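(* Let $\alpha\ge0$ be real, $r\ge1$ an integer, $1\le s\le\infty$, $1\le p\le\infty$ and $\mu>r+1-1/s$. Let $0<a_1\le a_2$ be constants. Then there are constants $0<c'\le c''$, not depending on $\delta$ and $N$, such that for every $0<\delta<1$ and every integer $N\ge1$ with $a_1\delta^{-1/(\mu+1/s-1/p)}\le N\le a_2\delta^{-1/(\mu+1/s-1/p)}$ $$c'\,\delta^{(\mu+1/s-1-r)/(\mu+1/s-1/p)}\le R^r_{N,\delta}\bigl(W_s^\mu,\Psi_N,C,\ell_p\bigr)\le c''\,\delta^{(\mu+1/s-1-r)/(\mu+1/s-1/p)}$$ and $$c'\,N^{-(\mu+1/s-1-r)}\le\delta^{(\mu+1/s-1-r)/(\mu+1/s-1/p)}\le c''\,N^{-(\mu+1/s-1-r)} .$$ Moreover, the upper estimate is attained in order on the methods of $\mathcal{S}^\theta$ with $\theta>0$, $\theta>\mu+1/s-1-r$: for every such $\theta$ and every array $\nu$ defining a method in $\mathcal{S}^\theta$ there is a constant $c>0$, not depending on $\delta$ and $N$, such that for every $0<\delta<1$ and every integer $N\ge1$ with $a_1\delta^{-1/(\mu+1/s-1/p)}\le N\le a_2\delta^{-1/(\mu+1/s-1/p)}$ the algorithm $\psi^N G_\Omega$, where $\psi^N\mathbf{y}=(S_N^\nu\mathbf{y})^{(r)}$ and $\Omega=\{k\in\mathbb{N}_0: r\le k\le N\}$, belongs to $\Psi_N$ and satisfies $e_\delta(W_s^\mu,\psi^N G_\Omega,C,\ell_p)\le c\,\delta^{(\mu+1/s-1-r)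/(\mu+1/s-1/p)}$.
   Context: $w(t)=t^\alpha e^{-t}$ on $(0,\infty)$; $L_{2,w}$ is the Hilbert space of real-valued functions on $(0,\infty)$ square-summable with weight $w$, with $\langle f,g\rangle=\int_0^\infty w f g\,dt$. $L_k^{(\alpha)}$ are the Laguerre polynomials and $\ell_k^{(\alpha)}=(k!/\Gamma(k+\alpha+1))^{1/2}L_k^{(\alpha)}$, $k\in\mathbb{N}_0$, is the corresponding orthonormal system (a basis of $L_{2,w}$). $C$ is the space of all real-valued continuous functions on $(0,\infty)$ (not necessarily bounded), and $\|g\|_C=\sup_{t>0}|g(t)|\in[0,+\infty]$. Conventions: $1/\infty=0$. With $\underline{k}=\max\{1,k\}$: $\|f\|_{s,\mu}=\bigl(\sum_{k\ge0}\underline{k}^{s\mu}|\langle f,\ell_k^{(\alpha)}\rangle|^s\bigr)^{1/s}$ for $1\le s<\infty$, $\|f\|_{\infty,\mu}=\sup_{k\ge0}\underline{k}^{\mu}|\langle f,\ell_k^{(\alpha)}\rangle|$; here $W_s^\mu$ denotes the unit ball $\{f\in L_{2,w}:\|f\|_{s,\mu}\le1\}$. For $\mu>r+1-1/s$ each $f\in W_s^\mu$ is identified with its representative of class $C^r$ on $(0,\infty)$ (which exists), and $f^{(r)}$ is its $r$-th derivative. For a triangular array of real numbers $\nu=\{\nu_k^N\}$, $0\le k\le N$, $N\in\mathbb{N}$, put $S_N^\nu\mathbf{y}(t)=\sum_{k=0}^N\nu_k^N y_k\,\ell_k^{(\alpha)}(t)$. For $\theta>0$, $\mathcal{S}^\theta$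 is the class of all such methods for which there is $C(\nu)>0$ with $|1-\nu_k^N|\le C(\nu)(k/N)^\theta$ for all $N\in\mathbb{N}$, $0\le k\le N$ (with $0^\theta=0$). $G:L_{2,w}\to\ell_2$, $Gf=(\langle f,\ell_k^{(\alpha)}\rangle)_{k\in\mathbb{N}_0}$. For finite $\Omega\subset\mathbb{N}_0$, $P_\Omega$ is the coordinate projection of sequences keeping the entries with indices in $\Omega$ (others set to $0$) and $G_\Omega=P_\Omega G$. A recovery operator is an arbitrary mapping $\psi:\ell_{\max\{p,2\}}\to C$ (no linearity or continuity is required). $\Psi_N$ is the set of all $\psi G_\Omega$ with $\psi$ a recovery operator and $\operatorname{card}(\Omega)\le N$. The error is $$e_\delta(W_s^\mu,\psi G_\Omega,C,\ell_p)=\sup_{f\in W_s^\mu}\ \sup_{\|\boldsymbol{\xi}\|_{\ell_p}\le\delta}\bigl\|\bigl(f^{(r)}-\psi(G_\Omega f+\boldsymbol{\xi})\bigr)\sqrt{w}\bigr\|_C ,$$ the inner supremum being over real sequences $\boldsymbol{\xi}$. The minimal radius of Galerkin information is $R^r_{N,\delta}(W_s^\mu,\Psi_N,C,\ell_p)=\inf_{\psi G_\Omega\in\Psi_N}e_\delta(W_s^\mu,\psi G_\Omega,C,\ell_p)$. *)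

theory Defs
  imports "HOL-Analysis.Analysis"
begin

text \<open>
  Functions on \<open>(0, \<infinity>)\<close> are total functions \<open>real \<Rightarrow> real\<close>; their values outside \<open>{0<..}\<close> are
  irrelevant. Exponents from \<open>[1, \<infinity>]\<close> are of type \<open>ennreal\<close>, and norms, errors and radii are
  \<open>ennreal\<close>-valued, so that every supremum, infimum and series below exists.
\<close>

definition recip :: "ennreal \<Rightarrow> real" where
  "recip s = enn2real (1 / s)"

lemma recip_top: "recip \<infinity> = 0"
  by (simp add: recip_def)

lemma recip_ennreal: "0 < x \<Longrightarrow> recip (ennreal x) = 1 / x"
  by (metis divide_ennreal enn2real_ennreal ennreal_1 less_imp_le recip_def zero_le_divide_1_iff
      zero_le_one)

subsection \<open>The weighted space and the Laguerre system\<close>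

definition w :: "real \<Rightarrow> real \<Rightarrow> real" where
  "w \<alpha> t = t powr \<alpha> * exp (- t)"

text \<open>Elements are functions, not classes modulo equality almost everywhere.\<close>

definition L2w :: "real \<Rightarrow> (real \<Rightarrow> real) set" where
  "L2w \<alpha> = {f. f \<in> borel_measurable (lebesgue_on {0<..})
              \<and> set_integrable lebesgue {0<..} (\<lambda>t. w \<alpha> t * (f t)\<^sup>2)}"

definition inner_w :: "real \<Rightarrow> (real \<Rightarrow> real) \<Rightarrow> (real \<Rightarrow> real) \<Rightarrow> real" where
  "inner_w \<alpha> f g = (LINT t:{0<..}|lebesgue. w \<alpha> t * f t * g t)"

definition Laguerre :: "real \<Rightarrow> nat \<Rightarrow> real \<Rightarrow> real" where
  "Laguerre \<alpha> k t = (\<Sum>j=0..k. (- 1) ^ j * ((real k + \<alpha>) gchoose (k - j)) * t ^ j / fact j)"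

definition laguerre_on :: "real \<Rightarrow> nat \<Rightarrow> real \<Rightarrow> real" where
  "laguerre_on \<alpha> k t = sqrt (fact k / Gamma (real k + \<alpha> + 1)) * Laguerre \<alpha> k t"

definition G :: "real \<Rightarrow> (real \<Rightarrow> real) \<Rightarrow> nat \<Rightarrow> real" where
  "G \<alpha> f = (\<lambda>k. inner_w \<alpha> f (laguerre_on \<alpha> k))"

definition proj :: "nat set \<Rightarrow> (nat \<Rightarrow> real) \<Rightarrow> nat \<Rightarrow> real" where
  "proj \<Omega> y = (\<lambda>k. if k \<in> \<Omega> then y k else 0)"

subsection \<open>Norms\<close>

definition ell_norm :: "ennreal \<Rightarrow> (nat \<Rightarrow> real) \<Rightarrow> ennreal" where
  "ell_norm p x =
     (if p = \<infinity> then (SUP k. ennreal \<bar>x k\<bar>)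
      else (let S = (\<Sum>k. ennreal (\<bar>x k\<bar> powr enn2real p))
            in if S = \<infinity> then \<infinity> else ennreal (enn2real S powr (1 / enn2real p))))"

definition ell :: "ennreal \<Rightarrow> (nat \<Rightarrow> real) set" where
  "ell p = {x. ell_norm p x < \<infinity>}"

definition smooth_norm :: "real \<Rightarrow> ennreal \<Rightarrow> real \<Rightarrow> (real \<Rightarrow> real) \<Rightarrow> ennreal" where
  "smooth_norm \<alpha> s \<mu> f = ell_norm s (\<lambda>k. real (max 1 k) powr \<mu> * \<bar>G \<alpha> f k\<bar>)"

definition W_ball :: "real \<Rightarrow> ennreal \<Rightarrow> real \<Rightarrow> (real \<Rightarrow> real) set" where
  "W_ball \<alpha> s \<mu> = {f \<in> L2w \<alpha>. smooth_norm \<alpha> s \<mu> f \<le> 1}"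

definition C_pos :: "(real \<Rightarrow> real) set" where
  "C_pos = {g. continuous_on {0<..} g}"

definition C_norm :: "(real \<Rightarrow> real) \<Rightarrow> ennreal" where
  "C_norm g = (SUP t\<in>{0<..}. ennreal \<bar>g t\<bar>)"

subsection \<open>Derivatives\<close>

definition Cr_pos :: "nat \<Rightarrow> (real \<Rightarrow> real) set" where
  "Cr_pos r = {g. (\<forall>j<r. \<forall>t>0. (deriv ^^ j) g field_differentiable at t)
                \<and> continuous_on {0<..} ((deriv ^^ r) g)}"

text \<open>
  The derivative of order \<open>r\<close> of the representative of class \<open>C\<^sup>r\<close> of \<open>f\<close>. Two continuous functions
  that agree almost everywhere on \<open>(0, \<infinity>)\<close> agree there, so on \<open>(0, \<infinity>)\<close> the result does not depend
  on the choice made by \<open>SOME\<close>.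
\<close>

definition rth_deriv :: "nat \<Rightarrow> (real \<Rightarrow> real) \<Rightarrow> real \<Rightarrow> real" where
  "rth_deriv r f = (deriv ^^ r) (SOME g. g \<in> Cr_pos r \<and> (AE t in lebesgue_on {0<..}. g t = f t))"

subsection \<open>Recovery, error and minimal radius\<close>

text \<open>
  An algorithm \<open>\<psi> G\<^sub>\<Omega>\<close> is represented by the pair \<open>(\<psi>, \<Omega>)\<close>; values of \<open>\<psi>\<close> outside
  \<open>ell (max p 2)\<close> are irrelevant.
\<close>

definition Psi :: "ennreal \<Rightarrow> nat \<Rightarrow> (((nat \<Rightarrow> real) \<Rightarrow> real \<Rightarrow> real) \<times> nat set) set" where
  "Psi p N = {(\<psi>, \<Omega>). \<psi> \<in> ell (max p 2) \<rightarrow> C_pos \<and> finite \<Omega> \<and> card \<Omega> \<le> N}"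

definition err :: "real \<Rightarrow> nat \<Rightarrow> ennreal \<Rightarrow> real \<Rightarrow> ennreal \<Rightarrow> real
    \<Rightarrow> ((nat \<Rightarrow> real) \<Rightarrow> real \<Rightarrow> real) \<times> nat set \<Rightarrow> ennreal" where
  "err \<alpha> r s \<mu> p \<delta> = (\<lambda>(\<psi>, \<Omega>).
     SUP f\<in>W_ball \<alpha> s \<mu>. SUP \<xi>\<in>{\<xi>. ell_norm p \<xi> \<le> ennreal \<delta>}.
       C_norm (\<lambda>t. (rth_deriv r f t - \<psi> (\<lambda>k. proj \<Omega> (G \<alpha> f) k + \<xi> k) t) * sqrt (w \<alpha> t)))"

definition radius :: "real \<Rightarrow> nat \<Rightarrow> ennreal \<Rightarrow> real \<Rightarrow> ennreal \<Rightarrow> real \<Rightarrow> nat \<Rightarrow> ennreal" where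
  "radius \<alpha> r s \<mu> p \<delta> N = (INF A\<in>Psi p N. err \<alpha> r s \<mu> p \<delta> A)"

subsection \<open>Summation methods\<close>

text \<open>An array is a function \<open>\<nu>\<close> with \<open>\<nu> N k\<close> the entry \<open>\<nu>\<^sub>k\<^sup>N\<close>; only entries with \<open>k \<le> N\<close>, \<open>1 \<le> N\<close> matter.\<close>

definition S_op :: "real \<Rightarrow> (nat \<Rightarrow> nat \<Rightarrow> real) \<Rightarrow> nat \<Rightarrow> (nat \<Rightarrow> real) \<Rightarrow> real \<Rightarrow> real" where
  "S_op \<alpha> \<nu> N y t = (\<Sum>k=0..N. \<nu> N k * y k * laguerre_on \<alpha> k t)"

definition S_class :: "real \<Rightarrow> (nat \<Rightarrow> nat \<Rightarrow> real) set" where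
  "S_class \<theta> = {\<nu>. \<exists>C>0. \<forall>N\<ge>1. \<forall>k\<le>N. \<bar>1 - \<nu> N k\<bar> \<le> C * (real k / real N) powr \<theta>}"

definition psi_S :: "real \<Rightarrow> nat \<Rightarrow> (nat \<Rightarrow> nat \<Rightarrow> real) \<Rightarrow> nat \<Rightarrow> (nat \<Rightarrow> real) \<Rightarrow> real \<Rightarrow> real" where
  "psi_S \<alpha> r \<nu> N y = (deriv ^^ r) (S_op \<alpha> \<nu> N y)"

text \<open>\<open>\<kappa>\<close> is the smoothness balance \<open>\<mu> + 1/s - 1/p\<close>.\<close>

definition coupled :: "real \<Rightarrow> real \<Rightarrow> real \<Rightarrow> real \<Rightarrow> nat \<Rightarrow> bool" where
  "coupled a\<^sub>1 a\<^sub>2 \<kappa> \<delta> N \<longleftrightarrow> 0 < \<delta> \<and> \<delta> < 1 \<and> 1 \<le> N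
     \<and> a\<^sub>1 * \<delta> powr (- 1 / \<kappa>) \<le> real N \<and> real N \<le> a\<^sub>2 * \<delta> powr (- 1 / \<kappa>)"

end

theory Submission
  imports Defs "HOL-Real_Asymp.Real_Asymp"
begin

text \<open>
  Everything rests on the bound \<open>\<bar>\<ell>\<^sub>k\<^bsup>(r)\<^esup>\<bar> \<surd>w = O(k\<^sup>r)\<close>, uniformly on \<open>(0, \<infinity>)\<close>, for \<open>r \<ge> 1\<close>. For an integer
  parameter \<open>m\<close> the numbers \<open>L\<^sub>k\<^bsup>(j - k)\<^esup>(t)\<close> are the Charlier polynomials in \<open>j\<close>, and their norm with
  respect to the Poisson distribution bounds \<open>t\<^sup>m e\<^sup>-\<^sup>t L\<^sub>k\<^bsup>(m)\<^esup>(t)\<^sup>2\<close> by \<open>(k + m)! / k!\<close>; a real parameter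
  \<open>\<alpha> + r\<close> is reached from an integer between \<open>\<alpha>\<close> and \<open>\<alpha> + r\<close> by a sum with nonnegative coefficients.
  Since \<open>r \<ge> 1\<close>, the Laguerre series of \<open>f\<close> and its first \<open>r\<close> derivatives then converge locally uniformly, and
  completeness of the Laguerre system identifies the sum with \<open>f\<close>. The upper estimate follows from
  Hoelder's inequality on dyadic blocks. For the lower estimate, take the sum of the \<open>\<ell>\<^sub>k\<close> with
  \<open>k \<notin> \<Omega>\<close> of order \<open>N\<close>, with equal coefficients: the information does not distinguish it from its negative,
  and near \<open>0\<close>, at \<open>t = 1 / (12 N)\<close>, the weighted \<open>r\<close>-th derivatives of all its terms have the same sign and
  the maximal order \<open>N\<^sup>r\<close>, so that nothing cancels. No noise is needed.
\<close>



text \<open>Write E = \<mu> + 1/s - 1 - r and \<kappa> = \<mu> + 1/s - 1/p. The coupling makes three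
  errors balance at order N^(-E): the tail beyond N, the defect 1 - \<nu> of the multipliers, and
  the noise, which contributes N^r * \<delta> * N^(1 - 1/p) with \<delta> of order N^(-\<kappa>).
  The upper estimate uses the norm bound of the class only through partial sums: those of k^\<mu>
  |c_k| over 1 \<le> k \<le> n are at most n^(1 - 1/s) for every n. In this way all s, infinity
  included, are treated alike. The obstacle to completeness is that on a half-line moments need not
  determine a function. Here the weight leaves an exponential moment to spare, and x = exp (- (c/2)
  t) carries the problem to [0, 1], where Weierstrass approximation applies.\<close>

section \<open>Laguerre polynomials as functions of their parameter\<close>

text \<open>The binomial coefficient \<open>n + a\<close> over \<open>n\<close>, written as a rising
  factorial because positivity for \<open>0 \<le> a\<close> and the convolution in \<open>a\<close>
  are visible in this form.\<close>

definition rbinom :: "real \<Rightarrow> nat \<Rightarrow> real" where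
  "rbinom a n = pochhammer (a + 1) n / fact n"

lemma rbinom_pos: "0 \<le> a \<Longrightarrow> 0 < rbinom a n"
  by (simp add: rbinom_def pochhammer_pos)

lemma pochhammer_nonneg': "0 \<le> b \<Longrightarrow> 0 \<le> pochhammer b n" for b :: real
  by (simp add: pochhammer_prod prod_nonneg)

lemma rbinom_0 [simp]: "rbinom a 0 = 1"
  by (simp add: rbinom_def)

lemma rbinom_of_nat: "rbinom (real m) n = real ((n + m) choose n)"
proof -
  have "rbinom (real m) n = real (n + m) gchoose n"
    by (simp add: rbinom_def gbinomial_pochhammer' algebra_simps)
  then show ?thesis by (simp add: binomial_gbinomial)
qed

text \<open>Vandermonde's convolution for rising factorials, divided by n!.\<close>

lemma rbinom_add:
  "rbinom (a + b) n = (\<Sum>k\<le>n. pochhammer b (n - k) / fact (n - k) * rbinom a k)"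
proof -
  have "pochhammer (a + 1 + b) n / fact n
      = (\<Sum>k\<le>n. real (n choose k) * pochhammer (a + 1) k * pochhammer b (n - k)) / fact n"
    by (simp add: pochhammer_binomial_sum)
  also have "\<dots> = (\<Sum>k\<le>n. pochhammer b (n - k) / fact (n - k) * rbinom a k)"
    unfolding sum_divide_distrib
    by (rule sum.cong) (auto simp: rbinom_def binomial_fact field_simps)
  finally show ?thesis by (simp add: rbinom_def algebra_simps)
qed

text \<open>With the sign moved into the power of \<open>- t\<close>, the remaining coefficients are
  positive for \<open>0 \<le> a\<close>, and the parameter grows with the power. Differentiation and
  addition of parameters both act on this form coefficient by coefficient.\<close>

lemma Laguerre_altdef:
  "Laguerre a n t = (\<Sum>j\<le>n. (- t) ^ j / fact j * rbinom (a + real j) (n - j))"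
proof -
  have "(real n + a) gchoose (n - j) = rbinom (a + real j) (n - j)" if "j \<le> n" for j
  proof -
    have "real n + a - real (n - j) + 1 = a + real j + 1" using that by (simp add: of_nat_diff)
    then show ?thesis unfolding gbinomial_pochhammer' rbinom_def by simp
  qed
  then show ?thesis
    unfolding Laguerre_def atLeast0AtMost
    by (intro sum.cong) (auto simp: power_minus[of t])
qed

text \<open>Raising the parameter by \<open>b\<close> multiplies the generating function in the
  degree by (1 - z)^(-b), whose coefficients are the factors here. They are nonnegative for
  \<open>0 \<le> b\<close>, so absolute bounds carry over from parameter \<open>a\<close> to
  \<open>a + b\<close>.\<close>

lemma Laguerre_add:
  "Laguerre (a + b) n t = (\<Sum>k\<le>n. pochhammer b (n - k) / fact (n - k) * Laguerre a k t)"
proof -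
  have 1: "rbinom (a + b + real j) (n - j)
      = (\<Sum>k=j..n. pochhammer b (n - k) / fact (n - k) * rbinom (a + real j) (k - j))"
    if "j \<le> n" for j
  proof -
    have "rbinom (a + real j + b) (n - j) = (\<Sum>k\<le>n - j. pochhammer b (n - j - k)
        / fact (n - j - k) * rbinom (a + real j) k)"
      by (rule rbinom_add)
    also have "\<dots> = (\<Sum>k=j..n. pochhammer b (n - k) / fact (n - k) * rbinom (a + real j) (k - j))"
      using that by (intro sum.reindex_bij_witness[of _ "\<lambda>k. k - j" "\<lambda>k. k + j"]) (auto simp: add.commute)
    finally show ?thesis by (simp add: algebra_simps)
  qed
  have "Laguerre (a + b) n t = (\<Sum>j\<le>n. \<Sum>k=j..n. (- t) ^ j / fact j *
      (pochhammer b (n - k) / fact (n - k) * rbinom (a + real j) (k - j)))"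
    unfolding Laguerre_altdef sum_distrib_left[symmetric] by (intro sum.cong) (auto simp: 1)
  also have "\<dots> = (\<Sum>k\<le>n. \<Sum>j\<le>k. (- t) ^ j / fact j *
      (pochhammer b (n - k) / fact (n - k) * rbinom (a + real j) (k - j)))"
    by (simp add: sum.Sigma)
      (rule sum.reindex_bij_witness[of _ "\<lambda>(k, j). (j, k)" "\<lambda>(k, j). (j, k)"]; auto)
  also have "\<dots> = (\<Sum>k\<le>n. pochhammer b (n - k) / fact (n - k) * Laguerre a k t)"
    unfolding Laguerre_altdef sum_distrib_left by (intro sum.cong) (auto simp: mult_ac)
  finally show ?thesis .
qed

lemma Laguerre_sum: "Laguerre (a + 1) n t = (\<Sum>k\<le>n. Laguerre a k t)"
  unfolding Laguerre_add by (simp add: pochhammer_fact[symmetric])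

text \<open>Lowers the parameter by one at the price of a second term; this is how the
  undifferentiated functions are reached from parameter \<open>a + 1\<close>.\<close>

lemma Laguerre_diff: "Laguerre a (Suc n) t = Laguerre (a + 1) (Suc n) t - Laguerre (a + 1) n t"
  by (simp add: Laguerre_sum)

lemma has_field_derivative_Laguerre:
  "(Laguerre a (Suc n) has_field_derivative - Laguerre (a + 1) n t) (at t)"
proof -
  have "((\<lambda>t. \<Sum>j\<le>Suc n. (- t) ^ j / fact j * rbinom (a + real j) (Suc n - j))
     has_field_derivative (\<Sum>j\<le>Suc n. (real j * (- t) ^ (j - 1) * - 1) / fact j *
        rbinom (a + real j) (Suc n - j))) (at t)"
  proof (rule DERIV_sum)
    fix j
    have "((\<lambda>t. (- t) ^ j) has_field_derivative real j * (- t) ^ (j - 1) * - 1) (at t)"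
      using DERIV_power[OF DERIV_minus[OF DERIV_ident], of j t UNIV] by (simp add: mult_ac)
    from DERIV_cmult_right[OF DERIV_cdivide[OF this]]
    show "((\<lambda>t. (- t) ^ j / fact j * rbinom (a + real j) (Suc n - j)) has_field_derivative
        (real j * (- t) ^ (j - 1) * - 1) / fact j * rbinom (a + real j) (Suc n - j)) (at t)" .
  qed
  also have "(\<Sum>j\<le>Suc n. (real j * (- t) ^ (j - 1) * - 1) / fact j * rbinom (a + real j) (Suc n - j))
     = (\<Sum>j\<le>n. (real (Suc j) * (- t) ^ j * - 1) / fact (Suc j) * rbinom (a + real (Suc j)) (n - j))"
    by (subst sum.atMost_Suc_shift) (simp del: of_nat_Suc fact_Suc)
  also have "\<dots> = (\<Sum>j\<le>n. - ((- t) ^ j / fact j * rbinom (a + 1 + real j) (n - j)))"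
  proof (rule sum.cong)
    fix j
    have "a + real (Suc j) = a + 1 + real j" "real (Suc j) * (- t) ^ j * - 1 / fact (Suc j) = - ((- t) ^ j / fact j)"
      by (simp_all del: of_nat_Suc)
    then show "(real (Suc j) * (- t) ^ j * - 1) / fact (Suc j) * rbinom (a + real (Suc j)) (n - j) =
        - ((- t) ^ j / fact j * rbinom (a + 1 + real j) (n - j))" by (simp only: mult_minus_left)
  qed simp
  also have "\<dots> = - Laguerre (a + 1) n t"
    unfolding Laguerre_altdef sum_negf ..
  finally show ?thesis by (simp add: Laguerre_altdef[abs_def])
qed

lemma Laguerre_0 [simp]: "Laguerre a 0 t = 1"
  by (simp add: Laguerre_altdef)

lemma continuous_on_Laguerre [continuous_intros]: "continuous_on S (Laguerre a n)"
  unfolding Laguerre_altdef[abs_def] by (intro continuous_intros) auto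

lemma borel_measurable_Laguerre [measurable]: "Laguerre a n \<in> borel_measurable borel"
  by (intro borel_measurable_continuous_onI continuous_on_Laguerre)

subsection \<open>Growth of generalized binomial coefficients\<close>

text \<open>Gauss's limit formula for 1/Gamma, corrected by a factor tending to 1.
  \<open>Suc n\<close> instead of \<open>n\<close> keeps the quotient meaningful at
  \<open>n = 0\<close>.\<close>

lemma rbinom_asymp:
  assumes "0 \<le> a"
  shows "(\<lambda>n. rbinom a n / real (Suc n) powr a) \<longlonglongrightarrow> rGamma (a + 1)"
proof -
  have "(\<lambda>n. rGamma_series (a + 1) n * (real n powr (a + 1) / ((a + 1 + real n) * real (Suc n) powr a)))
      \<longlonglongrightarrow> rGamma (a + 1) * 1"
  proof (intro tendsto_mult rGamma_series_LIMSEQ)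
    show "(\<lambda>n. real n powr (a + 1) / ((a + 1 + real n) * real (Suc n) powr a)) \<longlonglongrightarrow> 1"
      using assms by real_asymp
  qed
  moreover have "\<forall>\<^sub>F n in sequentially. rGamma_series (a + 1) n *
      (real n powr (a + 1) / ((a + 1 + real n) * real (Suc n) powr a)) = rbinom a n / real (Suc n) powr a"
    using eventually_gt_at_top[of 0]
  proof eventually_elim
    case (elim n)
    have "exp ((a + 1) * of_real (ln (of_nat n))) = real n powr (a + 1)"
      using elim by (simp add: powr_def)
    moreover have "pochhammer (a + 1) (n + 1) = pochhammer (a + 1) n * (a + 1 + real n)"
      by (simp only: pochhammer_Suc Suc_eq_plus1[symmetric])
    moreover have "a + 1 + real n \<noteq> 0" using assms by simp
    moreover have "P * D / (F * X) * (X / (D * Y)) = P / F / Y" if "D \<noteq> 0" "X \<noteq> 0" for P D F X Y :: real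
      using that by (simp add: divide_simps)
    ultimately show ?case
      using elim unfolding rGamma_series_def rbinom_def by simp
  qed
  ultimately show ?thesis by (simp add: tendsto_cong)
qed

text \<open>The quotient in \<open>rbinom_asymp\<close> and its reciprocal both converge, hence are
  bounded; so the two bounds hold for every \<open>n\<close>, not only eventually.\<close>

lemma rbinom_bounds:
  assumes "0 \<le> a"
  obtains c C where "0 < c" "0 < C"
    "\<And>n. c * real (Suc n) powr a \<le> rbinom a n" "\<And>n. rbinom a n \<le> C * real (Suc n) powr a"
proof -
  let ?q = "\<lambda>n. rbinom a n / real (Suc n) powr a"
  have q: "?q n > 0" for n by (simp add: rbinom_pos assms)
  have lim: "?q \<longlonglongrightarrow> rGamma (a + 1)" by (rule rbinom_asymp[OF assms])
  have pos: "rGamma (a + 1) > 0"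
    using assms by (simp add: rGamma_inverse_Gamma)
  have "Bseq ?q" using lim by (intro convergent_imp_Bseq convergentI)
  then obtain C where C: "C > 0" "\<And>n. norm (?q n) \<le> C" by (elim BseqE) blast
  have "(\<lambda>n. inverse (?q n)) \<longlonglongrightarrow> inverse (rGamma (a + 1))"
    using lim pos by (intro tendsto_inverse) auto
  then have "Bseq (\<lambda>n. inverse (?q n))" by (intro convergent_imp_Bseq convergentI)
  then obtain D where D: "D > 0" "\<And>n. norm (inverse (?q n)) \<le> D" by (elim BseqE) blast
  show ?thesis
  proof (rule that)
    show "0 < inverse D" "0 < C" using C D by auto
    show "rbinom a n \<le> C * real (Suc n) powr a" for n
      using C(2)[of n] q[of n] by (simp add: divide_le_eq)
    show "inverse D * real (Suc n) powr a \<le> rbinom a n" for n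
    proof -
      have "inverse (?q n) \<le> D" using D(2)[of n] rbinom_pos[OF assms, of n] by simp
      then have "inverse D \<le> ?q n"
        using q[of n] D(1) by (metis inverse_inverse_eq inverse_positive_iff_positive le_imp_inverse_le)
      then show ?thesis by (simp add: le_divide_eq)
    qed
  qed
qed

subsection \<open>Charlier polynomials and the case of integer parameters\<close>

text \<open>\<open>charlier n j t\<close> is the coefficient of \<open>z\<^sup>n\<close> in \<open>exp (- t z) (1 + z)\<^sup>j\<close>, that is
  \<open>L\<^sub>n\<^bsup>(j - n)\<^esup>(t)\<close>. For fixed \<open>n\<close> these are, up to a factor, the Charlier polynomials in \<open>j\<close>,
  orthogonal with respect to the Poisson distribution with parameter \<open>t\<close>.\<close>

definition charlier :: "nat \<Rightarrow> nat \<Rightarrow> real \<Rightarrow> real" where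
  "charlier n j t = (\<Sum>i\<le>n. (- t) ^ i / fact i * real (j choose (n - i)))"

lemma charlier_eq_Laguerre: "charlier n (n + m) t = Laguerre (real m) n t"
  unfolding charlier_def Laguerre_altdef
proof (intro sum.cong refl)
  fix i assume "i \<in> {..n}"
  then have "rbinom (real (m + i)) (n - i) = real ((n + m) choose (n - i))"
    unfolding rbinom_of_nat by (simp add: algebra_simps)
  then show "(- t) ^ i / fact i * real ((n + m) choose (n - i)) =
      (- t) ^ i / fact i * rbinom (real m + real i) (n - i)"
    by simp
qed

text \<open>Multiplication of the generating function by 1 + z, that is, Pascal's rule. It exhibits
  the polynomial of index \<open>n\<close> as the forward difference in \<open>j\<close> of the next
  one.\<close>

lemma charlier_Suc_shift: "charlier (Suc n) (Suc j) t = charlier (Suc n) j t + charlier n j t"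
proof -
  have "charlier (Suc n) (Suc j) t = (\<Sum>i\<le>n. (- t) ^ i / fact i * real (Suc j choose (Suc (n - i))))
     + (- t) ^ Suc n / fact (Suc n)"
    unfolding charlier_def by (simp add: Suc_diff_le)
  also have "\<dots> = charlier (Suc n) j t + charlier n j t"
    unfolding charlier_def by (simp add: Suc_diff_le sum.distrib algebra_simps)
  finally show ?thesis .
qed

text \<open>The z-derivative of exp (- t z) (1 + z)^j, read off coefficientwise: the factor n + 1 is
  split as i + (n + 1 - i), one part for each factor of the product. At \<open>j = 0\<close> the
  truncated \<open>j - 1\<close> is harmless, since it is multiplied by \<open>j\<close>.\<close>

lemma charlier_recurrence:
  "real (Suc n) * charlier (Suc n) j t = real j * charlier n (j - 1) t - t * charlier n j t"
proof -
  have 1: "real (Suc n) * charlier (Suc n) j t =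
      (\<Sum>i\<le>Suc n. (- t) ^ i / fact i * (real i * real (j choose (Suc n - i)))) +
      (\<Sum>i\<le>Suc n. (- t) ^ i / fact i * (real (Suc n - i) * real (j choose (Suc n - i))))"
    unfolding charlier_def sum_distrib_left sum.distrib[symmetric]
  proof (intro sum.cong refl)
    fix i assume "i \<in> {..Suc n}"
    then have "real (Suc n) = real i + real (Suc n - i)" by auto
    then show "real (Suc n) * ((- t) ^ i / fact i * real (j choose (Suc n - i))) =
      (- t) ^ i / fact i * (real i * real (j choose (Suc n - i))) +
      (- t) ^ i / fact i * (real (Suc n - i) * real (j choose (Suc n - i)))"
      by (simp only: algebra_simps)
  qed
  have 2: "(\<Sum>i\<le>Suc n. (- t) ^ i / fact i * (real i * real (j choose (Suc n - i))))
      = - t * charlier n j t"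
  proof -
    have "(- t) ^ Suc i / fact (Suc i) * (real (Suc i) * c) = - t * ((- t) ^ i / fact i * c)" for i c
      by (simp del: of_nat_Suc)
    then show ?thesis
      unfolding charlier_def sum.atMost_Suc_shift sum_distrib_left by (simp del: of_nat_Suc fact_Suc power_Suc)
  qed
  have "real (Suc n - i) * real (j choose (Suc n - i)) = real j * real ((j - 1) choose (n - i))"
    if "i \<le> n" for i
    using that times_binomial_minus1_eq[of "Suc n - i" j]
    by (metis Suc_diff_le diff_Suc_1 of_nat_mult zero_less_Suc)
  then have 3: "(\<Sum>i\<le>Suc n. (- t) ^ i / fact i * (real (Suc n - i) * real (j choose (Suc n - i))))
      = real j * charlier n (j - 1) t"
    unfolding charlier_def sum_distrib_left by (simp, intro sum.cong) auto
  show ?thesis unfolding 1 2 3 by simp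
qed

lemma charlier_0 [simp]: "charlier 0 j t = 1"
  by (simp add: charlier_def)

text \<open>A crude bound, geometric in \<open>j\<close>; its sole purpose is convergence of the
  Poisson sums.\<close>

lemma charlier_bound: "\<bar>charlier n j t\<bar> \<le> exp \<bar>t\<bar> * 2 ^ j"
proof -
  have "\<bar>charlier n j t\<bar> \<le> (\<Sum>i\<le>n. \<bar>t\<bar> ^ i / fact i * 2 ^ j)"
    unfolding charlier_def
  proof (rule order_trans[OF sum_abs], rule sum_mono)
    fix i
    have "real (j choose (n - i)) \<le> 2 ^ j"
      using binomial_le_pow2 by (metis numeral_power_eq_of_nat_cancel_iff of_nat_le_iff of_nat_numeral of_nat_power)
    then show "\<bar>(- t) ^ i / fact i * real (j choose (n - i))\<bar> \<le> \<bar>t\<bar> ^ i / fact i * 2 ^ j"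
      by (simp add: abs_mult power_abs[symmetric] mult_left_mono divide_right_mono)
  qed
  also have "\<dots> = (\<Sum>i<Suc n. \<bar>t\<bar> ^ i /\<^sub>R fact i) * 2 ^ j"
    by (simp add: sum_distrib_right sum_distrib_left lessThan_Suc_atMost divide_inverse_commute mult_ac)
  also have "\<dots> \<le> exp \<bar>t\<bar> * 2 ^ j"
    unfolding exp_def
    by (intro mult_right_mono sum_le_suminf summable_exp_generic) auto
  finally show ?thesis .
qed

lemma charlier_summable:
  "summable (\<lambda>j. t ^ j / fact j * (charlier n (j + a) t * charlier m (j + b) t))"
proof (rule summable_comparison_test)
  let ?K = "exp \<bar>t\<bar> * exp \<bar>t\<bar> * 2 ^ (a + b)"
  have "\<bar>charlier n (j + a) t * charlier m (j + b) t\<bar> \<le> ?K * 4 ^ j" for j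
  proof -
    have "\<bar>charlier n (j + a) t * charlier m (j + b) t\<bar> \<le> (exp \<bar>t\<bar> * 2 ^ (j + a)) * (exp \<bar>t\<bar> * 2 ^ (j + b))"
      unfolding abs_mult by (intro mult_mono charlier_bound) auto
    also have "\<dots> = ?K * (2 ^ j * 2 ^ j)"
      by (simp add: power_add)
    also have "(2::real) ^ j * 2 ^ j = 4 ^ j" by (simp flip: power_mult_distrib)
    finally show ?thesis .
  qed
  then have "norm (t ^ j / fact j * (charlier n (j + a) t * charlier m (j + b) t))
      \<le> \<bar>t\<bar> ^ j / fact j * (?K * 4 ^ j)" for j
    by (simp add: abs_mult power_abs mult_left_mono divide_right_mono)
  then show "\<exists>N. \<forall>j\<ge>N. norm (t ^ j / fact j * (charlier n (j + a) t * charlier m (j + b) t))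
      \<le> ?K * ((4 * \<bar>t\<bar>) ^ j /\<^sub>R fact j)"
    by (intro exI[of _ 0]) (auto simp: power_mult_distrib field_simps)
  show "summable (\<lambda>j. ?K * ((4 * \<bar>t\<bar>) ^ j /\<^sub>R fact j))"
    by (intro summable_mult summable_exp_generic)
qed

text \<open>For the weights t^j/j!, multiplication by \<open>j\<close> after a backward shift is
  \<open>t\<close> times the adjoint of the forward shift. Hence the recurrence in one factor and
  the difference rule in the other give (n + 1) |c_(n+1)|^2 = t <c_n, c_(n+1)(. + 1) - c_(n+1)> = t
  |c_n|^2. The weights lack the normalization exp (- t), whence the factor
  \<open>exp t\<close>.\<close>

lemma charlier_norm:
  "(\<Sum>j. t ^ j / fact j * (charlier n j t)\<^sup>2) = exp t * t ^ n / fact n"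
proof (induction n)
  case 0
  then show ?case by (simp add: exp_def field_simps)
next
  case (Suc n)
  define E where "E = (\<lambda>f. \<Sum>j. t ^ j / fact j * f j :: real)"
  define S where "S f \<longleftrightarrow> summable (\<lambda>j. t ^ j / fact j * f j :: real)" for f
  let ?c = "\<lambda>n j. charlier n j t"
  have S: "S (\<lambda>j. ?c n (j + a) * ?c m (j + b))" for n m a b
    unfolding S_def by (rule charlier_summable)
  have *: "t ^ j / fact j * (x - y) = t ^ j / fact j * x - t ^ j / fact j * y" for j x y
    by (rule right_diff_distrib)
  have Ediff: "E (\<lambda>j. f j - g j) = E f - E g" "S (\<lambda>j. f j - g j)" if "S f" "S g" for f g
    using that suminf_diff[of "\<lambda>j. t ^ j / fact j * f j" "\<lambda>j. t ^ j / fact j * g j"]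
      summable_diff[of "\<lambda>j. t ^ j / fact j * f j" "\<lambda>j. t ^ j / fact j * g j"]
    unfolding E_def S_def * by simp_all
  have Ecm: "E (\<lambda>j. c * f j) = c * E f" "S (\<lambda>j. c * f j)" if "S f" for f c
    using that suminf_mult[of "\<lambda>j. t ^ j / fact j * f j" c] summable_mult[of "\<lambda>j. t ^ j / fact j * f j" c]
    by (auto simp: E_def S_def mult.left_commute)
  have Eshift: "E (\<lambda>j. real j * f j) = t * E (\<lambda>j. f (Suc j))" "S (\<lambda>j. real j * f j)"
    if "S (\<lambda>j. f (Suc j))" for f
  proof -
    have eq: "t ^ Suc j / fact (Suc j) * (real (Suc j) * f (Suc j)) = t * (t ^ j / fact j * f (Suc j))" for j
      by (simp del: of_nat_Suc)
    have "summable (\<lambda>j. t ^ Suc j / fact (Suc j) * (real (Suc j) * f (Suc j)))"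
      unfolding eq using that unfolding S_def by (intro summable_mult)
    then have s: "summable (\<lambda>j. t ^ j / fact j * (real j * f j))"
      by (subst (asm) summable_Suc_iff)
    then show "S (\<lambda>j. real j * f j)" by (simp add: S_def)
    have "E (\<lambda>j. real j * f j) = (\<Sum>j. t ^ Suc j / fact (Suc j) * (real (Suc j) * f (Suc j)))"
      unfolding E_def using suminf_split_head[OF s] by simp
    also have "\<dots> = t * E (\<lambda>j. f (Suc j))"
      unfolding eq E_def using that unfolding S_def by (rule suminf_mult)
    finally show "E (\<lambda>j. real j * f j) = t * E (\<lambda>j. f (Suc j))" .
  qed
  have sq: "S (\<lambda>j. ?c n j * ?c m j)" for n m
    using S[of n 0 m 0] by simp
  have "real (Suc n) * E (\<lambda>j. (?c (Suc n) j)\<^sup>2) = E (\<lambda>j. real (Suc n) * (?c (Suc n) j)\<^sup>2)"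
    using Ecm(1)[OF sq[of "Suc n" "Suc n"]] by (simp add: power2_eq_square)
  \<comment> \<open>Only one of the two equal factors is expanded by the recurrence.\<close>
  also have "\<dots> = E (\<lambda>j. real j * (?c n (j - 1) * ?c (Suc n) j) - t * (?c n j * ?c (Suc n) j))"
  proof -
    have "real (Suc n) * (?c (Suc n) j)\<^sup>2 = (real (Suc n) * ?c (Suc n) j) * ?c (Suc n) j" for j
      by (simp add: power2_eq_square)
    also have "\<dots> j = real j * (?c n (j - 1) * ?c (Suc n) j) - t * (?c n j * ?c (Suc n) j)" for j
      unfolding charlier_recurrence by (simp add: algebra_simps)
    finally show ?thesis by simp
  qed
  also have "\<dots> = t * E (\<lambda>j. ?c n j * ?c (Suc n) (Suc j)) - t * E (\<lambda>j. ?c n j * ?c (Suc n) j)"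
  proof (subst Ediff)
    have *: "S (\<lambda>j. ?c n (Suc j - 1) * ?c (Suc n) (Suc j))" using S[of n 0 "Suc n" 1] by simp
    show "S (\<lambda>j. real j * (?c n (j - 1) * ?c (Suc n) j))" by (rule Eshift(2)[OF *])
    show "S (\<lambda>j. t * (?c n j * ?c (Suc n) j))" by (intro Ecm(2) sq)
    show "E (\<lambda>j. real j * (?c n (j - 1) * ?c (Suc n) j)) - E (\<lambda>j. t * (?c n j * ?c (Suc n) j)) =
       t * E (\<lambda>j. ?c n j * ?c (Suc n) (Suc j)) - t * E (\<lambda>j. ?c n j * ?c (Suc n) j)"
      using Eshift(1)[OF *] Ecm(1)[OF sq] by simp
  qed
  also have "\<dots> = t * E (\<lambda>j. ?c n j * ?c (Suc n) (Suc j) - ?c n j * ?c (Suc n) j)"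
    using Ediff(1)[of "\<lambda>j. ?c n j * ?c (Suc n) (Suc j)" "\<lambda>j. ?c n j * ?c (Suc n) j"] S[of n 0 "Suc n" 1] sq
    by (simp flip: right_diff_distrib)
  also have "\<dots> = t * E (\<lambda>j. (?c n j)\<^sup>2)"
    by (simp add: charlier_Suc_shift power2_eq_square algebra_simps)
  also have "\<dots> = t * (exp t * t ^ n / fact n)"
    using Suc.IH by (simp add: E_def)
  finally have "E (\<lambda>j. (?c (Suc n) j)\<^sup>2) = t * (exp t * t ^ n / fact n) / real (Suc n)"
    by (subst nonzero_eq_divide_eq) (auto simp: mult.commute)
  then show ?case unfolding E_def by (simp add: mult_ac)
qed

text \<open>All terms of the Poisson norm are nonnegative, so the single term
  \<open>j = k + m\<close> is at most the whole sum.\<close>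

lemma Laguerre_nat_sq_le:
  assumes "0 < t"
  shows "(Laguerre (real m) k t)\<^sup>2 * t ^ m * exp (- t) \<le> fact (k + m) / fact k"
proof -
  have "(\<Sum>j\<in>{k + m}. t ^ j / fact j * (charlier k j t)\<^sup>2) \<le> (\<Sum>j. t ^ j / fact j * (charlier k j t)\<^sup>2)"
    using charlier_summable[of t k 0 k 0] assms
    by (intro sum_le_suminf) (auto simp: power2_eq_square)
  then have "t ^ (k + m) / fact (k + m) * (Laguerre (real m) k t)\<^sup>2 \<le> exp t * t ^ k / fact k"
    unfolding charlier_norm by (simp add: charlier_eq_Laguerre)
  then have "t ^ k * (t ^ m * (Laguerre (real m) k t)\<^sup>2) \<le> t ^ k * (exp t * (fact (k + m) / fact k))"
    by (simp add: power_add field_simps)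
  then have "t ^ m * (Laguerre (real m) k t)\<^sup>2 \<le> exp t * (fact (k + m) / fact k)"
    by (rule mult_left_le_imp_le) (use assms in simp)
  then show ?thesis
    by (simp add: exp_minus field_simps)
qed

lemma fact_ratio_le: "fact (k + m) / fact k \<le> (fact m * real (Suc k) ^ m :: real)"
proof (induction m)
  case (Suc m)
  have "fact (k + Suc m) / fact k = real (k + Suc m) * (fact (k + m) / fact k)"
    by (simp add: field_simps)
  also have "\<dots> \<le> (real (Suc m) * real (Suc k)) * (fact m * real (Suc k) ^ m)"
    by (intro mult_mono Suc) (auto simp: algebra_simps)
  finally show ?case by (simp add: algebra_simps)
qed simp

lemma Laguerre_nat_le1:
  assumes "0 < t"
  shows "t powr (real m / 2) * exp (- t / 2) * \<bar>Laguerre (real m) k t\<bar>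
    \<le> sqrt (fact m) * real (Suc k) powr (real m / 2)"
proof (rule power2_le_imp_le)
  have 1: "(x powr (real m / 2))\<^sup>2 = x ^ m" if "x > 0" for x :: real
    using that by (simp add: powr_realpow[symmetric] powr_powr)
  have 2: "(exp (- t / 2))\<^sup>2 = exp (- t)"
    by (simp add: power2_eq_square flip: exp_add)
  have "(t powr (real m / 2) * exp (- t / 2) * \<bar>Laguerre (real m) k t\<bar>)\<^sup>2
      = (Laguerre (real m) k t)\<^sup>2 * t ^ m * exp (- t)"
    using assms unfolding power_mult_distrib 2 by (simp add: 1)
  also have "\<dots> \<le> fact m * real (Suc k) ^ m"
    using Laguerre_nat_sq_le[OF assms, of m k] fact_ratio_le[of k m] by linarith
  also have "\<dots> = (sqrt (fact m) * real (Suc k) powr (real m / 2))\<^sup>2"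
    unfolding power_mult_distrib by (subst 1) simp_all
  finally show "(t powr (real m / 2) * exp (- t / 2) * \<bar>Laguerre (real m) k t\<bar>)\<^sup>2
      \<le> (sqrt (fact m) * real (Suc k) powr (real m / 2))\<^sup>2" .
qed simp

text \<open>A bound without powers of \<open>t\<close>, for use near 0. At \<open>m = 0\<close> the
  previous bound has no power of \<open>t\<close> either; each increase of the parameter sums at
  most k + 1 such terms.\<close>

lemma Laguerre_nat_le2:
  assumes "0 < t"
  shows "exp (- t / 2) * \<bar>Laguerre (real m) k t\<bar> \<le> real (Suc k) ^ m"
proof (induction m arbitrary: k)
  case 0
  then show ?case using Laguerre_nat_le1[OF assms, of 0 k] assms by simp
next
  case (Suc m)
  have "exp (- t / 2) * \<bar>Laguerre (real (Suc m)) k t\<bar> = exp (- t / 2) * \<bar>\<Sum>i\<le>k. Laguerre (real m) i t\<bar>"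
    using Laguerre_sum[of "real m" k t] by (simp add: add.commute)
  also have "\<dots> \<le> (\<Sum>i\<le>k. exp (- t / 2) * \<bar>Laguerre (real m) i t\<bar>)"
    unfolding sum_distrib_left[symmetric] by (intro mult_left_mono sum_abs) auto
  also have "\<dots> \<le> (\<Sum>i\<le>k. real (Suc k) ^ m)"
  proof (rule sum_mono)
    fix i assume "i \<in> {..k}"
    then have "real (Suc i) ^ m \<le> real (Suc k) ^ m" by (intro power_mono) auto
    with Suc[of i] show "exp (- t / 2) * \<bar>Laguerre (real m) i t\<bar> \<le> real (Suc k) ^ m" by linarith
  qed
  finally show ?case by (simp add: algebra_simps)
qed

subsection \<open>Uniform bounds for real parameters\<close>

text \<open>The two bounds for integer parameters have equal order at t = 1/(k + 1). To the right of
  this point the missing power t^((m - a)/2) is paid for by powers of k + 1; to its left t^(a/2) is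
  itself at most (k + 1)^(-a/2).\<close>

lemma Laguerre_nat_interpolated:
  assumes "0 < t" "0 \<le> a" "a \<le> real m"
  shows "t powr (a / 2) * exp (- t / 2) * \<bar>Laguerre (real m) k t\<bar>
    \<le> sqrt (fact m) * real (Suc k) powr (real m - a / 2)"
proof (cases "t \<ge> 1 / real (Suc k)")
  case True
  have "t powr (a / 2) = t powr (real m / 2) * (1 / t) powr ((real m - a) / 2)"
    using assms by (simp add: powr_divide powr_diff[symmetric] diff_divide_distrib flip: powr_minus_divide powr_add)
  also have "\<dots> \<le> t powr (real m / 2) * real (Suc k) powr ((real m - a) / 2)"
  proof (intro mult_left_mono powr_mono2)
    show "1 / t \<le> real (Suc k)" using True assms(1) by (simp add: field_simps)
  qed (use assms in auto)
  finally have "t powr (a / 2) * exp (- t / 2) * \<bar>Laguerre (real m) k t\<bar>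
    \<le> real (Suc k) powr ((real m - a) / 2) * (t powr (real m / 2) * exp (- t / 2) * \<bar>Laguerre (real m) k t\<bar>)"
    by (simp add: mult_left_mono mult.left_commute mult.commute)
  also have "\<dots> \<le> real (Suc k) powr ((real m - a) / 2) * (sqrt (fact m) * real (Suc k) powr (real m / 2))"
    by (intro mult_left_mono Laguerre_nat_le1 assms) auto
  also have "\<dots> = sqrt (fact m) * real (Suc k) powr ((real m - a) / 2 + real m / 2)"
    by (simp add: powr_add)
  also have "(real m - a) / 2 + real m / 2 = real m - a / 2" by (simp add: field_simps)
  finally show ?thesis .
next
  case False
  have "t powr (a / 2) \<le> (1 / real (Suc k)) powr (a / 2)"
    using assms False by (intro powr_mono2) auto
  then have "t powr (a / 2) * (exp (- t / 2) * \<bar>Laguerre (real m) k t\<bar>)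
    \<le> (1 / real (Suc k)) powr (a / 2) * real (Suc k) ^ m"
    using assms by (intro mult_mono Laguerre_nat_le2) auto
  also have "\<dots> = 1 * real (Suc k) powr (real m - a / 2)"
    by (simp add: powr_divide powr_diff powr_realpow[symmetric] del: of_nat_Suc)
  also have "\<dots> \<le> sqrt (fact m) * real (Suc k) powr (real m - a / 2)"
    by (intro mult_right_mono) auto
  finally show ?thesis by (simp add: mult_ac)
qed

text \<open>As \<open>r \<ge> 1\<close>, there is an integer \<open>m\<close> between \<open>a\<close> and \<open>a + r\<close>; the sum representation of
  \<open>Laguerre (a + r)\<close> in terms of \<open>Laguerre m\<close> has nonnegative coefficients.\<close>

lemma Laguerre_bound:
  assumes a: "0 \<le> a" and r: "1 \<le> r"
  obtains B where "0 < B" "\<And>n t. 0 < t \<Longrightarrow>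
    t powr (a / 2) * exp (- t / 2) * \<bar>Laguerre (a + real r) n t\<bar> \<le> B * real (Suc n) powr (a / 2 + real r)"
proof -
  define m where "m = nat \<lceil>a\<rceil>"
  define b where "b = a + real r - real m"
  have m: "a \<le> real m" "real m \<le> a + 1" using a unfolding m_def by linarith+
  then have b: "0 \<le> b" using r unfolding b_def by simp
  have ar: "a + real r = real m + b" by (simp add: b_def)
  obtain C where C: "0 < C" "\<And>n. rbinom b n \<le> C * real (Suc n) powr b"
    using rbinom_bounds[OF b] by metis
  show ?thesis
  proof (rule that)
    show "0 < sqrt (fact m) * C" using C by simp
    fix n and t :: real assume t: "0 < t"
    let ?p = "\<lambda>k. pochhammer b k / fact k"
    have p: "0 \<le> ?p k" for k using pochhammer_nonneg'[OF b] by simp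
    have e: "0 \<le> real m - a / 2" using m a by simp
    have "t powr (a / 2) * exp (- t / 2) * \<bar>Laguerre (a + real r) n t\<bar>
      \<le> t powr (a / 2) * exp (- t / 2) * (\<Sum>k\<le>n. ?p (n - k) * \<bar>Laguerre (real m) k t\<bar>)"
    proof (rule mult_left_mono)
      show "\<bar>Laguerre (a + real r) n t\<bar> \<le> (\<Sum>k\<le>n. ?p (n - k) * \<bar>Laguerre (real m) k t\<bar>)"
        unfolding ar Laguerre_add
        by (rule order_trans[OF sum_abs]) (simp add: abs_mult pochhammer_nonneg' b)
    qed simp
    also have "\<dots> = (\<Sum>k\<le>n. ?p (n - k) * (t powr (a / 2) * exp (- t / 2) * \<bar>Laguerre (real m) k t\<bar>))"
      by (simp add: sum_distrib_left mult_ac)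
    also have "\<dots> \<le> (\<Sum>k\<le>n. ?p (n - k) * (sqrt (fact m) * real (Suc n) powr (real m - a / 2)))"
    proof (intro sum_mono mult_left_mono p)
      fix k assume k: "k \<in> {..n}"
      have "t powr (a / 2) * exp (- t / 2) * \<bar>Laguerre (real m) k t\<bar>
          \<le> sqrt (fact m) * real (Suc k) powr (real m - a / 2)"
        by (rule Laguerre_nat_interpolated[OF t a m(1)])
      also have "\<dots> \<le> sqrt (fact m) * real (Suc n) powr (real m - a / 2)"
        using k e by (intro mult_left_mono powr_mono2) auto
      finally show "t powr (a / 2) * exp (- t / 2) * \<bar>Laguerre (real m) k t\<bar>
          \<le> sqrt (fact m) * real (Suc n) powr (real m - a / 2)" .
    qed
    \<comment> \<open>The connection coefficients are summed by \<open>rbinom_add\<close> at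
      \<open>a = 0\<close>, where every \<open>rbinom 0 k\<close> is 1.\<close>
    also have "\<dots> = rbinom b n * (sqrt (fact m) * real (Suc n) powr (real m - a / 2))"
    proof -
      have "rbinom (0 + b) n = (\<Sum>k\<le>n. ?p (n - k) * rbinom 0 k)" by (rule rbinom_add)
      then have "rbinom b n = (\<Sum>k\<le>n. ?p (n - k))"
        by (simp add: rbinom_def pochhammer_fact[symmetric])
      then show ?thesis by (simp add: sum_distrib_right)
    qed
    also have "\<dots> \<le> (C * real (Suc n) powr b) * (sqrt (fact m) * real (Suc n) powr (real m - a / 2))"
      by (intro mult_right_mono C) auto
    also have "\<dots> = sqrt (fact m) * C * real (Suc n) powr (b + (real m - a / 2))"
      by (simp add: powr_add)
    \<comment> \<open>The auxiliary integer \<open>m\<close> leaves the exponent, so the detour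
      costs only a constant.\<close>
    also have "b + (real m - a / 2) = a / 2 + real r" by (simp add: b_def)
    finally show "t powr (a / 2) * exp (- t / 2) * \<bar>Laguerre (a + real r) n t\<bar>
      \<le> sqrt (fact m) * C * real (Suc n) powr (a / 2 + real r)" .
  qed
qed

text \<open>Near 0 the constant term dominates: the coefficient of t^j is at most n^j/j! times the
  constant term, so the other terms together are at most exp (n t) - 1 \<le> 1/2 times it.\<close>

lemma Laguerre_lower:
  assumes a: "0 \<le> a" and t: "0 \<le> t" "real n * t \<le> 1 / 4"
  shows "rbinom a n / 2 \<le> Laguerre a n t"
proof -
  have bound: "rbinom (a + real j) (n - j) \<le> rbinom a n * real n ^ j" if "j \<le> n" for j
    using that
  proof (induction j)
    case (Suc j)
    obtain i where i: "n - j = Suc i" using Suc.prems by (metis Suc_diff_Suc Suc_le_lessD)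
    then have i': "n - Suc j = i" by simp
    have "rbinom (a + real j) (Suc i) = (a + real j + 1) / real (Suc i) * rbinom (a + real (Suc j)) i"
      by (simp add: rbinom_def pochhammer_rec field_simps)
    \<comment> \<open>Passing from \<open>j\<close> to \<open>Suc j\<close> costs at most a factor
      \<open>n\<close>, because \<open>Suc i = n - j\<close> is at most \<open>n\<close> and the
      numerator is at least 1.\<close>
    moreover have "1 / real n \<le> (a + real j + 1) / real (Suc i)"
      using a i by (intro frac_le) auto
    ultimately have "1 / real n * rbinom (a + real (Suc j)) i \<le> rbinom (a + real j) (Suc i)"
      using rbinom_pos[of "a + real (Suc j)" i] a by (metis add_nonneg_nonneg less_imp_le mult_right_mono of_nat_0_le_iff)
    then have "rbinom (a + real (Suc j)) i \<le> real n * rbinom (a + real j) (Suc i)"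
      using Suc.prems by (simp add: field_simps)
    also have "\<dots> \<le> real n * (rbinom a n * real n ^ j)"
      using Suc i by (intro mult_left_mono) auto
    finally show ?case by (simp add: i' mult_ac)
  qed simp
  have "\<bar>Laguerre a n t - rbinom a n\<bar> = \<bar>\<Sum>j\<in>{..n} - {0}. (- t) ^ j / fact j * rbinom (a + real j) (n - j)\<bar>"
    unfolding Laguerre_altdef by (subst sum.remove[of _ 0]) auto
  also have "\<dots> \<le> (\<Sum>j\<in>{..n} - {0}. rbinom a n * ((real n * t) ^ j / fact j))"
  proof (rule order_trans[OF sum_abs], rule sum_mono)
    fix j assume j: "j \<in> {..n} - {0}"
    have "\<bar>(- t) ^ j / fact j * rbinom (a + real j) (n - j)\<bar> = t ^ j / fact j * rbinom (a + real j) (n - j)"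
      using t(1) a rbinom_pos[of "a + real j" "n - j"] by (simp add: abs_mult power_abs)
    also have "\<dots> \<le> t ^ j / fact j * (rbinom a n * real n ^ j)"
      using t j by (intro mult_left_mono bound) auto
    finally show "\<bar>(- t) ^ j / fact j * rbinom (a + real j) (n - j)\<bar> \<le> rbinom a n * ((real n * t) ^ j / fact j)"
      by (simp add: power_mult_distrib field_simps)
  qed
  also have "\<dots> = rbinom a n * (\<Sum>j\<in>{..n} - {0}. (real n * t) ^ j / fact j)"
    by (simp add: sum_distrib_left)
  also have "\<dots> \<le> rbinom a n * (1 / 2)"
  proof (rule mult_left_mono)
    let ?x = "real n * t"
    have "1 + (\<Sum>j\<in>{..n} - {0}. ?x ^ j / fact j) = (\<Sum>j<Suc n. ?x ^ j /\<^sub>R fact j)"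
      by (simp add: lessThan_Suc_atMost sum.remove[of "{..n}" 0] field_simps)
    also have "\<dots> \<le> exp ?x"
      unfolding exp_def using t by (intro sum_le_suminf summable_exp_generic) auto
    also have "\<dots> \<le> 1 + ?x + ?x\<^sup>2" using t by (intro exp_bound) auto
    also have "\<dots> \<le> 1 + 1 / 2"
    proof -
      have "?x\<^sup>2 \<le> (1 / 4)\<^sup>2" using t by (intro power_mono) auto
      then show ?thesis using t by (simp add: power2_eq_square)
    qed
    finally show "(\<Sum>j\<in>{..n} - {0}. ?x ^ j / fact j) \<le> 1 / 2" by simp
    show "0 \<le> rbinom a n" using rbinom_pos[OF a] by (simp add: less_imp_le)
  qed
  finally show ?thesis by linarith
qed


subsection \<open>Orthonormality\<close>

abbreviation leb_pos :: "real measure" where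
  "leb_pos \<equiv> lebesgue_on {0<..}"

lemma set_integrable_leb_pos: "set_integrable lebesgue {0<..} f \<longleftrightarrow> integrable leb_pos f"
  for f :: "real \<Rightarrow> real"
  by (simp add: set_integrable_def integrable_restrict_space)

lemma set_integral_leb_pos: "(LINT t:{0<..}|lebesgue. f t) = integral\<^sup>L leb_pos f"
  for f :: "real \<Rightarrow> real"
  by (simp add: set_lebesgue_integral_def integral_restrict_space)

lemma borel_measurable_leb_pos:
  "f \<in> borel_measurable borel \<Longrightarrow> f \<in> borel_measurable leb_pos" for f :: "real \<Rightarrow> real"
  by (rule measurable_restrict_space1, rule measurable_completion) simp

lemma integrable_leb_pos_exp_powr:
  assumes "0 < x" "0 < c"
  shows "integrable leb_pos (\<lambda>t. t powr (x - 1) * exp (- c * t))"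
proof -
  have "set_integrable lebesgue {0<..} (\<lambda>t. norm (complex_of_real t powr (complex_of_real x - 1) / of_real (exp (c * t))))"
    by (intro set_integrable_norm absolutely_integrable_Gamma_integral) (use assms in auto)
  then have "set_integrable lebesgue {0<..} (\<lambda>t. t powr (x - 1) * exp (- c * t))"
    by (rule set_integrable_cong[THEN iffD1, rotated -1])
      (auto simp: norm_divide norm_powr_real_powr exp_minus field_simps)
  then show ?thesis by (simp add: set_integrable_leb_pos)
qed

lemma integral_leb_pos_Gamma:
  assumes "0 < x"
  shows "integral\<^sup>L leb_pos (\<lambda>t. t powr (x - 1) * exp (- t)) = Gamma x"
proof -
  have int: "set_integrable lebesgue {0<..} (\<lambda>t. t powr (x - 1) * exp (- t))"
    using integrable_leb_pos_exp_powr[OF assms, of 1] by (simp add: set_integrable_leb_pos)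
  have "((\<lambda>t. t powr (x - 1) / exp t) has_integral Gamma x) {0<..}"
    by (rule has_integral_spike_set_eq[THEN iffD1, OF _ _ Gamma_integral_real[OF assms]])
      (auto intro!: negligible_subset[OF negligible_sing[of 0]])
  then have "((\<lambda>t. t powr (x - 1) * exp (- t)) has_integral Gamma x) {0<..}"
    by (simp add: exp_minus divide_inverse)
  then show ?thesis
    using set_lebesgue_integral_eq_integral(2)[OF int]
    by (simp add: set_integral_leb_pos integral_unique)
qed

lemma w_nonneg: "0 \<le> w a t"
  by (simp add: w_def)

lemma borel_measurable_w: "w a \<in> borel_measurable borel"
  unfolding w_def[abs_def] by measurable

lemma w_moment:
  assumes "0 \<le> a"
  shows "integrable leb_pos (\<lambda>t. w a t * t ^ k)"
    and "integral\<^sup>L leb_pos (\<lambda>t. w a t * t ^ k) = Gamma (a + real k + 1)"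
proof -
  have eq: "w a t * t ^ k = t powr (a + real k + 1 - 1) * exp (- 1 * t)" if "t \<in> space leb_pos" for t
    using that by (simp add: w_def powr_add powr_realpow)
  show "integrable leb_pos (\<lambda>t. w a t * t ^ k)"
    using integrable_leb_pos_exp_powr[of "a + real k + 1" 1] assms
    by (subst Bochner_Integration.integrable_cong[OF refl eq]) auto
  show "integral\<^sup>L leb_pos (\<lambda>t. w a t * t ^ k) = Gamma (a + real k + 1)"
    using integral_leb_pos_Gamma[of "a + real k + 1"] assms
    by (subst Bochner_Integration.integral_cong[OF refl eq]) auto
qed

text \<open>The n-th finite difference of a monic polynomial of degree m \<le> n: it vanishes for m
  < n and leaves n!, up to sign, for m = n. Pascal's rule takes one difference at a time, and one
  difference of a rising factorial is again a rising factorial.\<close>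

lemma alternating_pochhammer_sum:
  fixes x :: real
  assumes "m \<le> n"
  shows "(\<Sum>j\<le>n. (- 1) ^ j * real (n choose j) * pochhammer (x + real j) m)
    = (if m = n then (- 1) ^ n * fact n else 0)"
  using assms
proof (induction n arbitrary: m x)
  case 0
  then show ?case by simp
next
  case (Suc n)
  have "(\<Sum>j\<le>Suc n. (- 1) ^ j * real (Suc n choose j) * pochhammer (x + real j) m)
    = pochhammer x m + (\<Sum>j\<le>n. (- 1) ^ Suc j * real (n choose Suc j) * pochhammer (x + real (Suc j)) m)
      + (\<Sum>j\<le>n. (- 1) ^ Suc j * real (n choose j) * pochhammer (x + real (Suc j)) m)"
    by (subst sum.atMost_Suc_shift) (simp add: sum.distrib[symmetric] algebra_simps)
  also have "pochhammer x m + (\<Sum>j\<le>n. (- 1) ^ Suc j * real (n choose Suc j) * pochhammer (x + real (Suc j)) m)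
    = (\<Sum>j\<le>Suc n. (- 1) ^ j * real (n choose j) * pochhammer (x + real j) m)"
    by (subst sum.atMost_Suc_shift) simp
  also have "\<dots> = (\<Sum>j\<le>n. (- 1) ^ j * real (n choose j) * pochhammer (x + real j) m)"
    by simp
  also have "\<dots> + (\<Sum>j\<le>n. (- 1) ^ Suc j * real (n choose j) * pochhammer (x + real (Suc j)) m)
    = (\<Sum>j\<le>n. (- 1) ^ j * real (n choose j) * (pochhammer (x + real j) m - pochhammer (x + real j + 1) m))"
    unfolding sum.distrib[symmetric] by (intro sum.cong) (auto simp: algebra_simps)
  also have "\<dots> = (if m = Suc n then (- 1) ^ Suc n * fact (Suc n) else 0)"
  proof (cases m)
    case 0
    then show ?thesis by simp
  next
    case (Suc l)
    have "pochhammer y m - pochhammer (y + 1) m = - real m * pochhammer (y + 1) l" for y :: real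
      unfolding Suc pochhammer_rec[of y] pochhammer_rec'[of "y + 1"] by (simp add: algebra_simps)
    then have "(\<Sum>j\<le>n. (- 1) ^ j * real (n choose j) * (pochhammer (x + real j) m - pochhammer (x + real j + 1) m))
      = - real m * (\<Sum>j\<le>n. (- 1) ^ j * real (n choose j) * pochhammer (x + 1 + real j) l)"
    proof -
      assume *: "pochhammer y m - pochhammer (y + 1) m = - real m * pochhammer (y + 1) l" for y :: real
      show ?thesis unfolding * sum_distrib_left by (intro sum.cong) (auto simp: add_ac)
    qed
    also have "(\<Sum>j\<le>n. (- 1) ^ j * real (n choose j) * pochhammer (x + 1 + real j) l)
      = (if l = n then (- 1) ^ n * fact n else 0)"
      using Suc.IH[of l "x + 1"] Suc.prems Suc by simp
    also have "- real m * (if l = n then (- 1) ^ n * fact n else 0) = (if m = Suc n then (- 1) ^ Suc n * fact (Suc n) else 0)"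
      using Suc by (simp add: algebra_simps)
    finally show ?thesis .
  qed
  finally show ?case .
qed

text \<open>Each Gamma value splits so that one part combines with \<open>rbinom\<close> into
  Gamma(n + a + 1), independent of \<open>j\<close>, and the rest is a rising factorial of length
  \<open>m\<close>; what remains is the finite difference above.\<close>

lemma Laguerre_moment:
  assumes a: "0 \<le> a" and mn: "m \<le> n"
  shows "integrable leb_pos (\<lambda>t. w a t * (Laguerre a n t * t ^ m))"
    and "integral\<^sup>L leb_pos (\<lambda>t. w a t * (Laguerre a n t * t ^ m))
      = (if m = n then (- 1) ^ n * Gamma (real n + a + 1) else 0)"
proof -
  let ?c = "\<lambda>j. (- 1) ^ j / fact j * rbinom (a + real j) (n - j)"
  have eq: "w a t * (Laguerre a n t * t ^ m) = (\<Sum>j\<le>n. ?c j * (w a t * t ^ (m + j)))" for t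
    unfolding Laguerre_altdef sum_distrib_right sum_distrib_left
    by (intro sum.cong) (auto simp: power_minus[of t] power_add)
  show "integrable leb_pos (\<lambda>t. w a t * (Laguerre a n t * t ^ m))"
    unfolding eq by (intro Bochner_Integration.integrable_sum integrable_mult_right w_moment a)
  have "integral\<^sup>L leb_pos (\<lambda>t. w a t * (Laguerre a n t * t ^ m))
      = (\<Sum>j\<le>n. ?c j * Gamma (a + real (m + j) + 1))"
    unfolding eq using w_moment[OF a] by (subst Bochner_Integration.integral_sum) auto
  also have "\<dots> = (\<Sum>j\<le>n. Gamma (real n + a + 1) / fact n *
      ((- 1) ^ j * real (n choose j) * pochhammer (a + 1 + real j) m))"
  proof (rule sum.cong)
    fix j assume "j \<in> {..n}"
    then have j: "j \<le> n" by simp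
    have "pochhammer (a + real j + 1) k = Gamma (a + real j + 1 + real k) / Gamma (a + real j + 1)" for k
      using a by (intro pochhammer_Gamma) (auto elim!: nonpos_Ints_cases)
    moreover have "Gamma (a + real j + 1) \<noteq> 0"
      using Gamma_real_pos[of "a + real j + 1"] a by linarith
    ultimately have p: "Gamma (a + real j + 1) * pochhammer (a + real j + 1) k = Gamma (a + real j + 1 + real k)" for k
      by simp
    have "rbinom (a + real j) (n - j) * Gamma (a + real (m + j) + 1)
        = pochhammer (a + real j + 1) (n - j) / fact (n - j) * (Gamma (a + real j + 1) * pochhammer (a + real j + 1) m)"
      unfolding p rbinom_def by (simp add: algebra_simps)
    also have "\<dots> = (Gamma (a + real j + 1) * pochhammer (a + real j + 1) (n - j)) / fact (n - j) * pochhammer (a + real j + 1) m"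
      by simp
    also have "Gamma (a + real j + 1) * pochhammer (a + real j + 1) (n - j) = Gamma (real n + a + 1)"
      unfolding p using j by (simp add: of_nat_diff algebra_simps)
    finally show "?c j * Gamma (a + real (m + j) + 1) = Gamma (real n + a + 1) / fact n *
      ((- 1) ^ j * real (n choose j) * pochhammer (a + 1 + real j) m)"
      using j by (simp add: binomial_fact algebra_simps)
  qed simp
  also have "\<dots> = (if m = n then (- 1) ^ n * Gamma (real n + a + 1) else 0)"
    unfolding sum_distrib_left[symmetric] alternating_pochhammer_sum[OF mn] by simp
  finally show "integral\<^sup>L leb_pos (\<lambda>t. w a t * (Laguerre a n t * t ^ m))
      = (if m = n then (- 1) ^ n * Gamma (real n + a + 1) else 0)" .
qed

text \<open>Only the factor of lower degree is expanded; its powers have vanishing moments except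
  possibly the top one.\<close>

lemma Laguerre_orthogonal_le:
  assumes a: "0 \<le> a" and mn: "m \<le> n"
  shows "integrable leb_pos (\<lambda>t. w a t * (Laguerre a n t * Laguerre a m t))"
    and "integral\<^sup>L leb_pos (\<lambda>t. w a t * (Laguerre a n t * Laguerre a m t))
      = (if m = n then Gamma (real n + a + 1) / fact n else 0)"
proof -
  let ?c = "\<lambda>j. (- 1) ^ j / fact j * rbinom (a + real j) (m - j)"
  have eq: "w a t * (Laguerre a n t * Laguerre a m t) = (\<Sum>j\<le>m. ?c j * (w a t * (Laguerre a n t * t ^ j)))" for t
    unfolding Laguerre_altdef[of _ m] sum_distrib_left
    by (intro sum.cong) (auto simp: power_minus[of t])
  show "integrable leb_pos (\<lambda>t. w a t * (Laguerre a n t * Laguerre a m t))"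
    unfolding eq using mn by (intro Bochner_Integration.integrable_sum integrable_mult_right Laguerre_moment a) auto
  have "integral\<^sup>L leb_pos (\<lambda>t. w a t * (Laguerre a n t * Laguerre a m t))
      = (\<Sum>j\<le>m. ?c j * (if j = n then (- 1) ^ n * Gamma (real n + a + 1) else 0))"
    unfolding eq using Laguerre_moment[OF a] mn by (subst Bochner_Integration.integral_sum) auto
  also have "\<dots> = (\<Sum>j\<le>m. if j = n then Gamma (real n + a + 1) / fact n else 0)"
    using mn by (intro sum.cong) (auto simp flip: power_mult_distrib mult.assoc)
  also have "\<dots> = (if m = n then Gamma (real n + a + 1) / fact n else 0)"
    using mn by simp
  finally show "integral\<^sup>L leb_pos (\<lambda>t. w a t * (Laguerre a n t * Laguerre a m t))
      = (if m = n then Gamma (real n + a + 1) / fact n else 0)" .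
qed

lemma laguerre_on_orthonormal:
  assumes a: "0 \<le> a"
  shows "integrable leb_pos (\<lambda>t. w a t * laguerre_on a n t * laguerre_on a m t)"
    and "integral\<^sup>L leb_pos (\<lambda>t. w a t * laguerre_on a n t * laguerre_on a m t) = (if n = m then 1 else 0)"
proof -
  have G: "0 < Gamma (real k + a + 1)" for k using a by (simp add: Gamma_real_pos)
  have *: "integrable leb_pos (\<lambda>t. w a t * (Laguerre a n t * Laguerre a m t)) \<and>
     integral\<^sup>L leb_pos (\<lambda>t. w a t * (Laguerre a n t * Laguerre a m t))
      = (if n = m then Gamma (real n + a + 1) / fact n else 0)"
    using Laguerre_orthogonal_le[OF a, of m n] Laguerre_orthogonal_le[OF a, of n m]
    by (cases "m \<le> n") (auto simp: mult.commute)
  have eq: "w a t * laguerre_on a n t * laguerre_on a m t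
    = sqrt (fact n / Gamma (real n + a + 1)) * sqrt (fact m / Gamma (real m + a + 1))
      * (w a t * (Laguerre a n t * Laguerre a m t))" for t
    by (simp add: laguerre_on_def)
  show "integrable leb_pos (\<lambda>t. w a t * laguerre_on a n t * laguerre_on a m t)"
    unfolding eq using * by (intro integrable_mult_right) auto
  show "integral\<^sup>L leb_pos (\<lambda>t. w a t * laguerre_on a n t * laguerre_on a m t) = (if n = m then 1 else 0)"
  proof (cases "n = m")
    case True
    have "sqrt (fact n / Gamma (real n + a + 1)) * sqrt (fact n / Gamma (real n + a + 1)) = fact n / Gamma (real n + a + 1)"
      by (rule real_sqrt_mult_self[THEN trans]) (use G[of n] in simp)
    moreover have "Gamma (real n + a + 1) \<noteq> 0" using G[of n] by linarith
    ultimately show ?thesis unfolding eq integral_mult_right_zero using * True by simp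
  next
    case False
    then show ?thesis unfolding eq integral_mult_right_zero using * by simp
  qed
qed

subsection \<open>Completeness\<close>

text \<open>Half-lines form an intersection-stable generator of the Borel sets, so the vanishing of
  the integral spreads to all Borel sets by a Dynkin argument; the total integral is what
  complements require.\<close>

lemma AE_zero_if_integral_Ioi_zero:
  fixes v :: "real \<Rightarrow> real"
  assumes v: "integrable lborel v" and v0: "integral\<^sup>L lborel v = 0"
    and zero: "\<And>a. (LINT t:{a<..}|lborel. v t) = 0"
  shows "AE t in lborel. v t = 0"
proof (rule sigma_finite_measure.density_zero[OF sigma_finite_lborel v])
  fix A :: "real set" assume "A \<in> sets lborel"
  then have A: "A \<in> sigma_sets UNIV (range greaterThan)"
    by (simp add: borel_Ioi)
  have meas: "B \<in> sets lborel" if "B \<in> sigma_sets UNIV (range greaterThan)" for B :: "real set"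
    using that by (simp add: borel_Ioi)
  have int: "set_integrable lborel B v" if "B \<in> sets lborel" for B
    unfolding set_integrable_def using that v by (intro integrable_mult_indicator) auto
  show "(LINT t:A|lborel. v t) = 0"
  proof (rule sigma_sets_induct_disjoint[OF _ _ A])
    show "Int_stable (range greaterThan :: real set set)"
      by (auto simp: Int_stable_def lessThan_Int_lessThan)
    show "range greaterThan \<subseteq> Pow (UNIV :: real set)" by simp
    fix B :: "real set" assume "B \<in> range greaterThan"
    then show "(LINT t:B|lborel. v t) = 0" using zero by auto
  next
    show "(LINT t:{}|lborel. v t) = 0" by (simp add: set_lebesgue_integral_def)
  next
    fix B :: "real set"
    assume B: "B \<in> sigma_sets UNIV (range greaterThan)" "(LINT t:B|lborel. v t) = 0"
    have "(LINT t:(B \<union> (UNIV - B))|lborel. v t) = (LINT t:B|lborel. v t) + (LINT t:(UNIV - B)|lborel. v t)"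
      using meas[OF B(1)] by (intro set_integral_Un int) auto
    moreover have "B \<union> (UNIV - B) = UNIV" by auto
    ultimately show "(LINT t:(UNIV - B)|lborel. v t) = 0"
      using B v0 by (simp add: set_lebesgue_integral_def)
  next
    fix B :: "nat \<Rightarrow> real set"
    assume B: "disjoint_family B" "range B \<subseteq> sigma_sets UNIV (range greaterThan)"
      "\<And>i. (LINT t:B i|lborel. v t) = 0"
    have m: "B i \<in> sets lborel" for i using B(2) meas by blast
    have "(LINT t:(\<Union>i. B i)|lborel. v t) = (\<Sum>i. (LINT t:(B i)|lborel. v t))"
      using m B(1) by (intro lebesgue_integral_countable_add int) (auto simp: disjoint_family_on_def)
    then show "(LINT t:(\<Union>i. B i)|lborel. v t) = 0" by (simp add: B(3))
  qed
qed

section \<open>The moment problem on the half-line\<close>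

context
  fixes u :: "real \<Rightarrow> real" and c :: real
  assumes c: "0 < c" and u: "integrable leb_pos (\<lambda>t. u t * exp (c * t))"
begin

lemma integrable_exp_dominated:
  assumes "g \<in> borel_measurable borel" and "\<And>t. 0 < t \<Longrightarrow> \<bar>g t\<bar> \<le> K * exp (c * t)"
  shows "integrable leb_pos (\<lambda>t. u t * g t)"
proof (rule Bochner_Integration.integrable_bound[OF integrable_mult_right[OF u, of K]])
  \<comment> \<open>Measurability of \<open>u\<close> itself is recovered by dividing out the
    exponential.\<close>
  have "(\<lambda>t. (u t * exp (c * t)) * exp (- c * t)) \<in> borel_measurable leb_pos"
    by (rule borel_measurable_times[OF borel_measurable_integrable[OF u] borel_measurable_leb_pos]) measurable
  then have "u \<in> borel_measurable leb_pos" by (simp add: mult.assoc flip: exp_add)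
  then show "(\<lambda>t. u t * g t) \<in> borel_measurable leb_pos"
    using assms(1) by (rule borel_measurable_times[OF _ borel_measurable_leb_pos])
  show "AE t in leb_pos. norm (u t * g t) \<le> norm (K * (u t * exp (c * t)))"
  proof (rule AE_I2)
    fix t assume "t \<in> space leb_pos"
    then have "\<bar>g t\<bar> \<le> K * exp (c * t)" using assms(2) by simp
    also have "\<dots> \<le> \<bar>K * exp (c * t)\<bar>" by simp
    finally have "\<bar>u t\<bar> * \<bar>g t\<bar> \<le> \<bar>u t\<bar> * \<bar>K * exp (c * t)\<bar>" by (rule mult_left_mono) simp
    then show "norm (u t * g t) \<le> norm (K * (u t * exp (c * t)))"
      by (simp add: abs_mult mult_ac)
  qed
qed

text \<open>The power is one term of the series of exp (c/2 * t). Half of the rate \<open>c\<close>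
  pays for it, and the other half stays available for the exponential factor.\<close>

lemma power_mult_exp_le:
  assumes "0 < t"
  shows "t ^ k * exp (c / 2 * t) \<le> fact k * (2 / c) ^ k * exp (c * t)"
proof -
  have "(c / 2 * t) ^ k / fact k = (\<Sum>j\<in>{k}. (c / 2 * t) ^ j /\<^sub>R fact j)"
    by (simp add: field_simps)
  also have "\<dots> \<le> exp (c / 2 * t)"
    unfolding exp_def using assms c by (intro sum_le_suminf summable_exp_generic) auto
  finally have "(c / 2 * t) ^ k / fact k \<le> exp (c / 2 * t)" .
  then have "t ^ k \<le> fact k * (2 / c) ^ k * exp (c / 2 * t)"
    using c by (simp add: power_mult_distrib power_divide field_simps)
  then have "t ^ k * exp (c / 2 * t) \<le> fact k * (2 / c) ^ k * exp (c / 2 * t) * exp (c / 2 * t)"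
    by (rule mult_right_mono) simp
  also have "\<dots> = fact k * (2 / c) ^ k * exp (c * t)"
    by (simp add: mult.assoc flip: exp_add)
  finally show ?thesis .
qed

lemma integrable_power_exp:
  assumes "0 \<le> b"
  shows "integrable leb_pos (\<lambda>t. u t * (t ^ k * exp (- b * t)))"
proof (rule integrable_exp_dominated)
  fix t :: real assume t: "0 < t"
  have "- b * t \<le> 0" using t assms by simp
  also have "0 \<le> c / 2 * t" using t c by simp
  finally have "t ^ k * exp (- b * t) \<le> t ^ k * exp (c / 2 * t)"
    using t by (intro mult_left_mono) auto
  also note power_mult_exp_le[OF t, of k]
  finally show "\<bar>t ^ k * exp (- b * t)\<bar> \<le> fact k * (2 / c) ^ k * exp (c * t)"
    using t by (simp add: abs_mult)
qed measurable

text \<open>Expanding \<open>exp (- (c / 2) t)\<close> into its power series moves the vanishing of the moments from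
  the weight \<open>exp (- b t)\<close> to \<open>exp (- (b + c / 2) t)\<close>; a single step would leave the domain of
  dominated convergence.\<close>

lemma exp_moments_zero:
  assumes "\<And>k. integral\<^sup>L leb_pos (\<lambda>t. u t * t ^ k) = 0"
  shows "integral\<^sup>L leb_pos (\<lambda>t. u t * (t ^ k * exp (- (real n * (c / 2)) * t))) = 0"
proof (induction n arbitrary: k)
  case 0
  then show ?case using assms by simp
next
  case (Suc n)
  define b where "b = real n * (c / 2)"
  have b: "0 \<le> b" using c by (simp add: b_def)
  define f where "f = (\<lambda>i t. u t * (t ^ k * exp (- b * t)) * (\<Sum>j<i. (- (c / 2) * t) ^ j /\<^sub>R fact j))"
  have f_eq: "f i t = (\<Sum>j<i. (- (c / 2)) ^ j / fact j * (u t * (t ^ (k + j) * exp (- b * t))))" for i t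
    unfolding f_def sum_distrib_left
    by (intro sum.cong refl) (simp only: power_mult_distrib power_add real_scaleR_def divide_inverse mult_ac)
  have int: "integral\<^sup>L leb_pos (f i) = 0" for i
  proof -
    have "integral\<^sup>L leb_pos (f i) =
        (\<Sum>j<i. (- (c / 2)) ^ j / fact j * integral\<^sup>L leb_pos (\<lambda>t. u t * (t ^ (k + j) * exp (- b * t))))"
      unfolding f_eq using integrable_power_exp[OF b]
      by (subst Bochner_Integration.integral_sum) auto
    also have "\<dots> = 0" using Suc.IH by (simp add: b_def)
    finally show ?thesis .
  qed
  have "(\<lambda>i. integral\<^sup>L leb_pos (f i)) \<longlonglongrightarrow> integral\<^sup>L leb_pos (\<lambda>t. u t * (t ^ k * exp (- b * t)) * exp (- (c / 2) * t))"
  proof (rule integral_dominated_convergence)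
    \<comment> \<open>Taking absolute values in the partial sums of exp (- (c/2) t) reverses the
      sign of the exponent, so the majorant grows like exp (c/2 * t). That is only half of the
      available rate.\<close>
    have "integrable leb_pos (\<lambda>t. u t * (t ^ k * exp (c / 2 * t)))"
      by (rule integrable_exp_dominated) (use power_mult_exp_le in \<open>auto simp: abs_mult\<close>)
    then show "integrable leb_pos (\<lambda>t. \<bar>u t * (t ^ k * exp (c / 2 * t))\<bar>)" by simp
    show "f i \<in> borel_measurable leb_pos" for i
      unfolding f_eq using integrable_power_exp[OF b]
      by (intro borel_measurable_integrable Bochner_Integration.integrable_sum integrable_mult_right)
    show "(\<lambda>t. u t * (t ^ k * exp (- b * t)) * exp (- (c / 2) * t)) \<in> borel_measurable leb_pos"
      by (intro borel_measurable_times borel_measurable_integrable[OF integrable_power_exp[OF b]]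
          borel_measurable_leb_pos) measurable
    show "AE t in leb_pos. (\<lambda>i. f i t) \<longlonglongrightarrow> u t * (t ^ k * exp (- b * t)) * exp (- (c / 2) * t)"
      unfolding f_def exp_def using summable_LIMSEQ[OF summable_exp_generic]
      by (intro AE_I2 tendsto_mult tendsto_const)
    show "AE t in leb_pos. norm (f i t) \<le> \<bar>u t * (t ^ k * exp (c / 2 * t))\<bar>" for i
    proof (rule AE_I2)
      fix t assume "t \<in> space leb_pos"
      then have t: "0 < t" by simp
      have "\<bar>\<Sum>j<i. (- (c / 2) * t) ^ j /\<^sub>R fact j\<bar> \<le> (\<Sum>j<i. (c / 2 * t) ^ j /\<^sub>R fact j)"
        by (rule order_trans[OF sum_abs]) (use t c in \<open>auto simp: abs_mult power_abs intro!: sum_mono\<close>)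
      also have "\<dots> \<le> exp (c / 2 * t)"
        unfolding exp_def using t c by (intro sum_le_suminf summable_exp_generic) auto
      finally have 1: "\<bar>\<Sum>j<i. (- (c / 2) * t) ^ j /\<^sub>R fact j\<bar> \<le> exp (c / 2 * t)" .
      have 2: "\<bar>t ^ k * exp (- b * t)\<bar> \<le> t ^ k * 1"
        using t b by (auto simp: abs_mult intro!: mult_left_mono)
      have "\<bar>u t\<bar> * (\<bar>t ^ k * exp (- b * t)\<bar> * \<bar>\<Sum>j<i. (- (c / 2) * t) ^ j /\<^sub>R fact j\<bar>)
        \<le> \<bar>u t\<bar> * (t ^ k * 1 * exp (c / 2 * t))"
        using t by (intro mult_left_mono mult_mono 1 2) auto
      then show "norm (f i t) \<le> \<bar>u t * (t ^ k * exp (c / 2 * t))\<bar>"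
        using t by (simp add: f_def abs_mult mult.assoc)
    qed
  qed
  then have "integral\<^sup>L leb_pos (\<lambda>t. u t * (t ^ k * exp (- b * t)) * exp (- (c / 2) * t)) = 0"
    unfolding int by (simp add: LIMSEQ_const_iff)
  moreover have "u t * (t ^ k * exp (- b * t)) * exp (- (c / 2) * t) = u t * (t ^ k * exp (- (real (Suc n) * (c / 2)) * t))" for t
    by (simp add: b_def mult.assoc algebra_simps flip: exp_add)
  ultimately show ?case by (simp only:)
qed

text \<open>The substitution x = exp (- (c/2) t) maps the half-line into [0, 1] and turns
  polynomials in x into combinations of exp (- i (c/2) t), whose integrals against \<open>u\<close>
  vanish. Weierstrass approximation extends this to continuous \<open>h\<close>.\<close>

lemma integral_continuous_exp_zero:
  assumes mom: "\<And>k. integral\<^sup>L leb_pos (\<lambda>t. u t * t ^ k) = 0"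
    and h: "continuous_on {0..1} h" and hm: "h \<in> borel_measurable borel"
  shows "integral\<^sup>L leb_pos (\<lambda>t. u t * h (exp (- (c / 2) * t))) = 0"
proof -
  let ?x = "\<lambda>t::real. exp (- (c / 2) * t)"
  have x: "?x t \<in> {0..1}" if "0 < t" for t using that c by auto
  have ui: "integrable leb_pos u"
    using integrable_power_exp[of 0 0] by simp
  obtain B where B: "\<And>x. x \<in> {0..1} \<Longrightarrow> \<bar>h x\<bar> \<le> B"
  proof -
    have "bounded (h ` {0..1})" using h by (intro compact_imp_bounded compact_continuous_image) auto
    then show ?thesis using that by (force simp: bounded_iff)
  qed
  have one: "1 \<le> exp (c * t)" if "0 < t" for t using that c by simp
  have hi: "integrable leb_pos (\<lambda>t. u t * h (?x t))"
  proof (rule integrable_exp_dominated)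
    show "(\<lambda>t. h (?x t)) \<in> borel_measurable borel" using hm by measurable
    fix t :: real assume t: "0 < t"
    have "\<bar>h (?x t)\<bar> \<le> B" by (rule B[OF x[OF t]])
    moreover have "0 \<le> B" using B[of 0] by simp
    ultimately show "\<bar>h (?x t)\<bar> \<le> B * exp (c * t)"
      using mult_left_mono[OF one[OF t], of B] by simp
  qed
  have "\<bar>integral\<^sup>L leb_pos (\<lambda>t. u t * h (?x t))\<bar> \<le> e * integral\<^sup>L leb_pos (\<lambda>t. \<bar>u t\<bar>)" if "0 < e" for e
  proof -
    obtain g where g: "real_polynomial_function g" "\<And>x. x \<in> {0..1} \<Longrightarrow> \<bar>h x - g x\<bar> < e"
      using Stone_Weierstrass_real_polynomial_function[OF compact_Icc h \<open>0 < e\<close>] by blast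
    from g(1) obtain a n where gs: "g = (\<lambda>x. \<Sum>i\<le>n. a i * x ^ i)"
      using real_polynomial_function_imp_sum by blast
    have eq: "u t * g (?x t) = (\<Sum>i\<le>n. a i * (u t * (t ^ 0 * exp (- (real i * (c / 2)) * t))))" for t
      unfolding gs sum_distrib_left by (intro sum.cong) (auto simp: mult_ac simp flip: exp_of_nat_mult)
    have gi: "integrable leb_pos (\<lambda>t. u t * g (?x t))"
      unfolding eq using c by (intro Bochner_Integration.integrable_sum integrable_mult_right integrable_power_exp) auto
    have g0: "integral\<^sup>L leb_pos (\<lambda>t. u t * g (?x t)) = 0"
    proof -
      have i: "integrable leb_pos (\<lambda>t. a i * (u t * (t ^ 0 * exp (- (real i * (c / 2)) * t))))" for i
        using c by (intro integrable_mult_right integrable_power_exp) auto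
      show ?thesis
        unfolding eq by (subst Bochner_Integration.integral_sum[OF i])
          (simp only: integral_mult_right_zero exp_moments_zero[OF mom] mult_zero_right sum.neutral_const)
    qed
    have "\<bar>integral\<^sup>L leb_pos (\<lambda>t. u t * h (?x t))\<bar> = \<bar>integral\<^sup>L leb_pos (\<lambda>t. u t * h (?x t) - u t * g (?x t))\<bar>"
      using hi gi g0 by simp
    also have "\<dots> \<le> integral\<^sup>L leb_pos (\<lambda>t. \<bar>u t * h (?x t) - u t * g (?x t)\<bar>)"
      by (rule integral_abs_bound)
    also have "\<dots> \<le> integral\<^sup>L leb_pos (\<lambda>t. e * \<bar>u t\<bar>)"
    proof (rule integral_mono)
      show "integrable leb_pos (\<lambda>t. \<bar>u t * h (?x t) - u t * g (?x t)\<bar>)"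
        by (intro integrable_abs Bochner_Integration.integrable_diff hi gi)
      show "integrable leb_pos (\<lambda>t. e * \<bar>u t\<bar>)"
        by (intro integrable_mult_right integrable_abs ui)
      fix t assume "t \<in> space leb_pos"
      then have "\<bar>h (?x t) - g (?x t)\<bar> \<le> e" using g(2)[OF x] by (simp add: less_imp_le)
      then have "\<bar>u t\<bar> * \<bar>h (?x t) - g (?x t)\<bar> \<le> \<bar>u t\<bar> * e" by (rule mult_left_mono) simp
      then show "\<bar>u t * h (?x t) - u t * g (?x t)\<bar> \<le> e * \<bar>u t\<bar>"
        by (simp only: mult.commute[of e] right_diff_distrib[symmetric] abs_mult)
    qed
    finally show ?thesis by simp
  qed
  note bound = this
  define X where "X = \<bar>integral\<^sup>L leb_pos (\<lambda>t. u t * h (?x t))\<bar>"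
  define I where "I = integral\<^sup>L leb_pos (\<lambda>t. \<bar>u t\<bar>)"
  have "X = 0"
  proof (rule ccontr)
    assume "X \<noteq> 0"
    then have X: "0 < X" by (simp add: X_def)
    have I: "0 \<le> I" unfolding I_def by simp
    \<comment> \<open>The tolerance is chosen so that the bound falls below \<open>X\<close>;
      \<open>I + 1\<close> keeps the denominator positive when \<open>I = 0\<close>.\<close>
    have "X \<le> X / (2 * (I + 1)) * I"
      using bound[of "X / (2 * (I + 1))"] X I unfolding X_def[symmetric] I_def[symmetric] by simp
    also have "\<dots> < X"
    proof -
      have "X * I < X * (2 * (I + 1))" using X I by (intro mult_strict_left_mono) auto
      then show ?thesis using I by (simp add: divide_less_eq)
    qed
    finally show False by simp
  qed
  then show ?thesis by (simp add: X_def)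
qed

text \<open>Continuous functions of exp (- (c/2) t) suffice to approximate the indicators of
  half-lines, and the integrals over half-lines determine \<open>u\<close> almost
  everywhere.\<close>

lemma AE_zero_if_moments_zero:
  assumes mom: "\<And>k. integral\<^sup>L leb_pos (\<lambda>t. u t * t ^ k) = 0"
  shows "AE t in leb_pos. u t = 0"
proof -
  let ?x = "\<lambda>t::real. exp (- (c / 2) * t)"
  have ui: "integrable leb_pos u"
    using integrable_power_exp[of 0 0] by simp
  have Ioi: "integral\<^sup>L leb_pos (\<lambda>t. u t * indicator {a<..} t) = 0" for a
  proof -
    \<comment> \<open>A ramp of slope \<open>n\<close> below the image of \<open>a\<close>; as the
      substitution is decreasing, it tends to the indicator of \<open>a < t\<close>.\<close>
    define h where "h = (\<lambda>n x. min 1 (max 0 (real n * (?x a - x))))"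
    have hm: "(\<lambda>t. h n (?x t)) \<in> borel_measurable borel" for n unfolding h_def by measurable
    have "(\<lambda>n. integral\<^sup>L leb_pos (\<lambda>t. u t * h n (?x t))) \<longlonglongrightarrow> integral\<^sup>L leb_pos (\<lambda>t. u t * indicator {a<..} t)"
    proof (rule integral_dominated_convergence)
      show "integrable leb_pos (\<lambda>t. \<bar>u t\<bar>)" using ui by simp
      show "(\<lambda>t. u t * h n (?x t)) \<in> borel_measurable leb_pos" for n
        by (intro borel_measurable_times borel_measurable_integrable[OF ui] borel_measurable_leb_pos hm)
      show "(\<lambda>t. u t * indicator {a<..} t) \<in> borel_measurable leb_pos"
        by (intro borel_measurable_times borel_measurable_integrable[OF ui] borel_measurable_leb_pos) measurable
      show "AE t in leb_pos. norm (u t * h n (?x t)) \<le> \<bar>u t\<bar>" for n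
        by (intro AE_I2) (auto simp: h_def abs_mult intro!: mult_left_le)
      show "AE t in leb_pos. (\<lambda>n. u t * h n (?x t)) \<longlonglongrightarrow> u t * indicator {a<..} t"
      proof (intro AE_I2 tendsto_mult tendsto_const)
        fix t
        show "(\<lambda>n. h n (?x t)) \<longlonglongrightarrow> indicator {a<..} t"
        proof (cases "a < t")
          case True
          define d where "d = ?x a - ?x t"
          have d: "0 < d" using True c by (simp add: d_def)
          have "\<forall>\<^sub>F n in sequentially. 1 / d \<le> real n"
            using filterlim_real_sequentially by (simp add: filterlim_at_top)
          then have "\<forall>\<^sub>F n in sequentially. h n (?x t) = 1"
          proof eventually_elim
            case (elim n)
            then have "1 \<le> real n * d" using d by (simp add: field_simps)
            then show ?case by (simp add: h_def d_def)
          qed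
          then show ?thesis using True by (simp add: tendsto_eventually)
        next
          case False
          then have "?x a - ?x t \<le> 0" using c by simp
          then have "h n (?x t) = 0" for n
            by (simp add: h_def mult_nonneg_nonpos)
          then show ?thesis using False by simp
        qed
      qed
    qed
    moreover have "integral\<^sup>L leb_pos (\<lambda>t. u t * h n (?x t)) = 0" for n
      unfolding h_def by (rule integral_continuous_exp_zero[OF mom]) (auto intro!: continuous_intros)
    ultimately show ?thesis by (simp add: LIMSEQ_const_iff)
  qed
  \<comment> \<open>The Dynkin argument lives on Borel sets, whereas \<open>u\<close> is only
    Lebesgue measurable: it is extended by 0 and replaced by a Borel function equal to it almost
    everywhere.\<close>
  define v where "v = (\<lambda>t. indicator {0<..} t * u t)"
  have vi: "integrable lebesgue v"
    using ui by (simp add: v_def integrable_restrict_space)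
  obtain v' where v': "v' \<in> borel_measurable lborel" "AE t in lborel. v t = v' t"
    using completion_ex_borel_measurable_real[OF borel_measurable_integrable[OF vi]] by blast
  have ae: "AE t in lebesgue. v t = v' t" using v'(2) by (rule AE_completion)
  have v'm: "v' \<in> borel_measurable lebesgue" using v'(1) by (rule measurable_completion)
  have v'L: "integrable lebesgue v'"
    using vi ae v'm by (subst integrable_cong_AE[of v' _ v]) (auto intro: borel_measurable_integrable)
  have v'i: "integrable lborel v'" using v'L v'(1) by (simp add: integrable_completion)
  have v'I: "(LINT t|lborel. g t * v' t) = integral\<^sup>L leb_pos (\<lambda>t. u t * g t)"
    if g: "g \<in> borel_measurable borel" for g
  proof -
    have gm: "g \<in> borel_measurable lebesgue" using g by (intro measurable_completion) simp
    have "(LINT t|lborel. g t * v' t) = (LINT t|lebesgue. g t * v' t)"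
      using g v'(1) by (intro integral_completion[symmetric]) auto
    also have "\<dots> = (LINT t|lebesgue. g t * v t)"
      using gm v'm borel_measurable_integrable[OF vi] ae by (intro integral_cong_AE) auto
    also have "\<dots> = integral\<^sup>L leb_pos (\<lambda>t. u t * g t)"
      by (simp add: v_def integral_restrict_space mult_ac)
    finally show ?thesis .
  qed
  have "AE t in lborel. v' t = 0"
  proof (rule AE_zero_if_integral_Ioi_zero[OF v'i])
    show "integral\<^sup>L lborel v' = 0" using v'I[of "\<lambda>_. 1"] mom[of 0] by simp
    show "(LINT t:{a<..}|lborel. v' t) = 0" for a
      unfolding set_lebesgue_integral_def using v'I[of "indicator {a<..}"] Ioi[of a] by simp
  qed
  then have "AE t in lebesgue. v' t = 0" by (rule AE_completion)
  with ae have "AE t in lebesgue. v t = 0" by eventually_elim simp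
  then have "AE t in lebesgue. t \<in> {0<..} \<longrightarrow> u t = 0" by eventually_elim (auto simp: v_def)
  then show ?thesis by (simp add: AE_restrict_space_iff)
qed

end


subsection \<open>Derivatives of the Laguerre functions\<close>

text \<open>The j-th derivative of \<open>laguerre_on a k\<close>. The guard matters: for
  \<open>k < j\<close> the truncated degree is 0 and would give the constant 1 instead of 0.\<close>

definition laguerre_deriv :: "real \<Rightarrow> nat \<Rightarrow> nat \<Rightarrow> real \<Rightarrow> real" where
  "laguerre_deriv a j k t = sqrt (fact k / Gamma (real k + a + 1)) *
     (if j \<le> k then (- 1) ^ j * Laguerre (a + real j) (k - j) t else 0)"

lemma laguerre_deriv_0: "laguerre_deriv a 0 k = laguerre_on a k"
  by (simp add: laguerre_deriv_def laguerre_on_def fun_eq_iff)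

lemma laguerre_deriv_zero: "k < j \<Longrightarrow> laguerre_deriv a j k t = 0"
  by (simp add: laguerre_deriv_def)

lemma continuous_on_laguerre_deriv [continuous_intros]: "continuous_on S (laguerre_deriv a j k)"
  unfolding laguerre_deriv_def[abs_def]
  by (cases "j \<le> k") (auto intro!: continuous_intros)

lemma has_field_derivative_laguerre_deriv:
  "(laguerre_deriv a j k has_field_derivative laguerre_deriv a (Suc j) k t) (at t)"
proof -
  let ?s = "sqrt (fact k / Gamma (real k + a + 1))"
  consider "k < j" | "j = k" | "j < k" by linarith
  then show ?thesis
  proof cases
    case 1
    then show ?thesis by (simp add: laguerre_deriv_def[abs_def])
  next
    case 2
    have "laguerre_deriv a j k = (\<lambda>t. ?s * (- 1) ^ j)"
      using 2 by (simp add: laguerre_deriv_def fun_eq_iff)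
    then show ?thesis using 2 by (simp add: laguerre_deriv_zero)
  next
    case 3
    have "k - j = Suc (k - Suc j)" using 3 by simp
    moreover have "a + real (Suc j) = a + real j + 1" by simp
    ultimately have "(Laguerre (a + real j) (k - j) has_field_derivative
        - Laguerre (a + real (Suc j)) (k - Suc j) t) (at t)"
      using has_field_derivative_Laguerre[of "a + real j" "k - Suc j" t] by metis
    then have "((\<lambda>t. ?s * ((- 1) ^ j * Laguerre (a + real j) (k - j) t)) has_field_derivative
        ?s * ((- 1) ^ j * - Laguerre (a + real (Suc j)) (k - Suc j) t)) (at t)"
      by (intro DERIV_cmult)
    then show ?thesis using 3 by (simp add: laguerre_deriv_def[abs_def])
  qed
qed

text \<open>k!/Gamma(k + a + 1) is the reciprocal of Gamma(a + 1) * \<open>rbinom a k\<close>, so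
  both bounds come from \<open>rbinom_bounds\<close>.\<close>

lemma laguerre_normalization:
  assumes a: "0 \<le> a"
  obtains c C where "0 < c" "0 < C"
    "\<And>k. c * real (Suc k) powr (- a / 2) \<le> sqrt (fact k / Gamma (real k + a + 1))"
    "\<And>k. sqrt (fact k / Gamma (real k + a + 1)) \<le> C * real (Suc k) powr (- a / 2)"
proof -
  obtain c C where cC: "0 < c" "0 < C" "\<And>n. c * real (Suc n) powr a \<le> rbinom a n"
    "\<And>n. rbinom a n \<le> C * real (Suc n) powr a"
    using rbinom_bounds[OF a] by metis
  define g where "g = Gamma (a + 1)"
  have g: "0 < g" using a by (simp add: g_def Gamma_real_pos)
  have eq: "fact k / Gamma (real k + a + 1) = 1 / (g * rbinom a k)" for k
  proof -
    have "pochhammer (a + 1) k = Gamma (a + 1 + real k) / Gamma (a + 1)"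
      using a by (intro pochhammer_Gamma) (auto elim!: nonpos_Ints_cases)
    then have "Gamma (real k + a + 1) = g * pochhammer (a + 1) k"
      using g by (simp add: g_def add_ac)
    then show ?thesis by (simp add: rbinom_def)
  qed
  have pw: "sqrt (1 / (d * real (Suc k) powr a)) = 1 / sqrt d * real (Suc k) powr (- a / 2)"
    if "0 < d" for d k
  proof -
    have "sqrt (real (Suc k) powr a) = (real (Suc k) powr a) powr (1 / 2)"
      by (rule powr_half_sqrt[symmetric]) simp
    also have "\<dots> = real (Suc k) powr (a / 2)" by (simp add: powr_powr)
    finally show ?thesis
      by (simp add: real_sqrt_divide real_sqrt_mult powr_minus_divide del: of_nat_Suc)
  qed
  show ?thesis
  proof (rule that)
    show "0 < 1 / sqrt (g * C)" "0 < 1 / sqrt (g * c)" using g cC by auto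
    fix k
    have p: "0 < real (Suc k) powr a" by simp
    have r: "0 < rbinom a k" by (rule rbinom_pos[OF a])
    have "1 / (g * C * real (Suc k) powr a) \<le> fact k / Gamma (real k + a + 1)"
      unfolding eq using g r cC(4)[of k] by (intro divide_left_mono) (auto simp: mult.assoc intro!: mult_pos_pos cC)
    from real_sqrt_le_mono[OF this]
    show "1 / sqrt (g * C) * real (Suc k) powr (- a / 2) \<le> sqrt (fact k / Gamma (real k + a + 1))"
      by (simp only: pw[OF mult_pos_pos[OF g cC(2)]])
    have "fact k / Gamma (real k + a + 1) \<le> 1 / (g * c * real (Suc k) powr a)"
      unfolding eq using g r cC(3)[of k] cC(1) p by (intro divide_left_mono) (auto simp: mult.assoc intro!: mult_pos_pos)
    from real_sqrt_le_mono[OF this]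
    show "sqrt (fact k / Gamma (real k + a + 1)) \<le> 1 / sqrt (g * c) * real (Suc k) powr (- a / 2)"
      by (simp only: pw[OF mult_pos_pos[OF g cC(1)]])
  qed
qed

lemma sqrt_w: "0 < t \<Longrightarrow> sqrt (w a t) = t powr (a / 2) * exp (- t / 2)"
proof (rule real_sqrt_unique)
  assume t: "0 < t"
  have "(exp (- t / 2))\<^sup>2 = exp (- t)" by (simp add: power2_eq_square flip: exp_add)
  moreover have "(t powr (a / 2))\<^sup>2 = t powr a" using t by (simp add: power2_eq_square flip: powr_add)
  ultimately show "(t powr (a / 2) * exp (- t / 2))\<^sup>2 = w a t"
    unfolding power_mult_distrib w_def by simp
qed simp

text \<open>For \<open>j < r\<close> the bound is far from sharp.\<close>

lemma laguerre_deriv_bound: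
  assumes a: "0 \<le> a" and r: "1 \<le> r"
  obtains B where "0 < B" "\<And>j k t. j \<le> r \<Longrightarrow> 0 < t \<Longrightarrow>
    \<bar>laguerre_deriv a j k t\<bar> * sqrt (w a t) \<le> B * real (Suc k) ^ r"
proof -
  have *: "\<exists>B>0. \<forall>k t. 0 < t \<longrightarrow> \<bar>laguerre_deriv a j k t\<bar> * sqrt (w a t) \<le> B * real (Suc k) ^ r"
    if j: "j \<le> r" for j
  proof -
    obtain C where C: "0 < C"
      "\<And>k. sqrt (fact k / Gamma (real k + a + 1)) \<le> C * real (Suc k) powr (- a / 2)"
      using laguerre_normalization[OF a] by metis
    \<comment> \<open>The uniform bound requires the parameter to be raised by at least one. The
      case \<open>j = 0\<close> is reached from \<open>a + 1\<close> by
      \<open>Laguerre_diff\<close>, whose two terms account for the factor in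
      \<open>2 * D\<close>.\<close>
    define i where "i = max 1 j"
    obtain D where D: "0 < D" "\<And>n t. 0 < t \<Longrightarrow> t powr (a / 2) * exp (- t / 2) * \<bar>Laguerre (a + real i) n t\<bar>
         \<le> D * real (Suc n) powr (a / 2 + real i)"
      using Laguerre_bound[OF a, of i] unfolding i_def by (metis max.cobounded1)
    have i: "i \<le> r" using j r by (simp add: i_def)
    have D': "t powr (a / 2) * exp (- t / 2) * \<bar>Laguerre (a + real i) n t\<bar> \<le> D * real (Suc k) powr (a / 2 + real r)"
      if "0 < t" "n \<le> k" for n k t
    proof -
      have "real (Suc n) powr (a / 2 + real i) \<le> real (Suc k) powr (a / 2 + real i)"
        using that a by (intro powr_mono2) auto
      also have "\<dots> \<le> real (Suc k) powr (a / 2 + real r)"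
        using i by (intro powr_mono) auto
      finally have "D * real (Suc n) powr (a / 2 + real i) \<le> D * real (Suc k) powr (a / 2 + real r)"
        using D(1) by simp
      with D(2)[OF that(1), of n] show ?thesis by linarith
    qed
    have le2: "D * real (Suc k) powr (a / 2 + real r) \<le> 2 * D * real (Suc k) powr (a / 2 + real r)" for k
      using D(1) by (intro mult_right_mono) auto
    have L: "sqrt (w a t) * \<bar>Laguerre (a + real j) n t\<bar> \<le> 2 * D * real (Suc k) powr (a / 2 + real r)"
      if t: "0 < t" and n: "n \<le> k" for n k t
    proof (cases "j = 0")
      case False
      then have "i = j" by (simp add: i_def)
      then show ?thesis using order_trans[OF D'[OF t n] le2] unfolding sqrt_w[OF t] by simp
    next
      case True
      show ?thesis
      proof (cases n)
        case 0
        have "\<bar>Laguerre (a + real j) n t\<bar> = \<bar>Laguerre (a + real i) n t\<bar>" by (simp add: 0)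
        then show ?thesis using order_trans[OF D'[OF t n] le2] unfolding sqrt_w[OF t] by simp
      next
        case (Suc m)
        have i1: "real i = 1" using True by (simp add: i_def)
        have "\<bar>Laguerre (a + real j) n t\<bar> \<le> \<bar>Laguerre (a + real i) n t\<bar> + \<bar>Laguerre (a + real i) m t\<bar>"
          unfolding Suc i1 using True by (simp add: Laguerre_diff[of a m])
        then have "sqrt (w a t) * \<bar>Laguerre (a + real j) n t\<bar>
            \<le> sqrt (w a t) * \<bar>Laguerre (a + real i) n t\<bar> + sqrt (w a t) * \<bar>Laguerre (a + real i) m t\<bar>"
          unfolding distrib_left[symmetric] by (rule mult_left_mono) (simp add: w_nonneg)
        also have "\<dots> \<le> D * real (Suc k) powr (a / 2 + real r) + D * real (Suc k) powr (a / 2 + real r)"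
          unfolding sqrt_w[OF t] using D'[OF t n] D'[OF t, of m k] n Suc by (intro add_mono) auto
        finally show ?thesis by simp
      qed
    qed
    have "\<bar>laguerre_deriv a j k t\<bar> * sqrt (w a t) \<le> (C * (2 * D)) * real (Suc k) ^ r" if t: "0 < t" for k t
    proof -
      have "\<bar>laguerre_deriv a j k t\<bar> * sqrt (w a t)
          \<le> sqrt (fact k / Gamma (real k + a + 1)) * (sqrt (w a t) * \<bar>Laguerre (a + real j) (k - j) t\<bar>)"
        using a by (auto simp: laguerre_deriv_def abs_mult Gamma_real_pos less_imp_le w_nonneg)
      also have "\<dots> \<le> (C * real (Suc k) powr (- a / 2)) * (2 * D * real (Suc k) powr (a / 2 + real r))"
        using C D t by (intro mult_mono L C) (auto simp: w_nonneg)
      also have "\<dots> = (C * (2 * D)) * real (Suc k) powr (- a / 2 + (a / 2 + real r))"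
        by (simp only: powr_add mult_ac)
      \<comment> \<open>The normalization cancels exactly the growth that comes from the parameter
        \<open>a\<close>.\<close>
      also have "- a / 2 + (a / 2 + real r) = real r" by simp
      finally show ?thesis by (simp add: powr_realpow)
    qed
    then show ?thesis using C D by (intro exI[of _ "C * (2 * D)"]) auto
  qed
  then obtain B where B: "\<And>j. j \<le> r \<Longrightarrow> 0 < B j"
    "\<And>j k t. j \<le> r \<Longrightarrow> 0 < t \<Longrightarrow> \<bar>laguerre_deriv a j k t\<bar> * sqrt (w a t) \<le> B j * real (Suc k) ^ r"
    by metis
  show ?thesis
  proof (rule that)
    have le: "B j \<le> sum B {..r}" if "j \<le> r" for j
      using that B(1) by (intro member_le_sum) (auto intro: less_imp_le)
    show "0 < sum B {..r}" using le[of 0] B(1)[of 0] by simp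
    show "\<bar>laguerre_deriv a j k t\<bar> * sqrt (w a t) \<le> sum B {..r} * real (Suc k) ^ r"
      if "j \<le> r" "0 < t" for j k t
      using B(2)[OF that, of k] mult_right_mono[OF le[OF that(1)], of "real (Suc k) ^ r"] by (meson order_trans zero_le_power of_nat_0_le_iff)
  qed
qed

subsection \<open>Representatives of class \<open>C\<^sup>r\<close>\<close>

text \<open>An explicit chain of derivatives on an open set replaces the iterated
  \<open>deriv\<close>. Openness lets the induction hypothesis hold in a whole neighbourhood of
  \<open>t\<close>, as \<open>deriv\<close> demands.\<close>

lemma higher_deriv_eq:
  fixes h :: "nat \<Rightarrow> real \<Rightarrow> real"
  assumes "open S" and "\<And>j t. j < r \<Longrightarrow> t \<in> S \<Longrightarrow> (h j has_field_derivative h (Suc j) t) (at t)"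
    and "j \<le> r" "t \<in> S"
  shows "(deriv ^^ j) (h 0) t = h j t"
  using assms(3,4)
proof (induction j arbitrary: t)
  case (Suc j)
  have "\<forall>\<^sub>F x in nhds t. (deriv ^^ j) (h 0) x = h j x"
    using Suc eventually_nhds_in_open[OF assms(1) Suc.prems(2)] by (auto elim: eventually_mono)
  then have "deriv ((deriv ^^ j) (h 0)) t = deriv (h j) t"
    by (rule deriv_cong_ev) simp
  also have "\<dots> = h (Suc j) t" using assms(2)[of j t] Suc.prems by (intro DERIV_imp_deriv) auto
  finally show ?case by simp
qed simp

lemma Cr_posI:
  assumes "\<And>j t. j < r \<Longrightarrow> 0 < t \<Longrightarrow> (h j has_field_derivative h (Suc j) t) (at t)"
    and "continuous_on {0<..} (h r)"
  shows "h 0 \<in> Cr_pos r"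
proof -
  have eq: "(deriv ^^ j) (h 0) t = h j t" if "j \<le> r" "0 < t" for j t
    using that assms(1) by (intro higher_deriv_eq[of "{0<..}" r]) auto
  have "(deriv ^^ j) (h 0) field_differentiable at t" if "j < r" "0 < t" for j t
  proof -
    have "\<forall>\<^sub>F x in nhds t. x \<in> {0<..}" using that by (intro eventually_nhds_in_open) auto
    then have "\<forall>\<^sub>F x in nhds t. (deriv ^^ j) (h 0) x = h j x"
      by eventually_elim (use eq that in auto)
    then have "((deriv ^^ j) (h 0) has_field_derivative h (Suc j) t) (at t)"
      using assms(1)[OF that] by (subst DERIV_cong_ev) auto
    then show ?thesis by (auto simp: field_differentiable_def)
  qed
  moreover have "continuous_on {0<..} ((deriv ^^ r) (h 0))"
    using assms(2) by (subst continuous_on_cong[OF refl eq]) auto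
  ultimately show ?thesis by (simp add: Cr_pos_def)
qed

lemma Cr_pos_continuous_on: "g \<in> Cr_pos r \<Longrightarrow> continuous_on {0<..} g"
proof (cases "r = 0")
  case False
  assume "g \<in> Cr_pos r"
  with False have "g field_differentiable at t" if "0 < t" for t
    using that by (force simp: Cr_pos_def dest: spec[of _ 0])
  then show ?thesis
    by (intro continuous_at_imp_continuous_on) (auto intro: field_differentiable_imp_continuous_at)
qed (simp add: Cr_pos_def)

text \<open>The set of disagreement is open, and a nonempty open set is not negligible.\<close>

lemma continuous_AE_eq:
  fixes g h :: "real \<Rightarrow> real"
  assumes g: "continuous_on {0<..} g" and h: "continuous_on {0<..} h"
    and ae: "AE t in leb_pos. g t = h t" and t: "0 < t"
  shows "g t = h t"
proof (rule ccontr)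
  assume neq: "g t \<noteq> h t"
  let ?S = "{t \<in> {0<..}. g t - h t \<in> - {0}}"
  have "open ?S"
    using continuous_open_preimage[of "{0<..}" "\<lambda>t. g t - h t" "- {0}"] g h
    by (auto simp: vimage_def Int_def intro!: continuous_intros)
  moreover have "?S \<noteq> {}" using neq t by auto
  ultimately have "\<not> negligible ?S" by (rule open_not_negligible)
  moreover have "negligible ?S"
  proof -
    have "AE t in lebesgue. t \<in> {0<..} \<longrightarrow> g t = h t"
      using ae by (simp add: AE_restrict_space_iff)
    then obtain N where "N \<in> null_sets lebesgue" "{t. \<not> (t \<in> {0<..} \<longrightarrow> g t = h t)} \<subseteq> N"
      unfolding eventually_ae_filter by auto
    moreover have "?S \<subseteq> {t. \<not> (t \<in> {0<..} \<longrightarrow> g t = h t)}" by auto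
    ultimately show ?thesis by (meson negligible_iff_null_sets negligible_subset)
  qed
  ultimately show False by blast
qed

text \<open>Frees \<open>rth_deriv\<close> from the choice made by \<open>SOME\<close>: any two
  representatives agree throughout the half-line, hence near \<open>t\<close>, and so do their
  derivatives.\<close>

lemma rth_deriv_eq:
  assumes "g \<in> Cr_pos r" and "AE t in leb_pos. g t = f t" and t: "0 < t"
  shows "rth_deriv r f t = (deriv ^^ r) g t"
proof -
  define g' where "g' = (SOME g. g \<in> Cr_pos r \<and> (AE t in leb_pos. g t = f t))"
  have "g' \<in> Cr_pos r \<and> (AE t in leb_pos. g' t = f t)"
    unfolding g'_def by (rule someI[of _ g]) (use assms in auto)
  then have g': "g' \<in> Cr_pos r" "AE t in leb_pos. g' t = f t" by auto
  have "AE t in leb_pos. g' t = g t" using g'(2) assms(2) by eventually_elim simp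
  then have eq: "g' x = g x" if "0 < x" for x
    using that by (intro continuous_AE_eq Cr_pos_continuous_on[OF g'(1)] Cr_pos_continuous_on[OF assms(1)])
  have "\<forall>\<^sub>F x in nhds t. x \<in> {0<..}" using t by (intro eventually_nhds_in_open) auto
  then have "\<forall>\<^sub>F x in nhds t. g' x = g x" by eventually_elim (use eq in auto)
  then show ?thesis unfolding rth_deriv_def g'_def[symmetric] by (rule higher_deriv_cong_ev) simp
qed

subsection \<open>Laguerre series\<close>

lemma integrable_sqrt_w_exp_power:
  assumes "0 \<le> a" "b < 1 / 2"
  shows "integrable leb_pos (\<lambda>t. sqrt (w a t) * exp (b * t) * t ^ k)"
proof -
  have eq: "sqrt (w a t) * exp (b * t) * t ^ k = t powr (a / 2 + real k + 1 - 1) * exp (- (1 / 2 - b) * t)"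
    if "t \<in> space leb_pos" for t
  proof -
    have t: "0 < t" using that by simp
    have "exp (- (1 / 2 - b) * t) = exp (- t / 2) * exp (b * t)"
      by (simp add: algebra_simps flip: exp_add)
    then show ?thesis using t by (simp add: sqrt_w powr_add powr_realpow)
  qed
  show ?thesis
    using integrable_leb_pos_exp_powr[of "a / 2 + real k + 1" "1 / 2 - b"] assms
    by (subst Bochner_Integration.integrable_cong[OF refl eq]) auto
qed

lemma integrable_sqrt_w_laguerre_on:
  assumes "0 \<le> a"
  shows "integrable leb_pos (\<lambda>t. sqrt (w a t) * laguerre_on a k t)"
proof -
  have eq: "sqrt (w a t) * laguerre_on a k t = (\<Sum>j\<le>k. sqrt (fact k / Gamma (real k + a + 1)) *
      ((- 1) ^ j / fact j * rbinom (a + real j) (k - j)) * (sqrt (w a t) * exp (0 * t) * t ^ j))" for t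
    unfolding laguerre_on_def Laguerre_altdef sum_distrib_left
    by (intro sum.cong) (auto simp: power_minus[of t])
  show ?thesis unfolding eq using assms
    by (intro Bochner_Integration.integrable_sum integrable_mult_right integrable_sqrt_w_exp_power) auto
qed

text \<open>Stands in for Cauchy-Schwarz: products with \<open>f\<close> under the weight are
  dominated by a sum of two integrable functions.\<close>

lemma abs_mult_le_sum_squares: "\<bar>x * y\<bar> \<le> x\<^sup>2 + y\<^sup>2" for x y :: real
proof -
  have "0 \<le> \<bar>x\<bar> * \<bar>y\<bar>" by simp
  moreover have "2 * \<bar>x\<bar> * \<bar>y\<bar> \<le> x\<^sup>2 + y\<^sup>2" using sum_squares_bound[of "\<bar>x\<bar>" "\<bar>y\<bar>"] by simp
  ultimately show ?thesis unfolding abs_mult by linarith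
qed

text \<open>The Laguerre polynomials are triangular in the powers with nonzero leading coefficients,
  so vanishing coefficients give vanishing moments by strong induction.\<close>

lemma laguerre_coeffs_zero_imp_AE_zero:
  assumes u: "integrable leb_pos (\<lambda>t. u t * exp (c * t))" and c: "0 < c"
    and zero: "\<And>k. integral\<^sup>L leb_pos (\<lambda>t. u t * Laguerre a k t) = 0"
  shows "AE t in leb_pos. u t = 0"
proof (rule AE_zero_if_moments_zero[OF c u])
  have int: "integrable leb_pos (\<lambda>t. u t * t ^ j)" for j
    using integrable_power_exp[OF c u, of 0 j] by simp
  show "integral\<^sup>L leb_pos (\<lambda>t. u t * t ^ k) = 0" for k
  proof (induction k rule: less_induct)
    case (less k)
    let ?c = "\<lambda>j. (- 1) ^ j / fact j * rbinom (a + real j) (k - j)"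
    have eq: "u t * Laguerre a k t = (\<Sum>j\<le>k. ?c j * (u t * t ^ j))" for t
      unfolding Laguerre_altdef sum_distrib_left by (intro sum.cong) (auto simp: power_minus[of t])
    have "0 = (\<Sum>j\<le>k. ?c j * integral\<^sup>L leb_pos (\<lambda>t. u t * t ^ j))"
      using zero[of k] int unfolding eq by (subst (asm) Bochner_Integration.integral_sum) auto
    also have "\<dots> = (\<Sum>j\<in>{k}. ?c j * integral\<^sup>L leb_pos (\<lambda>t. u t * t ^ j))"
      using less.IH by (intro sum.mono_neutral_right) auto
    finally show ?case by simp
  qed
qed

section \<open>Laguerre series with coefficients absolutely summable against (k + 1)^r\<close>

context
  fixes a :: real and r :: nat and B :: real and c :: "nat \<Rightarrow> real"
  assumes a: "0 \<le> a" and r: "1 \<le> r"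
    and B: "\<And>j k t. j \<le> r \<Longrightarrow> 0 < t \<Longrightarrow> \<bar>laguerre_deriv a j k t\<bar> * sqrt (w a t) \<le> B * real (Suc k) ^ r"
    and c: "summable (\<lambda>k. \<bar>c k\<bar> * real (Suc k) ^ r)"
begin

definition laguerre_series :: "nat \<Rightarrow> real \<Rightarrow> real" where
  "laguerre_series j t = (\<Sum>k. c k * laguerre_deriv a j k t)"

lemma laguerre_term_weighted_le:
  assumes "j \<le> r" "0 < t"
  shows "\<bar>c k * laguerre_deriv a j k t\<bar> * sqrt (w a t) \<le> B * (\<bar>c k\<bar> * real (Suc k) ^ r)"
  using mult_left_mono[OF B[OF assms, of k], of "\<bar>c k\<bar>"] by (simp add: abs_mult mult_ac)

lemma sqrt_w_lower:
  assumes "0 < x" "x \<le> t" "t \<le> y"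
  shows "x powr (a / 2) * exp (- y / 2) \<le> sqrt (w a t)"
  unfolding sqrt_w[OF order.strict_trans2[OF assms(1,2)]]
  using assms a by (intro mult_mono powr_mono2) auto

text \<open>On a compact interval inside the half-line the weight has a positive lower bound, so the
  weighted bound becomes a majorant for Weierstrass' test.\<close>

lemma laguerre_term_le:
  assumes "j \<le> r" "0 < x" "t \<in> {x..y}"
  shows "norm (c k * laguerre_deriv a j k t) \<le> B / (x powr (a / 2) * exp (- y / 2)) * (\<bar>c k\<bar> * real (Suc k) ^ r)"
proof -
  have t: "0 < t" using assms by simp
  let ?m = "x powr (a / 2) * exp (- y / 2)"
  have m: "0 < ?m" using assms by simp
  have "\<bar>c k * laguerre_deriv a j k t\<bar> * ?m \<le> \<bar>c k * laguerre_deriv a j k t\<bar> * sqrt (w a t)"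
    using sqrt_w_lower[of x t y] assms by (intro mult_left_mono) auto
  also have "\<dots> \<le> B * (\<bar>c k\<bar> * real (Suc k) ^ r)"
    by (rule laguerre_term_weighted_le[OF assms(1) t])
  finally show ?thesis using m by (simp add: field_simps)
qed

lemma uniform_limit_laguerre_series:
  assumes "j \<le> r" "0 < x"
  shows "uniform_limit {x..y} (\<lambda>n t. \<Sum>k<n. c k * laguerre_deriv a j k t) (laguerre_series j) sequentially"
  unfolding laguerre_series_def[abs_def]
  by (rule Weierstrass_m_test[OF laguerre_term_le[OF assms] summable_mult[OF c]])

lemma summable_laguerre_series:
  assumes "j \<le> r" "0 < t"
  shows "summable (\<lambda>k. c k * laguerre_deriv a j k t)"
  by (rule summable_comparison_test'[OF summable_mult[OF c] laguerre_term_le[OF assms, of t t]]) simp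

lemma has_field_derivative_laguerre_series:
  assumes "j < r" "0 < t"
  shows "(laguerre_series j has_field_derivative laguerre_series (Suc j) t) (at t)"
proof -
  let ?S = "{t / 2..2 * t}"
  have 1: "((\<lambda>t. c n * laguerre_deriv a j n t) has_field_derivative c n * laguerre_deriv a (Suc j) n x) (at x within ?S)"
    for n x
    by (rule has_field_derivative_at_within[OF DERIV_cmult[OF has_field_derivative_laguerre_deriv]])
  have 2: "uniformly_convergent_on ?S (\<lambda>n x. \<Sum>i<n. c i * laguerre_deriv a (Suc j) i x)"
    using uniform_limit_laguerre_series[of "Suc j" "t / 2" "2 * t"] assms
    unfolding uniformly_convergent_on_def by auto
  have 3: "summable (\<lambda>n. c n * laguerre_deriv a j n t)"
    using assms by (intro summable_laguerre_series) auto
  have 4: "t \<in> ?S" "t \<in> interior ?S" using assms by auto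
  show ?thesis
    unfolding laguerre_series_def[abs_def]
    by (rule has_field_derivative_series'(2)[OF convex_real_interval(5) 1 2 4(1) 3 4(2)])
qed

lemma continuous_on_laguerre_series:
  assumes "j \<le> r"
  shows "continuous_on {0<..} (laguerre_series j)"
proof (rule continuous_at_imp_continuous_on, rule ballI)
  fix t :: real assume "t \<in> {0<..}"
  then have t: "0 < t" by simp
  have "continuous_on {t / 2..2 * t} (laguerre_series j)"
    by (rule uniform_limit_theorem[OF _ uniform_limit_laguerre_series[OF assms]])
      (use t in \<open>auto intro!: continuous_intros always_eventually\<close>)
  then show "isCont (laguerre_series j) t"
    by (rule continuous_on_interior) (use t in auto)
qed

lemma laguerre_series_Cr_pos: "laguerre_series 0 \<in> Cr_pos r"
  by (rule Cr_posI) (auto intro: has_field_derivative_laguerre_series continuous_on_laguerre_series)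

lemma higher_deriv_laguerre_series: "0 < t \<Longrightarrow> (deriv ^^ r) (laguerre_series 0) t = laguerre_series r t"
  by (rule higher_deriv_eq[of "{0<..}" r]) (auto intro: has_field_derivative_laguerre_series)

lemma laguerre_partial_sum_weighted_le:
  assumes "j \<le> r" "0 < t"
  shows "\<bar>\<Sum>k<n. c k * laguerre_deriv a j k t\<bar> * sqrt (w a t) \<le> B * (\<Sum>k. \<bar>c k\<bar> * real (Suc k) ^ r)"
proof -
  have "0 \<le> \<bar>laguerre_deriv a j 0 t\<bar> * sqrt (w a t)" by (simp add: w_nonneg)
  also have "\<dots> \<le> B" using B[OF assms, of 0] by simp
  finally have B0: "0 \<le> B" .
  have "\<bar>\<Sum>k<n. c k * laguerre_deriv a j k t\<bar> * sqrt (w a t)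
      \<le> (\<Sum>k<n. \<bar>c k * laguerre_deriv a j k t\<bar>) * sqrt (w a t)"
    by (intro mult_right_mono sum_abs) (simp add: w_nonneg)
  also have "\<dots> \<le> (\<Sum>k<n. B * (\<bar>c k\<bar> * real (Suc k) ^ r))"
    unfolding sum_distrib_right by (intro sum_mono laguerre_term_weighted_le assms)
  also have "\<dots> \<le> B * (\<Sum>k. \<bar>c k\<bar> * real (Suc k) ^ r)"
    unfolding sum_distrib_left[symmetric] using B0 c
    by (intro mult_left_mono sum_le_suminf) auto
  finally show ?thesis .
qed

lemma laguerre_series_weighted_le:
  assumes "j \<le> r" "0 < t"
  shows "\<bar>laguerre_series j t\<bar> * sqrt (w a t) \<le> B * (\<Sum>k. \<bar>c k\<bar> * real (Suc k) ^ r)"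
proof (rule LIMSEQ_le_const2)
  show "(\<lambda>n. \<bar>\<Sum>k<n. c k * laguerre_deriv a j k t\<bar> * sqrt (w a t)) \<longlonglongrightarrow> \<bar>laguerre_series j t\<bar> * sqrt (w a t)"
    unfolding laguerre_series_def
    by (intro tendsto_mult tendsto_rabs summable_LIMSEQ summable_laguerre_series assms tendsto_const)
qed (use laguerre_partial_sum_weighted_le[OF assms] in auto)

lemma laguerre_series_measurable: "laguerre_series 0 \<in> borel_measurable leb_pos"
  by (intro continuous_imp_measurable_on_sets_lebesgue continuous_on_laguerre_series) auto

text \<open>Termwise integration by dominated convergence. The weight is shared out: one factor sqrt
  w makes the partial sums uniformly bounded, the other makes \<open>laguerre_on a m\<close>
  integrable.\<close>

lemma laguerre_series_coeff:
  "integrable leb_pos (\<lambda>t. w a t * laguerre_series 0 t * laguerre_on a m t)"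
  "integral\<^sup>L leb_pos (\<lambda>t. w a t * laguerre_series 0 t * laguerre_on a m t) = c m"
proof -
  let ?M = "B * (\<Sum>k. \<bar>c k\<bar> * real (Suc k) ^ r)"
  let ?S = "\<lambda>n t. \<Sum>k<n. c k * laguerre_deriv a 0 k t"
  let ?f = "\<lambda>n t. w a t * ?S n t * laguerre_on a m t"
  have dom: "\<bar>w a t * y * laguerre_on a m t\<bar> \<le> ?M * \<bar>sqrt (w a t) * laguerre_on a m t\<bar>"
    if "\<bar>y\<bar> * sqrt (w a t) \<le> ?M" for y t
  proof -
    have "\<bar>w a t * y * laguerre_on a m t\<bar> = (sqrt (w a t) * sqrt (w a t)) * \<bar>y\<bar> * \<bar>laguerre_on a m t\<bar>"
      by (simp add: w_nonneg abs_mult)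
    also have "\<dots> = (\<bar>y\<bar> * sqrt (w a t)) * \<bar>sqrt (w a t) * laguerre_on a m t\<bar>"
      by (simp add: w_nonneg abs_mult)
    also have "\<dots> \<le> ?M * \<bar>sqrt (w a t) * laguerre_on a m t\<bar>"
      using that by (rule mult_right_mono) simp
    finally show ?thesis .
  qed
  have f_eq: "?f n t = (\<Sum>k<n. c k * (w a t * laguerre_on a k t * laguerre_on a m t))" for n t
    unfolding sum_distrib_left sum_distrib_right laguerre_deriv_0 by (intro sum.cong) auto
  have fi: "integrable leb_pos (?f n)" for n
    unfolding f_eq by (intro Bochner_Integration.integrable_sum integrable_mult_right laguerre_on_orthonormal a)
  have domi: "integrable leb_pos (\<lambda>t. ?M * \<bar>sqrt (w a t) * laguerre_on a m t\<bar>)"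
    by (intro integrable_mult_right integrable_abs integrable_sqrt_w_laguerre_on a)
  have meas: "(\<lambda>t. w a t * laguerre_series 0 t * laguerre_on a m t) \<in> borel_measurable leb_pos"
    unfolding laguerre_on_def
    by (intro borel_measurable_times borel_measurable_const laguerre_series_measurable
        borel_measurable_leb_pos[OF borel_measurable_w] borel_measurable_leb_pos[OF borel_measurable_Laguerre])
  show "integrable leb_pos (\<lambda>t. w a t * laguerre_series 0 t * laguerre_on a m t)"
  proof (rule Bochner_Integration.integrable_bound[OF domi meas], rule AE_I2)
    fix t assume "t \<in> space leb_pos"
    then have "\<bar>laguerre_series 0 t\<bar> * sqrt (w a t) \<le> ?M"
      by (intro laguerre_series_weighted_le) auto
    from dom[OF this]
    show "norm (w a t * laguerre_series 0 t * laguerre_on a m t) \<le> norm (?M * \<bar>sqrt (w a t) * laguerre_on a m t\<bar>)"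
      unfolding real_norm_def by (rule order_trans) (rule abs_ge_self)
  qed
  have "(\<lambda>n. integral\<^sup>L leb_pos (?f n)) \<longlonglongrightarrow> integral\<^sup>L leb_pos (\<lambda>t. w a t * laguerre_series 0 t * laguerre_on a m t)"
  proof (rule integral_dominated_convergence[OF meas _ domi])
    show "?f n \<in> borel_measurable leb_pos" for n using fi by (rule borel_measurable_integrable)
    show "AE t in leb_pos. (\<lambda>n. ?f n t) \<longlonglongrightarrow> w a t * laguerre_series 0 t * laguerre_on a m t"
      unfolding laguerre_series_def
      by (intro AE_I2 tendsto_mult tendsto_const summable_LIMSEQ summable_laguerre_series) auto
    show "AE t in leb_pos. norm (?f n t) \<le> ?M * \<bar>sqrt (w a t) * laguerre_on a m t\<bar>" for n
      unfolding real_norm_def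
      by (intro AE_I2 dom laguerre_partial_sum_weighted_le) auto
  qed
  moreover have "integral\<^sup>L leb_pos (?f n) = c m" if "m < n" for n
  proof -
    have "integral\<^sup>L leb_pos (?f n) = (\<Sum>k<n. c k * (if k = m then 1 else 0))"
      unfolding f_eq using laguerre_on_orthonormal[OF a]
      by (subst Bochner_Integration.integral_sum) auto
    also have "\<dots> = c m" using that by (simp add: if_distrib sum.delta cong: if_cong)
    finally show ?thesis .
  qed
  then have "\<forall>\<^sub>F n in sequentially. integral\<^sup>L leb_pos (?f n) = c m"
    by (rule eventually_mono[OF eventually_gt_at_top[of m]])
  then have "(\<lambda>n. integral\<^sup>L leb_pos (?f n)) \<longlonglongrightarrow> c m" by (rule tendsto_eventually)
  ultimately show "integral\<^sup>L leb_pos (\<lambda>t. w a t * laguerre_series 0 t * laguerre_on a m t) = c m"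
    by (rule LIMSEQ_unique)
qed

text \<open>The weighted difference \<open>u\<close> has vanishing Laguerre coefficients. It remains
  to find an exponential moment for it, and the rate 1/4 suits both the series and
  \<open>f\<close>.\<close>

lemma L2w_AE_laguerre_series:
  assumes f: "f \<in> L2w a" and G: "G a f = c"
  shows "AE t in leb_pos. laguerre_series 0 t = f t"
proof -
  have fm: "f \<in> borel_measurable leb_pos" and fi: "integrable leb_pos (\<lambda>t. w a t * (f t)\<^sup>2)"
    using f by (auto simp: L2w_def set_integrable_leb_pos)
  let ?M = "B * (\<Sum>k. \<bar>c k\<bar> * real (Suc k) ^ r)"
  define u where "u = (\<lambda>t. w a t * (laguerre_series 0 t - f t))"
  have wm: "w a \<in> borel_measurable leb_pos" by (rule borel_measurable_leb_pos[OF borel_measurable_w])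
  have em: "(\<lambda>t. exp (b * t)) \<in> borel_measurable leb_pos" for b :: real
    by (rule borel_measurable_leb_pos) measurable
  have wexp: "integrable leb_pos (\<lambda>t. w a t * exp (1 / 2 * t))"
  proof -
    have eq: "w a t * exp (1 / 2 * t) = t powr (a + 1 - 1) * exp (- (1 / 2) * t)" for t
      by (simp add: w_def flip: exp_add)
    show ?thesis unfolding eq using a by (intro integrable_leb_pos_exp_powr) auto
  qed
  \<comment> \<open>Squaring the exponential doubles its rate to 1/2, which the factor exp (- t) in
    the weight still absorbs.\<close>
  have i1: "integrable leb_pos (\<lambda>t. w a t * f t * exp (1 / 4 * t))"
  proof (rule Bochner_Integration.integrable_bound)
    show "integrable leb_pos (\<lambda>t. w a t * (f t)\<^sup>2 + w a t * exp (1 / 2 * t))"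
      by (intro Bochner_Integration.integrable_add fi wexp)
    show "(\<lambda>t. w a t * f t * exp (1 / 4 * t)) \<in> borel_measurable leb_pos"
      by (intro borel_measurable_times wm fm em)
    show "AE t in leb_pos. norm (w a t * f t * exp (1 / 4 * t)) \<le> norm (w a t * (f t)\<^sup>2 + w a t * exp (1 / 2 * t))"
    proof (rule AE_I2)
      fix t :: real
      have "(exp (1 / 4 * t))\<^sup>2 = exp (1 / 2 * t)" by (simp add: power2_eq_square flip: exp_add)
      then have "\<bar>f t * exp (1 / 4 * t)\<bar> \<le> (f t)\<^sup>2 + exp (1 / 2 * t)"
        using abs_mult_le_sum_squares[of "f t" "exp (1 / 4 * t)"] by simp
      then have "w a t * \<bar>f t * exp (1 / 4 * t)\<bar> \<le> w a t * ((f t)\<^sup>2 + exp (1 / 2 * t))"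
        by (rule mult_left_mono) (rule w_nonneg)
      moreover have "norm (w a t * f t * exp (1 / 4 * t)) = w a t * \<bar>f t * exp (1 / 4 * t)\<bar>"
        by (simp add: abs_mult w_nonneg)
      moreover have "w a t * ((f t)\<^sup>2 + exp (1 / 2 * t)) \<le> norm (w a t * (f t)\<^sup>2 + w a t * exp (1 / 2 * t))"
        by (simp only: distrib_left real_norm_def abs_ge_self)
      ultimately show "norm (w a t * f t * exp (1 / 4 * t)) \<le> norm (w a t * (f t)\<^sup>2 + w a t * exp (1 / 2 * t))"
        by linarith
    qed
  qed
  \<comment> \<open>One factor sqrt w bounds the series; the other decays like exp (- t / 2) and
    beats the rate 1/4.\<close>
  have i2: "integrable leb_pos (\<lambda>t. w a t * laguerre_series 0 t * exp (1 / 4 * t))"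
  proof (rule Bochner_Integration.integrable_bound)
    show "integrable leb_pos (\<lambda>t. ?M * (sqrt (w a t) * exp (1 / 4 * t) * t ^ 0))"
      by (intro integrable_mult_right integrable_sqrt_w_exp_power a) simp
    show "(\<lambda>t. w a t * laguerre_series 0 t * exp (1 / 4 * t)) \<in> borel_measurable leb_pos"
      by (intro borel_measurable_times wm laguerre_series_measurable em)
    show "AE t in leb_pos. norm (w a t * laguerre_series 0 t * exp (1 / 4 * t))
        \<le> norm (?M * (sqrt (w a t) * exp (1 / 4 * t) * t ^ 0))"
    proof (rule AE_I2)
      fix t assume "t \<in> space leb_pos"
      then have le: "\<bar>laguerre_series 0 t\<bar> * sqrt (w a t) \<le> ?M"
        by (intro laguerre_series_weighted_le) auto
      have "norm (w a t * laguerre_series 0 t * exp (1 / 4 * t))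
          = (sqrt (w a t) * sqrt (w a t)) * \<bar>laguerre_series 0 t\<bar> * exp (1 / 4 * t)"
        by (simp add: abs_mult w_nonneg)
      also have "\<dots> = (\<bar>laguerre_series 0 t\<bar> * sqrt (w a t)) * (sqrt (w a t) * exp (1 / 4 * t))"
        by (simp only: mult_ac)
      also have "\<dots> \<le> ?M * (sqrt (w a t) * exp (1 / 4 * t))"
        using le by (rule mult_right_mono) (simp add: w_nonneg)
      also have "\<dots> \<le> norm (?M * (sqrt (w a t) * exp (1 / 4 * t) * t ^ 0))"
        by (simp only: power_0 mult_1_right real_norm_def abs_ge_self)
      finally show "norm (w a t * laguerre_series 0 t * exp (1 / 4 * t))
        \<le> norm (?M * (sqrt (w a t) * exp (1 / 4 * t) * t ^ 0))" .
    qed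
  qed
  have ui: "integrable leb_pos (\<lambda>t. u t * exp (1 / 4 * t))"
    using Bochner_Integration.integrable_diff[OF i2 i1] by (simp add: u_def left_diff_distrib right_diff_distrib)
  have "AE t in leb_pos. u t = 0"
  proof (rule laguerre_coeffs_zero_imp_AE_zero[OF ui])
    fix k
    let ?s = "sqrt (fact k / Gamma (real k + a + 1))"
    have s: "0 < ?s" using Gamma_real_pos[of "real k + a + 1"] a by simp
    have fk: "integrable leb_pos (\<lambda>t. w a t * f t * laguerre_on a k t)"
    proof (rule Bochner_Integration.integrable_bound)
      show "integrable leb_pos (\<lambda>t. w a t * (f t)\<^sup>2 + w a t * laguerre_on a k t * laguerre_on a k t)"
        by (intro Bochner_Integration.integrable_add fi laguerre_on_orthonormal a)
      show "(\<lambda>t. w a t * f t * laguerre_on a k t) \<in> borel_measurable leb_pos"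
        unfolding laguerre_on_def
        by (intro borel_measurable_times wm fm borel_measurable_const borel_measurable_leb_pos[OF borel_measurable_Laguerre])
      show "AE t in leb_pos. norm (w a t * f t * laguerre_on a k t)
          \<le> norm (w a t * (f t)\<^sup>2 + w a t * laguerre_on a k t * laguerre_on a k t)"
      proof (rule AE_I2)
        fix t
        have "\<bar>f t * laguerre_on a k t\<bar> \<le> (f t)\<^sup>2 + (laguerre_on a k t)\<^sup>2"
          by (rule abs_mult_le_sum_squares)
        then have "w a t * \<bar>f t * laguerre_on a k t\<bar> \<le> w a t * ((f t)\<^sup>2 + (laguerre_on a k t)\<^sup>2)"
          by (rule mult_left_mono) (rule w_nonneg)
        then show "norm (w a t * f t * laguerre_on a k t)
          \<le> norm (w a t * (f t)\<^sup>2 + w a t * laguerre_on a k t * laguerre_on a k t)"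
          by (simp add: abs_mult w_nonneg distrib_left power2_eq_square mult.assoc)
      qed
    qed
    have "integral\<^sup>L leb_pos (\<lambda>t. w a t * f t * laguerre_on a k t) = c k"
      unfolding G[symmetric] G_def inner_w_def set_integral_leb_pos ..
    then have "integral\<^sup>L leb_pos (\<lambda>t. w a t * laguerre_series 0 t * laguerre_on a k t - w a t * f t * laguerre_on a k t) = 0"
      using laguerre_series_coeff[of k] fk by simp
    moreover have "w a t * laguerre_series 0 t * laguerre_on a k t - w a t * f t * laguerre_on a k t
        = ?s * (u t * Laguerre a k t)" for t
      by (simp only: u_def laguerre_on_def algebra_simps)
    ultimately have "?s * integral\<^sup>L leb_pos (\<lambda>t. u t * Laguerre a k t) = 0" by (simp only: integral_mult_right_zero)
    then show "integral\<^sup>L leb_pos (\<lambda>t. u t * Laguerre a k t) = 0" using s by (metis less_irrefl mult_eq_0_iff)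
  qed simp
  then show ?thesis
  proof (rule AE_mp, intro AE_I2 impI)
    fix t assume "t \<in> space leb_pos" "u t = 0"
    then show "laguerre_series 0 t = f t" by (auto simp: u_def w_def)
  qed
qed

lemma rth_deriv_L2w:
  assumes "f \<in> L2w a" "G a f = c" "0 < t"
  shows "summable (\<lambda>k. c k * laguerre_deriv a r k t)"
    and "rth_deriv r f t = (\<Sum>k. c k * laguerre_deriv a r k t)"
proof -
  show "summable (\<lambda>k. c k * laguerre_deriv a r k t)"
    using assms by (intro summable_laguerre_series) auto
  have "rth_deriv r f t = (deriv ^^ r) (laguerre_series 0) t"
    by (intro rth_deriv_eq laguerre_series_Cr_pos L2w_AE_laguerre_series assms)
  then show "rth_deriv r f t = (\<Sum>k. c k * laguerre_deriv a r k t)"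
    using higher_deriv_laguerre_series[OF assms(3)] by (simp add: laguerre_series_def)
qed

end

section \<open>Finite Laguerre sums\<close>

lemma higher_deriv_laguerre_sum:
  "(deriv ^^ j) (\<lambda>t. \<Sum>k\<in>A. c k * laguerre_on a k t) = (\<lambda>t. \<Sum>k\<in>A. c k * laguerre_deriv a j k t)"
proof
  fix t
  have "(deriv ^^ j) ((\<lambda>j t. \<Sum>k\<in>A. c k * laguerre_deriv a j k t) 0) t = (\<Sum>k\<in>A. c k * laguerre_deriv a j k t)"
    by (rule higher_deriv_eq[of UNIV j])
      (auto intro!: DERIV_sum DERIV_cmult has_field_derivative_laguerre_deriv)
  then show "(deriv ^^ j) (\<lambda>t. \<Sum>k\<in>A. c k * laguerre_on a k t) t = (\<Sum>k\<in>A. c k * laguerre_deriv a j k t)"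
    by (simp add: laguerre_deriv_0)
qed

lemma laguerre_polynomial_L2w:
  fixes c :: "nat \<Rightarrow> real"
  assumes a: "0 \<le> a" and A: "finite A"
  defines "f \<equiv> (\<lambda>t. \<Sum>k\<in>A. c k * laguerre_on a k t)"
  shows "f \<in> L2w a" and "G a f = (\<lambda>k. if k \<in> A then c k else 0)"
proof -
  have eq: "w a t * (f t)\<^sup>2 = (\<Sum>k\<in>A. \<Sum>l\<in>A. c k * c l * (w a t * laguerre_on a k t * laguerre_on a l t))" for t
  proof -
    have "(f t)\<^sup>2 = (\<Sum>k\<in>A. \<Sum>l\<in>A. c k * laguerre_on a k t * (c l * laguerre_on a l t))"
      unfolding f_def power2_eq_square by (rule sum_product)
    then show ?thesis
      by (simp only: sum_distrib_left) (intro sum.cong refl, simp only: mult_ac)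
  qed
  have "f \<in> borel_measurable leb_pos"
    unfolding f_def laguerre_on_def by (rule borel_measurable_leb_pos) measurable
  moreover have "integrable leb_pos (\<lambda>t. w a t * (f t)\<^sup>2)"
    unfolding eq by (intro Bochner_Integration.integrable_sum integrable_mult_right laguerre_on_orthonormal a)
  ultimately show "f \<in> L2w a" by (simp add: L2w_def set_integrable_leb_pos)
  show "G a f = (\<lambda>k. if k \<in> A then c k else 0)"
  proof
    fix m
    have eq: "w a t * f t * laguerre_on a m t = (\<Sum>k\<in>A. c k * (w a t * laguerre_on a k t * laguerre_on a m t))" for t
      unfolding f_def sum_distrib_left sum_distrib_right by (intro sum.cong refl) (simp only: mult_ac)
    have "G a f m = (\<Sum>k\<in>A. c k * (if k = m then 1 else 0))"
      unfolding G_def inner_w_def set_integral_leb_pos eq using laguerre_on_orthonormal[OF a]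
      by (subst Bochner_Integration.integral_sum) auto
    also have "\<dots> = (if m \<in> A then c m else 0)" using A by (simp add: if_distrib cong: if_cong)
    finally show "G a f m = (if m \<in> A then c m else 0)" .
  qed
qed

lemma rth_deriv_laguerre_polynomial:
  assumes "0 < t"
  shows "rth_deriv r (\<lambda>t. \<Sum>k\<in>A. c k * laguerre_on a k t) t = (\<Sum>k\<in>A. c k * laguerre_deriv a r k t)"
proof -
  have "(\<lambda>j t. \<Sum>k\<in>A. c k * laguerre_deriv a j k t) 0 \<in> Cr_pos r"
    by (rule Cr_posI) (auto intro!: DERIV_sum DERIV_cmult has_field_derivative_laguerre_deriv continuous_intros)
  then have "(\<lambda>t. \<Sum>k\<in>A. c k * laguerre_on a k t) \<in> Cr_pos r" by (simp add: laguerre_deriv_0)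
  then show ?thesis using assms by (subst rth_deriv_eq) (auto simp: higher_deriv_laguerre_sum)
qed


subsection \<open>Sequence norms\<close>

lemma one_le_enn2real: "1 \<le> p \<Longrightarrow> p \<noteq> \<infinity> \<Longrightarrow> 1 \<le> enn2real p"
  by (metis enn2real_1 enn2real_mono infinity_ennreal_def less_top)

lemma recip_finite: "1 \<le> p \<Longrightarrow> p \<noteq> \<infinity> \<Longrightarrow> recip p = 1 / enn2real p"
  by (metis ennreal_enn2real infinity_ennreal_def less_le_trans less_top one_le_enn2real recip_ennreal zero_less_one)

lemma recip_top' [simp]: "recip top = 0"
  using recip_top by simp

lemma recip_nonneg: "0 \<le> recip p"
  by (simp add: recip_def)

lemma recip_le_1:
  assumes "1 \<le> p"
  shows "recip p \<le> 1"
proof (cases "p = \<infinity>")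
  case False
  then show ?thesis using recip_finite[OF assms] one_le_enn2real[OF assms] by simp
qed simp

text \<open>Hoelder's inequality against the constant 1, obtained by adding Young's inequality over
  the terms after scaling them by \<open>T\<close>.\<close>

lemma sum_le_of_sum_powr_le:
  fixes x :: "'a \<Rightarrow> real"
  assumes q: "1 \<le> q" and A: "finite A" and x: "\<And>k. 0 \<le> x k" and D: "0 \<le> D"
    and le: "(\<Sum>k\<in>A. x k powr q) \<le> D powr q"
  shows "(\<Sum>k\<in>A. x k) \<le> D * real (card A) powr (1 - 1 / q)"
proof (cases "A = {}")
  case False
  then have n: "0 < real (card A)" using A by (simp add: card_gt_0_iff)
  show ?thesis
  proof (cases "D = 0")
    case True
    then have "(\<Sum>k\<in>A. x k powr q) \<le> 0" using le q by simp
    then have "(\<Sum>k\<in>A. x k powr q) = 0" using sum_nonneg[of A "\<lambda>k. x k powr q"] by simp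
    then have "\<forall>k\<in>A. x k powr q = 0" using A by (subst (asm) sum_nonneg_eq_0_iff) auto
    then show ?thesis using True by simp
  next
    case D0: False
    \<comment> \<open>The value of each term in the extremal case: \<open>card A\<close> copies of
      \<open>T powr q\<close> add up to \<open>D powr q\<close>.\<close>
    define T where "T = D * real (card A) powr (- 1 / q)"
    have T: "0 < T" using D D0 n by (simp add: T_def)
    have Tq: "T powr q = D powr q / real (card A)"
      using D D0 n q by (simp add: T_def powr_mult powr_divide powr_powr powr_minus_divide)
    have young: "y \<le> y powr q / q + (1 - 1 / q)" if "0 \<le> y" for y :: real
    proof (cases "y = 0")
      case False
      then have "(y powr q) powr (1 / q) * 1 powr (1 - 1 / q) \<le> 1 / q * y powr q + (1 - 1 / q) * 1"
        using q that by (intro Youngs_inequality_0) auto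
      then show ?thesis using q that by (simp add: powr_powr)
    qed (use q in simp)
    have "(\<Sum>k\<in>A. x k / T) \<le> (\<Sum>k\<in>A. (x k / T) powr q / q + (1 - 1 / q))"
      using x T by (intro sum_mono young) simp
    also have "\<dots> = (\<Sum>k\<in>A. x k powr q) / (T powr q) / q + real (card A) * (1 - 1 / q)"
      using x T by (simp add: sum.distrib sum_divide_distrib powr_divide less_imp_le)
    also have "\<dots> \<le> real (card A) / q + real (card A) * (1 - 1 / q)"
    proof -
      have "(\<Sum>k\<in>A. x k powr q) / (T powr q) \<le> D powr q / (T powr q)"
        using le by (intro divide_right_mono) auto
      also have "\<dots> = real (card A)" unfolding Tq using D D0 n by simp
      finally show ?thesis using q by (intro add_right_mono divide_right_mono) auto
    qed
    also have "\<dots> = real (card A)" by (simp add: algebra_simps)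
    finally have "(\<Sum>k\<in>A. x k) / T \<le> real (card A)" by (simp add: sum_divide_distrib)
    then have "(\<Sum>k\<in>A. x k) \<le> D * (real (card A) powr 1 * real (card A) powr (- 1 / q))"
      using T n by (simp add: T_def divide_le_eq mult_ac)
    then show ?thesis by (simp only: powr_add[symmetric]) simp
  qed
qed simp

text \<open>Serves twice: with exponent \<open>s\<close> for the weighted coefficients of the class,
  and with exponent \<open>p\<close> for the noise.\<close>

lemma ell_norm_sum_le:
  assumes p: "1 \<le> p" and A: "finite A" and D: "0 \<le> D" and le: "ell_norm p x \<le> ennreal D"
  shows "(\<Sum>k\<in>A. \<bar>x k\<bar>) \<le> D * real (card A) powr (1 - recip p)"
proof (cases "p = \<infinity>")
  case True
  have "ennreal \<bar>x k\<bar> \<le> ennreal D" for k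
    by (rule order_trans[OF _ le]) (auto simp: ell_norm_def True intro: SUP_upper)
  then have "\<bar>x k\<bar> \<le> D" for k using D by simp
  then have "(\<Sum>k\<in>A. \<bar>x k\<bar>) \<le> (\<Sum>k\<in>A. D)" by (intro sum_mono)
  then show ?thesis using True by (simp add: mult.commute)
next
  case False
  define q where "q = enn2real p"
  define S where "S = (\<Sum>k. ennreal (\<bar>x k\<bar> powr q))"
  have q: "1 \<le> q" using one_le_enn2real[OF p False] by (simp add: q_def)
  have S: "S \<noteq> \<infinity>" "ennreal (enn2real S powr (1 / q)) \<le> ennreal D"
    using le False by (auto simp: ell_norm_def S_def q_def Let_def top_unique split: if_splits)
  then have "enn2real S powr (1 / q) \<le> D" using D by simp
  then have "(enn2real S powr (1 / q)) powr q \<le> D powr q" using q by (intro powr_mono2) auto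
  then have SD: "enn2real S \<le> D powr q" using q by (simp add: powr_powr)
  have "ennreal (\<Sum>k\<in>A. \<bar>x k\<bar> powr q) = (\<Sum>k\<in>A. ennreal (\<bar>x k\<bar> powr q))" by simp
  also have "\<dots> \<le> S" unfolding S_def by (intro sum_le_suminf A) auto
  also have "S = ennreal (enn2real S)" using S(1) by (simp add: less_top)
  finally have "(\<Sum>k\<in>A. \<bar>x k\<bar> powr q) \<le> D powr q" using SD by (simp add: sum_nonneg)
  then show ?thesis
    using sum_le_of_sum_powr_le[OF q A _ D, of "\<lambda>k. \<bar>x k\<bar>"] recip_finite[OF p False] by (simp add: q_def)
qed

lemma ell_norm_finite_support_le:
  assumes s: "1 \<le> s" and A: "finite A" "A \<noteq> {}" and b: "0 \<le> b"
    and le: "\<And>k. k \<in> A \<Longrightarrow> \<bar>x k\<bar> \<le> b" and zero: "\<And>k. k \<notin> A \<Longrightarrow> x k = 0"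
  shows "ell_norm s x \<le> ennreal (b * real (card A) powr recip s)"
proof -
  have n: "0 < real (card A)" using A by (simp add: card_gt_0_iff)
  have le': "\<bar>x k\<bar> \<le> b" for k using le zero b by (cases "k \<in> A") auto
  show ?thesis
  proof (cases "s = \<infinity>")
    case True
    then show ?thesis using le' n by (auto simp: ell_norm_def intro!: SUP_least ennreal_leI)
  next
    case False
    define q where "q = enn2real s"
    have q: "1 \<le> q" using one_le_enn2real[OF s False] by (simp add: q_def)
    have S: "(\<Sum>k. ennreal (\<bar>x k\<bar> powr q)) = ennreal (\<Sum>k\<in>A. \<bar>x k\<bar> powr q)"
      using A(1) zero q by (subst suminf_finite[of A]) auto
    have "(\<Sum>k\<in>A. \<bar>x k\<bar> powr q) \<le> (\<Sum>k\<in>A. b powr q)"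
      using le q by (intro sum_mono powr_mono2) auto
    then have "(\<Sum>k\<in>A. \<bar>x k\<bar> powr q) \<le> real (card A) * b powr q" by simp
    then have "(\<Sum>k\<in>A. \<bar>x k\<bar> powr q) powr (1 / q) \<le> (real (card A) * b powr q) powr (1 / q)"
      using q by (intro powr_mono2) (auto intro: sum_nonneg)
    also have "\<dots> = b * real (card A) powr (1 / q)"
      using q b by (simp add: powr_mult powr_powr mult.commute)
    finally have "(\<Sum>k\<in>A. \<bar>x k\<bar> powr q) powr (1 / q) \<le> b * real (card A) powr (1 / q)" .
    moreover have "recip s = 1 / q" using recip_finite[OF s False] by (simp add: q_def)
    ultimately show ?thesis
      using False unfolding ell_norm_def Let_def q_def[symmetric] S
      by (simp add: sum_nonneg ennreal_leI del: sum_ennreal)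
  qed
qed

lemma ell_norm_zero: "ell_norm p (\<lambda>_. 0) = 0"
  by (simp add: ell_norm_def Let_def)

subsection \<open>Dyadic summation\<close>

text \<open>On the block from N 2^J to N 2^(J+1) the power is at most its value at the left end, and
  the sum of \<open>d\<close> is at most (N 2^(J+1))^\<eta>. The block bounds form a geometric
  series of ratio 2^(\<eta> - \<sigma>) < 1.\<close>

lemma dyadic_tail:
  fixes d :: "nat \<Rightarrow> real"
  assumes d: "\<And>k. 0 \<le> d k" and H: "\<And>n. 1 \<le> n \<Longrightarrow> (\<Sum>k=1..n. d k) \<le> real n powr \<eta>"
    and \<eta>: "0 \<le> \<eta>" "\<eta> < \<sigma>" and N: "1 \<le> N"
  shows "(\<Sum>k\<in>{N<..n}. d k * real k powr (- \<sigma>)) \<le> 2 powr \<eta> / (1 - 2 powr (\<eta> - \<sigma>)) * real N powr (\<eta> - \<sigma>)"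
proof -
  define \<rho> where "\<rho> = (2::real) powr (\<eta> - \<sigma>)"
  have \<rho>: "0 < \<rho>" "\<rho> < 1" using \<eta> by (auto simp: \<rho>_def powr_less_one)
  let ?C = "2 powr \<eta> * real N powr (\<eta> - \<sigma>)"
  let ?t = "\<lambda>k. d k * real k powr (- \<sigma>)"
  have ind: "(\<Sum>k\<in>{N<..N * 2 ^ J}. ?t k) \<le> (\<Sum>j<J. ?C * \<rho> ^ j)" for J
  proof (induction J)
    case (Suc J)
    have M: "0 < real N * 2 ^ J" using N by simp
    have split: "{N<..N * 2 ^ Suc J} = {N<..N * 2 ^ J} \<union> {N * 2 ^ J<..N * 2 ^ Suc J}"
    proof -
      have "N \<le> N * 2 ^ J" by simp
      moreover have "N * 2 ^ J \<le> N * 2 ^ Suc J" by simp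
      ultimately show ?thesis by (metis ivl_disj_un_two(6))
    qed
    have "(\<Sum>k\<in>{N * 2 ^ J<..N * 2 ^ Suc J}. ?t k)
        \<le> (\<Sum>k\<in>{N * 2 ^ J<..N * 2 ^ Suc J}. d k * (real N * 2 ^ J) powr (- \<sigma>))"
    proof (intro sum_mono mult_left_mono d powr_mono2')
      fix k assume "k \<in> {N * 2 ^ J<..N * 2 ^ Suc J}"
      then have "N * 2 ^ J \<le> k" by simp
      then have "real (N * 2 ^ J) \<le> real k" by (rule of_nat_mono)
      then show "real N * 2 ^ J \<le> real k" by simp
    qed (use M \<eta> in auto)
    also have "\<dots> \<le> (\<Sum>k=1..N * 2 ^ Suc J. d k) * (real N * 2 ^ J) powr (- \<sigma>)"
      unfolding sum_distrib_right[symmetric] using d by (intro mult_right_mono sum_mono2) auto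
    also have "\<dots> \<le> real (N * 2 ^ Suc J) powr \<eta> * (real N * 2 ^ J) powr (- \<sigma>)"
      using N by (intro mult_right_mono H) auto
    also have "\<dots> = ?C * \<rho> ^ J"
    proof -
      have "real (N * 2 ^ Suc J) = 2 * (real N * 2 ^ J)" by simp
      then have "real (N * 2 ^ Suc J) powr \<eta> * (real N * 2 ^ J) powr (- \<sigma>)
        = 2 powr \<eta> * (real N * 2 ^ J) powr (\<eta> - \<sigma>)"
        using M by (simp add: powr_mult powr_diff powr_minus_divide)
      also have "(real N * 2 ^ J) powr (\<eta> - \<sigma>) = real N powr (\<eta> - \<sigma>) * \<rho> ^ J"
        by (simp add: \<rho>_def powr_mult powr_powr mult.commute flip: powr_realpow)
      finally show ?thesis by simp
    qed
    finally have "(\<Sum>k\<in>{N * 2 ^ J<..N * 2 ^ Suc J}. ?t k) \<le> ?C * \<rho> ^ J" .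
    then show ?case unfolding split using Suc by (subst sum.union_disjoint) auto
  qed simp
  \<comment> \<open>A finite range is covered by finitely many blocks; \<open>n\<close> of them are
    more than enough.\<close>
  have "n \<le> N * 2 ^ n"
  proof -
    have "n \<le> 2 ^ n" using less_exp[of n] by simp
    also have "\<dots> \<le> N * 2 ^ n" using N by simp
    finally show ?thesis .
  qed
  then have "(\<Sum>k\<in>{N<..n}. ?t k) \<le> (\<Sum>k\<in>{N<..N * 2 ^ n}. ?t k)"
    using d by (intro sum_mono2) auto
  also have "\<dots> \<le> (\<Sum>j<n. ?C * \<rho> ^ j)" by (rule ind)
  also have "\<dots> = ?C * (\<Sum>j<n. \<rho> ^ j)" by (rule sum_distrib_left[symmetric])
  also have "\<dots> \<le> ?C * (1 / (1 - \<rho>))"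
  proof (rule mult_left_mono)
    have "(\<Sum>j<n. \<rho> ^ j) \<le> (\<Sum>j. \<rho> ^ j)"
      using \<rho> by (intro sum_le_suminf summable_geometric) auto
    also have "\<dots> = 1 / (1 - \<rho>)" using \<rho> by (intro suminf_geometric) auto
    finally show "(\<Sum>j<n. \<rho> ^ j) \<le> 1 / (1 - \<rho>)" .
  qed simp
  finally show ?thesis by (simp add: \<rho>_def)
qed

text \<open>The upper half (N/2, N] already has the order of the whole sum, and the lower half is
  the same problem at \<open>N div 2\<close>. The exponent |\<tau>| covers both signs, since the
  power varies on the upper half by at most the factor 2^|\<tau>|.\<close>

lemma dyadic_head:
  fixes d :: "nat \<Rightarrow> real"
  assumes d: "\<And>k. 0 \<le> d k" and H: "\<And>n. 1 \<le> n \<Longrightarrow> (\<Sum>k=1..n. d k) \<le> real n powr \<eta>"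
    and \<tau>: "0 < \<tau> + \<eta>"
  shows "(\<Sum>k=1..N. d k * real k powr \<tau>) \<le> 2 powr \<bar>\<tau>\<bar> / (1 - 2 powr (- (\<tau> + \<eta>))) * real N powr (\<tau> + \<eta>)"
proof (induction N rule: less_induct)
  case (less N)
  define \<rho> where "\<rho> = (2::real) powr (- (\<tau> + \<eta>))"
  have \<rho>: "0 < \<rho>" "\<rho> < 1" using \<tau> by (auto simp: \<rho>_def powr_less_one)
  define K where "K = 2 powr \<bar>\<tau>\<bar> / (1 - \<rho>)"
  have K: "0 < K" using \<rho> by (simp add: K_def)
  show ?case
  proof (cases "N = 0")
    case False
    then have N: "1 \<le> N" by simp
    have split: "{1..N} = {1..N div 2} \<union> {N div 2<..N}" by auto
    have "(\<Sum>k\<in>{N div 2<..N}. d k * real k powr \<tau>) \<le> (\<Sum>k\<in>{N div 2<..N}. d k * (2 powr \<bar>\<tau>\<bar> * real N powr \<tau>))"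
    proof (intro sum_mono mult_left_mono d)
      fix k assume k: "k \<in> {N div 2<..N}"
      then have "N \<le> 2 * k" by (simp only: greaterThanAtMost_iff) linarith
      then have "real N \<le> real (2 * k)" by (rule of_nat_mono)
      then have k': "real N / 2 \<le> real k" "real k \<le> real N" "0 < real k" using k N by auto
      show "real k powr \<tau> \<le> 2 powr \<bar>\<tau>\<bar> * real N powr \<tau>"
      proof (cases "0 \<le> \<tau>")
        case True
        have "real k powr \<tau> \<le> 1 * real N powr \<tau>" using k' True by (simp add: powr_mono2)
        also have "\<dots> \<le> 2 powr \<bar>\<tau>\<bar> * real N powr \<tau>"
          by (intro mult_right_mono ge_one_powr_ge_zero) auto
        finally show ?thesis .
      next
        case False
        have "real k powr \<tau> \<le> (real N / 2) powr \<tau>" using k' False N by (intro powr_mono2') auto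
        also have "\<dots> = 2 powr \<bar>\<tau>\<bar> * real N powr \<tau>" using False by (simp add: powr_divide powr_minus_divide)
        finally show ?thesis .
      qed
    qed
    also have "\<dots> \<le> (\<Sum>k=1..N. d k) * (2 powr \<bar>\<tau>\<bar> * real N powr \<tau>)"
      unfolding sum_distrib_right[symmetric] using d by (intro mult_right_mono sum_mono2) auto
    also have "\<dots> \<le> real N powr \<eta> * (2 powr \<bar>\<tau>\<bar> * real N powr \<tau>)"
      using N by (intro mult_right_mono H) auto
    also have "\<dots> = 2 powr \<bar>\<tau>\<bar> * real N powr (\<tau> + \<eta>)" by (simp add: powr_add)
    finally have 1: "(\<Sum>k\<in>{N div 2<..N}. d k * real k powr \<tau>) \<le> 2 powr \<bar>\<tau>\<bar> * real N powr (\<tau> + \<eta>)" .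
    have "(\<Sum>k=1..N div 2. d k * real k powr \<tau>) \<le> K * real (N div 2) powr (\<tau> + \<eta>)"
      using less.IH[of "N div 2"] N by (simp add: K_def \<rho>_def)
    also have "\<dots> \<le> K * (real N / 2) powr (\<tau> + \<eta>)"
      using K \<tau> by (intro mult_left_mono powr_mono2) auto
    also have "\<dots> = K * (\<rho> * real N powr (\<tau> + \<eta>))"
      unfolding \<rho>_def by (simp add: powr_divide powr_minus_divide[of 2 "\<tau> + \<eta>"] del: minus_add_distrib)
    finally have 2: "(\<Sum>k=1..N div 2. d k * real k powr \<tau>) \<le> K * (\<rho> * real N powr (\<tau> + \<eta>))" .
    have "(\<Sum>k=1..N. d k * real k powr \<tau>) = (\<Sum>k=1..N div 2. d k * real k powr \<tau>) + (\<Sum>k\<in>{N div 2<..N}. d k * real k powr \<tau>)"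
      unfolding split by (rule sum.union_disjoint) auto
    also have "\<dots> \<le> (K * \<rho> + 2 powr \<bar>\<tau>\<bar>) * real N powr (\<tau> + \<eta>)"
      using 1 2 by (simp add: algebra_simps)
    \<comment> \<open>\<open>K\<close> was chosen as the fixed point of the recursion, so the
      induction closes with the same constant.\<close>
    also have "K * \<rho> + 2 powr \<bar>\<tau>\<bar> = K" using \<rho> by (simp add: K_def field_simps)
    finally show ?thesis by (simp add: K_def \<rho>_def)
  qed simp
qed


subsection \<open>The upper estimate\<close>

text \<open>The form in which the norm bound enters the upper estimate. The range starts at 1, where
  the weight max 1 k is simply \<open>k\<close>.\<close>

lemma W_ball_partial_sum:
  assumes f: "f \<in> W_ball \<alpha> s \<mu>" and s: "1 \<le> s"
  shows "(\<Sum>k=1..n. real k powr \<mu> * \<bar>G \<alpha> f k\<bar>) \<le> real n powr (1 - recip s)"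
proof -
  have "ell_norm s (\<lambda>k. real (max 1 k) powr \<mu> * \<bar>G \<alpha> f k\<bar>) \<le> ennreal 1"
    using f by (simp add: W_ball_def smooth_norm_def)
  from ell_norm_sum_le[OF s _ _ this, of "{1..n}"]
  have "(\<Sum>k=1..n. \<bar>real (max 1 k) powr \<mu> * \<bar>G \<alpha> f k\<bar>\<bar>) \<le> real n powr (1 - recip s)"
    by simp
  moreover have "(\<Sum>k=1..n. \<bar>real (max 1 k) powr \<mu> * \<bar>G \<alpha> f k\<bar>\<bar>) = (\<Sum>k=1..n. real k powr \<mu> * \<bar>G \<alpha> f k\<bar>)"
    by (intro sum.cong) (auto simp: abs_mult max_def)
  ultimately show ?thesis by simp
qed

lemma Suc_power_le: "1 \<le> k \<Longrightarrow> real (Suc k) ^ r \<le> 2 ^ r * real k powr real r"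
proof -
  assume k: "1 \<le> k"
  have "real (Suc k) ^ r \<le> (2 * real k) ^ r" using k by (intro power_mono) auto
  also have "\<dots> = 2 ^ r * real k powr real r" using k by (simp add: power_mult_distrib powr_realpow)
  finally show ?thesis .
qed

text \<open>The dyadic tail with exponent \<mu> - r; the condition \<eta> < \<sigma> there is
  precisely the assumption on \<mu>.\<close>

lemma W_ball_summable:
  assumes f: "f \<in> W_ball \<alpha> s \<mu>" and s: "1 \<le> s" and \<mu>: "\<mu> > real r + 1 - recip s"
  shows "summable (\<lambda>k. \<bar>G \<alpha> f k\<bar> * real (Suc k) ^ r)"
proof -
  define d where "d = (\<lambda>k. real k powr \<mu> * \<bar>G \<alpha> f k\<bar>)"
  define K where "K = 2 powr (1 - recip s) / (1 - 2 powr ((1 - recip s) - (\<mu> - real r)))"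
  have tail: "(\<Sum>k\<in>{1<..n}. d k * real k powr (- (\<mu> - real r))) \<le> K" for n
    using dyadic_tail[of d "1 - recip s" "\<mu> - real r" 1 n] W_ball_partial_sum[OF f s] recip_le_1[OF s] \<mu>
    by (simp add: d_def K_def)
  have le: "\<bar>G \<alpha> f k\<bar> * real (Suc k) ^ r \<le> 2 ^ r * (d k * real k powr (- (\<mu> - real r)))" if "1 \<le> k" for k
  proof -
    have "real k powr real r = real k powr \<mu> * real k powr (- (\<mu> - real r))"
      by (simp flip: powr_add)
    then have "\<bar>G \<alpha> f k\<bar> * (2 ^ r * real k powr real r) = 2 ^ r * (d k * real k powr (- (\<mu> - real r)))"
      by (simp add: d_def)
    with mult_left_mono[OF Suc_power_le[OF that, of r], of "\<bar>G \<alpha> f k\<bar>"] show ?thesis by simp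
  qed
  show ?thesis
  proof (rule summableI_nonneg_bounded)
    fix n
    have "(\<Sum>k<n. \<bar>G \<alpha> f k\<bar> * real (Suc k) ^ r) \<le> (\<Sum>k\<in>{0, 1} \<union> {1<..n}. \<bar>G \<alpha> f k\<bar> * real (Suc k) ^ r)"
      by (intro sum_mono2) auto
    also have "\<dots> = (\<Sum>k\<in>{0, 1}. \<bar>G \<alpha> f k\<bar> * real (Suc k) ^ r) + (\<Sum>k\<in>{1<..n}. \<bar>G \<alpha> f k\<bar> * real (Suc k) ^ r)"
      by (rule sum.union_disjoint) auto
    also have "(\<Sum>k\<in>{1<..n}. \<bar>G \<alpha> f k\<bar> * real (Suc k) ^ r) \<le> (\<Sum>k\<in>{1<..n}. 2 ^ r * (d k * real k powr (- (\<mu> - real r))))"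
      by (intro sum_mono le) auto
    also have "\<dots> \<le> 2 ^ r * K" unfolding sum_distrib_left[symmetric] by (intro mult_left_mono tail) auto
    finally show "(\<Sum>k<n. \<bar>G \<alpha> f k\<bar> * real (Suc k) ^ r)
        \<le> (\<Sum>k\<in>{0, 1}. \<bar>G \<alpha> f k\<bar> * real (Suc k) ^ r) + 2 ^ r * K" by simp
  qed simp
qed

text \<open>The error is split into the multiplier defect \<open>T1\<close>, the noise
  \<open>T2\<close> and the truncation \<open>T3\<close>. The noise is controlled through \<delta>
  \<le> A N^(-\<kappa>), the form that the coupling will supply.\<close>

lemma psi_S_pointwise:
  assumes \<alpha>: "0 \<le> \<alpha>" and r: "1 \<le> r" and s: "1 \<le> s" and p: "1 \<le> p"
    and \<mu>: "\<mu> > real r + 1 - recip s" and A: "0 < A"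
    and \<theta>: "\<theta> > \<mu> + recip s - 1 - real r" and \<nu>: "\<nu> \<in> S_class \<theta>"
  obtains c where "0 < c"
    "\<And>N \<delta> f \<xi> t. 1 \<le> N \<Longrightarrow> 0 \<le> \<delta> \<Longrightarrow> \<delta> \<le> A * real N powr (- (\<mu> + recip s - recip p)) \<Longrightarrow>
      f \<in> W_ball \<alpha> s \<mu> \<Longrightarrow> ell_norm p \<xi> \<le> ennreal \<delta> \<Longrightarrow> 0 < t \<Longrightarrow>
      \<bar>rth_deriv r f t - psi_S \<alpha> r \<nu> N (\<lambda>k. proj {r..N} (G \<alpha> f) k + \<xi> k) t\<bar> * sqrt (w \<alpha> t)
        \<le> c * real N powr (- (\<mu> + recip s - 1 - real r))"
proof -
  define E where "E = \<mu> + recip s - 1 - real r"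
  define \<kappa> where "\<kappa> = \<mu> + recip s - recip p"
  define \<eta> where "\<eta> = 1 - recip s"
  have E: "0 < E" using \<mu> by (simp add: E_def)
  have \<eta>: "0 \<le> \<eta>" "\<eta> < \<mu> - real r" using recip_le_1[OF s] \<mu> by (auto simp: \<eta>_def)
  obtain B where B: "0 < B" "\<And>j k t. j \<le> r \<Longrightarrow> 0 < t \<Longrightarrow>
      \<bar>laguerre_deriv \<alpha> j k t\<bar> * sqrt (w \<alpha> t) \<le> B * real (Suc k) ^ r"
    using laguerre_deriv_bound[OF \<alpha> r] by metis
  obtain C where C: "0 < C" "\<And>N k. 1 \<le> N \<Longrightarrow> k \<le> N \<Longrightarrow> \<bar>1 - \<nu> N k\<bar> \<le> C * (real k / real N) powr \<theta>"
    using \<nu> by (auto simp: S_class_def)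
  define B' where "B' = B * 2 ^ r"
  define K1 where "K1 = 2 powr \<bar>\<theta> + real r - \<mu>\<bar> / (1 - 2 powr (- (\<theta> + real r - \<mu> + \<eta>)))"
  define K3 where "K3 = 2 powr \<eta> / (1 - 2 powr (\<eta> - (\<mu> - real r)))"
  have B': "0 < B'" using B by (simp add: B'_def)
  have \<theta>E: "0 < \<theta> + real r - \<mu> + \<eta>" using \<theta> by (simp add: \<eta>_def)
  have K1: "0 < K1" using \<theta>E by (simp add: K1_def powr_less_one)
  have K3: "0 < K3" using \<eta> by (simp add: K3_def powr_less_one)
  define c where "c = B' * C * K1 + (1 + C) * B' * A + B' * K3"
  show ?thesis
  proof (rule that)
    show "0 < c" using B' C(1) K1 K3 A by (simp add: c_def add_pos_pos)
    fix N :: nat and \<delta> t :: real and f \<xi>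
    assume N: "1 \<le> N" and \<delta>: "0 \<le> \<delta>" "\<delta> \<le> A * real N powr (- (\<mu> + recip s - recip p))"
      and f: "f \<in> W_ball \<alpha> s \<mu>" and \<xi>: "ell_norm p \<xi> \<le> ennreal \<delta>" and t: "0 < t"
    define g where "g = G \<alpha> f"
    define d where "d = (\<lambda>k. real k powr \<mu> * \<bar>g k\<bar>)"
    define D where "D = (\<lambda>k. laguerre_deriv \<alpha> r k t)"
    have d: "0 \<le> d k" for k by (simp add: d_def)
    have dsum: "(\<Sum>k=1..n. d k) \<le> real n powr \<eta>" for n
      using W_ball_partial_sum[OF f s] by (simp add: d_def g_def \<eta>_def)
    have DB: "\<bar>D k\<bar> * sqrt (w \<alpha> t) \<le> B' * real k powr real r" if "1 \<le> k" for k
    proof -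
      have "\<bar>D k\<bar> * sqrt (w \<alpha> t) \<le> B * real (Suc k) ^ r"
        unfolding D_def by (intro B t) simp
      also have "\<dots> \<le> B * (2 ^ r * real k powr real r)"
        using B by (intro mult_left_mono Suc_power_le that) auto
      finally show ?thesis by (simp add: B'_def)
    qed
    have D0: "D k = 0" if "k < r" for k using that by (simp add: D_def laguerre_deriv_zero)
    have gd: "\<bar>g k\<bar> * real k powr real r = d k * real k powr (real r - \<mu>)" for k
      by (cases "k = 0") (auto simp: d_def simp flip: powr_add)
    let ?y = "\<lambda>k. proj {r..N} (G \<alpha> f) k + \<xi> k"
    define \<Phi> where "\<Phi> = psi_S \<alpha> r \<nu> N ?y t"
    have \<Phi>: "\<Phi> = (\<Sum>k=0..N. \<nu> N k * ?y k * D k)"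
      unfolding \<Phi>_def psi_S_def S_op_def[abs_def] higher_deriv_laguerre_sum D_def ..
    have fL: "f \<in> L2w \<alpha>" using f by (simp add: W_ball_def)
    have summ: "summable (\<lambda>k. \<bar>g k\<bar> * real (Suc k) ^ r)"
      unfolding g_def by (rule W_ball_summable[OF f s \<mu>])
    have rep: "(\<lambda>k. g k * D k) sums rth_deriv r f t"
      using rth_deriv_L2w[OF \<alpha> r B(2) summ fL g_def[symmetric] t] by (simp add: D_def sums_iff)
    have w: "0 \<le> sqrt (w \<alpha> t)" by (simp add: w_nonneg)
    \<comment> \<open>The exponent in the dyadic head is \<theta> + r - \<mu> + \<eta> = \<theta> -
      E. It is positive because \<theta> exceeds E, so the sum is governed by its upper end, and the
      factor N^(-\<theta>) reduces it to N^(-E).\<close>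
    have T1: "(\<Sum>k=1..N. \<bar>1 - \<nu> N k\<bar> * \<bar>g k\<bar> * (B' * real k powr real r)) \<le> B' * C * K1 * real N powr (- E)"
    proof -
      have "(\<Sum>k=1..N. \<bar>1 - \<nu> N k\<bar> * \<bar>g k\<bar> * (B' * real k powr real r))
        \<le> (\<Sum>k=1..N. (B' * C * real N powr (- \<theta>)) * (d k * real k powr (\<theta> + real r - \<mu>)))"
      proof (rule sum_mono)
        fix k assume k: "k \<in> {1..N}"
        have "\<bar>1 - \<nu> N k\<bar> * (\<bar>g k\<bar> * (B' * real k powr real r))
          \<le> (C * (real k / real N) powr \<theta>) * (\<bar>g k\<bar> * (B' * real k powr real r))"
          using C(2)[OF N, of k] k B' by (intro mult_right_mono) auto
        also have "\<dots> = C * B' * (real k / real N) powr \<theta> * (\<bar>g k\<bar> * real k powr real r)"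
          by (simp only: mult_ac)
        also have "\<dots> = C * B' * (real N powr (- \<theta>) * real k powr \<theta>) * (d k * real k powr (real r - \<mu>))"
          unfolding gd by (simp add: powr_divide powr_minus_divide)
        also have "\<dots> = (B' * C * real N powr (- \<theta>)) * (d k * (real k powr \<theta> * real k powr (real r - \<mu>)))"
          by (simp only: mult_ac)
        also have "real k powr \<theta> * real k powr (real r - \<mu>) = real k powr (\<theta> + real r - \<mu>)"
          by (simp add: add_diff_eq flip: powr_add)
        finally show "\<bar>1 - \<nu> N k\<bar> * \<bar>g k\<bar> * (B' * real k powr real r)
          \<le> (B' * C * real N powr (- \<theta>)) * (d k * real k powr (\<theta> + real r - \<mu>))" by (simp only: mult.assoc)
      qed
      also have "\<dots> = (B' * C * real N powr (- \<theta>)) * (\<Sum>k=1..N. d k * real k powr (\<theta> + real r - \<mu>))"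
        by (rule sum_distrib_left[symmetric])
      also have "\<dots> \<le> (B' * C * real N powr (- \<theta>)) * (K1 * real N powr (\<theta> + real r - \<mu> + \<eta>))"
        unfolding K1_def using B' C(1) by (intro mult_left_mono dyadic_head d dsum \<theta>E) auto
      also have "\<dots> = B' * C * K1 * (real N powr (- \<theta>) * real N powr (\<theta> + real r - \<mu> + \<eta>))"
        by (simp only: mult_ac)
      also have "real N powr (- \<theta>) * real N powr (\<theta> + real r - \<mu> + \<eta>) = real N powr (- E)"
        by (simp add: E_def \<eta>_def algebra_simps flip: powr_add)
      finally show ?thesis .
    qed
    \<comment> \<open>The multipliers are bounded by 1 + C since k/N \<le> 1, and the growth k^r is
      replaced by N^r before Hoelder's inequality is applied to the noise.\<close>
    have T2: "(\<Sum>k=1..N. \<bar>\<nu> N k\<bar> * \<bar>\<xi> k\<bar> * (B' * real k powr real r)) \<le> (1 + C) * B' * A * real N powr (- E)"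
    proof -
      have "(\<Sum>k=1..N. \<bar>\<nu> N k\<bar> * \<bar>\<xi> k\<bar> * (B' * real k powr real r))
        \<le> (\<Sum>k=1..N. (1 + C) * \<bar>\<xi> k\<bar> * (B' * real N powr real r))"
      proof (intro sum_mono mult_mono)
        fix k assume k: "k \<in> {1..N}"
        have "(real k / real N) powr \<theta> \<le> 1 powr \<theta>"
          using k \<theta> E by (intro powr_mono2) (auto simp: E_def)
        then have "C * (real k / real N) powr \<theta> \<le> C" using C(1) by simp
        then show "\<bar>\<nu> N k\<bar> \<le> 1 + C" using C(2)[OF N, of k] k by auto
        show "real k powr real r \<le> real N powr real r" using k by (intro powr_mono2) auto
      qed (use B' C(1) in auto)
      also have "\<dots> = (1 + C) * B' * real N powr real r * (\<Sum>k=1..N. \<bar>\<xi> k\<bar>)"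
        unfolding sum_distrib_left by (intro sum.cong refl) (simp only: mult_ac)
      also have "\<dots> \<le> (1 + C) * B' * real N powr real r * (\<delta> * real N powr (1 - recip p))"
        using ell_norm_sum_le[OF p _ \<delta>(1) \<xi>, of "{1..N}"] C(1) B' by (intro mult_left_mono) auto
      also have "\<dots> \<le> (1 + C) * B' * real N powr real r * (A * real N powr (- \<kappa>) * real N powr (1 - recip p))"
        using \<delta>(2) C(1) B' by (intro mult_left_mono mult_right_mono) (auto simp: \<kappa>_def)
      also have "\<dots> = (1 + C) * B' * A * (real N powr real r * real N powr (- \<kappa>) * real N powr (1 - recip p))"
        by (simp only: mult_ac)
      also have "real N powr real r * real N powr (- \<kappa>) * real N powr (1 - recip p) = real N powr (- E)"
        by (simp add: E_def \<kappa>_def algebra_simps flip: powr_add)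
      finally show ?thesis .
    qed
    have T3: "(\<Sum>k\<in>{N<..n}. \<bar>g k\<bar> * (B' * real k powr real r)) \<le> B' * K3 * real N powr (- E)" for n
    proof -
      have "(\<Sum>k\<in>{N<..n}. \<bar>g k\<bar> * (B' * real k powr real r)) = B' * (\<Sum>k\<in>{N<..n}. d k * real k powr (- (\<mu> - real r)))"
        unfolding sum_distrib_left using gd by (intro sum.cong) (auto simp: mult_ac)
      also have "\<dots> \<le> B' * (K3 * real N powr (\<eta> - (\<mu> - real r)))"
        unfolding K3_def using B' by (intro mult_left_mono dyadic_tail d dsum \<eta> N) auto
      also have "\<eta> - (\<mu> - real r) = - E" by (simp add: E_def \<eta>_def)
      finally show ?thesis by simp
    qed
    have partial: "\<bar>(\<Sum>k<Suc n. g k * D k) - \<Phi>\<bar> * sqrt (w \<alpha> t) \<le> c * real N powr (- E)" if n: "N \<le> n" for n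
    proof -
      \<comment> \<open>Index 0 is split off because the power estimates start at 1; its term
        vanishes as \<open>1 \<le> r\<close>.\<close>
      have set1: "{..<Suc n} = {0} \<union> ({1..N} \<union> {N<..n})" "{0..N} = {0} \<union> {1..N}" using n by auto
      have "(\<Sum>k<Suc n. g k * D k) = (\<Sum>k=1..N. g k * D k) + (\<Sum>k\<in>{N<..n}. g k * D k)"
        unfolding set1 using D0[of 0] r by (subst sum.union_disjoint, simp, simp, simp)
          (simp, rule sum.union_disjoint, auto)
      moreover have "\<Phi> = (\<Sum>k=1..N. \<nu> N k * ?y k * D k)"
        unfolding \<Phi> set1 using D0[of 0] r by (subst sum.union_disjoint) auto
      ultimately have eq: "(\<Sum>k<Suc n. g k * D k) - \<Phi>
          = (\<Sum>k=1..N. g k * D k - \<nu> N k * ?y k * D k) + (\<Sum>k\<in>{N<..n}. g k * D k)"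
        by (simp add: sum_subtractf)
      have term_le: "\<bar>g k * D k - \<nu> N k * ?y k * D k\<bar> * sqrt (w \<alpha> t)
          \<le> \<bar>1 - \<nu> N k\<bar> * \<bar>g k\<bar> * (B' * real k powr real r) + \<bar>\<nu> N k\<bar> * \<bar>\<xi> k\<bar> * (B' * real k powr real r)"
        if k: "k \<in> {1..N}" for k
      proof -
        \<comment> \<open>For \<open>k < r\<close> the projection has erased \<open>g k\<close> from
          the data, but the r-th derivative \<open>D k\<close> is zero there, so nothing is
          lost.\<close>
        have "g k * D k - \<nu> N k * ?y k * D k = ((1 - \<nu> N k) * g k - \<nu> N k * \<xi> k) * D k"
        proof (cases "k < r")
          case False
          then have "?y k = g k + \<xi> k" using k by (simp add: proj_def g_def)
          then show ?thesis by (simp add: algebra_simps)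
        qed (simp add: D0)
        then have "\<bar>g k * D k - \<nu> N k * ?y k * D k\<bar> * sqrt (w \<alpha> t)
            = \<bar>(1 - \<nu> N k) * g k - \<nu> N k * \<xi> k\<bar> * (\<bar>D k\<bar> * sqrt (w \<alpha> t))"
          by (simp add: abs_mult)
        also have "\<dots> \<le> (\<bar>1 - \<nu> N k\<bar> * \<bar>g k\<bar> + \<bar>\<nu> N k\<bar> * \<bar>\<xi> k\<bar>) * (B' * real k powr real r)"
          using abs_triangle_ineq4[of "(1 - \<nu> N k) * g k" "\<nu> N k * \<xi> k"] k w
          by (intro mult_mono DB) (auto simp: abs_mult)
        finally show ?thesis by (simp only: distrib_right)
      qed
      have "\<bar>(\<Sum>k<Suc n. g k * D k) - \<Phi>\<bar> * sqrt (w \<alpha> t)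
        \<le> ((\<Sum>k=1..N. \<bar>g k * D k - \<nu> N k * ?y k * D k\<bar>) + (\<Sum>k\<in>{N<..n}. \<bar>g k * D k\<bar>)) * sqrt (w \<alpha> t)"
        unfolding eq by (intro mult_right_mono w order_trans[OF abs_triangle_ineq] add_mono sum_abs)
      also have "\<dots> = (\<Sum>k=1..N. \<bar>g k * D k - \<nu> N k * ?y k * D k\<bar> * sqrt (w \<alpha> t)) + (\<Sum>k\<in>{N<..n}. \<bar>g k\<bar> * (\<bar>D k\<bar> * sqrt (w \<alpha> t)))"
        by (simp only: distrib_right sum_distrib_right abs_mult mult.assoc)
      also have "\<dots> \<le> (\<Sum>k=1..N. \<bar>1 - \<nu> N k\<bar> * \<bar>g k\<bar> * (B' * real k powr real r) + \<bar>\<nu> N k\<bar> * \<bar>\<xi> k\<bar> * (B' * real k powr real r))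
          + (\<Sum>k\<in>{N<..n}. \<bar>g k\<bar> * (B' * real k powr real r))"
        using N by (intro add_mono sum_mono term_le mult_left_mono DB) auto
      also have "\<dots> \<le> c * real N powr (- E)"
        using T1 T2 T3[of n] unfolding sum.distrib c_def by (simp add: distrib_right)
      finally show ?thesis .
    qed
    have "\<bar>rth_deriv r f t - \<Phi>\<bar> * sqrt (w \<alpha> t) \<le> c * real N powr (- E)"
    proof (rule LIMSEQ_le_const2)
      have "(\<lambda>n. \<Sum>k<Suc n. g k * D k) \<longlonglongrightarrow> rth_deriv r f t"
        using rep unfolding sums_def by (rule LIMSEQ_Suc)
      then show "(\<lambda>n. \<bar>(\<Sum>k<Suc n. g k * D k) - \<Phi>\<bar> * sqrt (w \<alpha> t)) \<longlonglongrightarrow> \<bar>rth_deriv r f t - \<Phi>\<bar> * sqrt (w \<alpha> t)"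
        by (intro tendsto_intros)
    qed (use partial in blast)
    then show "\<bar>rth_deriv r f t - psi_S \<alpha> r \<nu> N ?y t\<bar> * sqrt (w \<alpha> t)
        \<le> c * real N powr (- (\<mu> + recip s - 1 - real r))"
      by (simp add: \<Phi>_def E_def)
  qed
qed

lemma psi_S_err:
  assumes "0 \<le> \<alpha>" "1 \<le> r" "1 \<le> s" "1 \<le> p" "\<mu> > real r + 1 - recip s" "0 < A"
    and "\<theta> > \<mu> + recip s - 1 - real r" "\<nu> \<in> S_class \<theta>"
  shows "\<exists>c>0. \<forall>N \<delta>. 1 \<le> N \<longrightarrow> 0 \<le> \<delta> \<longrightarrow> \<delta> \<le> A * real N powr (- (\<mu> + recip s - recip p)) \<longrightarrow>
      err \<alpha> r s \<mu> p \<delta> (psi_S \<alpha> r \<nu> N, {r..N}) \<le> ennreal (c * real N powr (- (\<mu> + recip s - 1 - real r)))"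
proof (rule psi_S_pointwise[OF assms])
  fix c
  assume c: "0 < c"
    "\<And>N \<delta> f \<xi> t. 1 \<le> N \<Longrightarrow> 0 \<le> \<delta> \<Longrightarrow> \<delta> \<le> A * real N powr (- (\<mu> + recip s - recip p)) \<Longrightarrow>
      f \<in> W_ball \<alpha> s \<mu> \<Longrightarrow> ell_norm p \<xi> \<le> ennreal \<delta> \<Longrightarrow> 0 < t \<Longrightarrow>
      \<bar>rth_deriv r f t - psi_S \<alpha> r \<nu> N (\<lambda>k. proj {r..N} (G \<alpha> f) k + \<xi> k) t\<bar> * sqrt (w \<alpha> t)
        \<le> c * real N powr (- (\<mu> + recip s - 1 - real r))"
  show ?thesis
  proof (intro exI[of _ c] conjI c(1) allI impI)
    fix N :: nat and \<delta> :: real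
    assume *: "1 \<le> N" "0 \<le> \<delta>" "\<delta> \<le> A * real N powr (- (\<mu> + recip s - recip p))"
    show "err \<alpha> r s \<mu> p \<delta> (psi_S \<alpha> r \<nu> N, {r..N}) \<le> ennreal (c * real N powr (- (\<mu> + recip s - 1 - real r)))"
      unfolding err_def prod.case C_norm_def
    proof (intro SUP_least ennreal_leI)
      fix f \<xi> and t :: real
      assume "f \<in> W_ball \<alpha> s \<mu>" "\<xi> \<in> {\<xi>. ell_norm p \<xi> \<le> ennreal \<delta>}" "t \<in> {0<..}"
      then show "\<bar>(rth_deriv r f t - psi_S \<alpha> r \<nu> N (\<lambda>k. proj {r..N} (G \<alpha> f) k + \<xi> k) t) * sqrt (w \<alpha> t)\<bar>
          \<le> c * real N powr (- (\<mu> + recip s - 1 - real r))"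
        using c(2)[OF *, of f \<xi> t] by (simp add: abs_mult w_nonneg)
    qed
  qed
qed

text \<open>The set {r..N} has at most N elements because \<open>1 \<le> r\<close>; starting at 0
  would use N + 1.\<close>

lemma psi_S_Psi:
  assumes "1 \<le> r"
  shows "(psi_S \<alpha> r \<nu> N, {r..N}) \<in> Psi p N"
proof -
  have "psi_S \<alpha> r \<nu> N y \<in> C_pos" for y
    unfolding psi_S_def S_op_def[abs_def] higher_deriv_laguerre_sum C_pos_def
    by (auto intro!: continuous_intros)
  then show ?thesis using assms by (simp add: Psi_def)
qed

subsection \<open>The lower estimate\<close>

text \<open>The degree k - r is at most 3 N, so t = 1/(12 N) makes (k - r) t \<le> 1/4, the range of
  \<open>Laguerre_lower\<close>. There the normalization and sqrt w each contribute N^(-\<alpha>/2)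
  and the polynomial N^(\<alpha> + r), which leaves N^r.\<close>

lemma laguerre_deriv_lower:
  assumes \<alpha>: "0 \<le> \<alpha>"
  obtains c where "0 < c" "\<And>N k. 1 \<le> N \<Longrightarrow> N + r \<le> k \<Longrightarrow> k \<le> 3 * N + r \<Longrightarrow>
    c * real N powr real r \<le> (- 1) ^ r * laguerre_deriv \<alpha> r k (1 / (12 * real N)) * sqrt (w \<alpha> (1 / (12 * real N)))"
proof -
  obtain c1 where c1: "0 < c1" "\<And>k. c1 * real (Suc k) powr (- \<alpha> / 2) \<le> sqrt (fact k / Gamma (real k + \<alpha> + 1))"
    using laguerre_normalization[OF \<alpha>] by metis
  have \<alpha>r: "0 \<le> \<alpha> + real r" using \<alpha> by simp
  obtain c2 where c2: "0 < c2" "\<And>n. c2 * real (Suc n) powr (\<alpha> + real r) \<le> rbinom (\<alpha> + real r) n"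
    using rbinom_bounds[OF \<alpha>r] by metis
  define c where "c = c1 * real (4 + r) powr (- \<alpha> / 2) * (c2 / 2) * (12 powr (- \<alpha> / 2) * exp (- 1))"
  show ?thesis
  proof (rule that)
    show "0 < c" using c1 c2 by (simp add: c_def)
    fix N k :: nat assume N: "1 \<le> N" and k: "N + r \<le> k" "k \<le> 3 * N + r"
    define t where "t = 1 / (12 * real N)"
    have t: "0 < t" "t \<le> 1" using N by (auto simp: t_def)
    have s1: "c1 * (real (4 + r) powr (- \<alpha> / 2) * real N powr (- \<alpha> / 2)) \<le> sqrt (fact k / Gamma (real k + \<alpha> + 1))"
    proof -
      \<comment> \<open>As \<open>1 \<le> N\<close>, the additive terms are absorbed into a multiple
        of \<open>N\<close>.\<close>
      have "Suc k \<le> (4 + r) * N"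
      proof -
        have "r \<le> r * N" using N by simp
        then show ?thesis using k N unfolding add_mult_distrib by linarith
      qed
      then have "real (Suc k) \<le> real ((4 + r) * N)" by (rule of_nat_mono)
      then have "(real (4 + r) * real N) powr (- \<alpha> / 2) \<le> real (Suc k) powr (- \<alpha> / 2)"
        using \<alpha> by (intro powr_mono2') (auto simp del: of_nat_Suc)
      then have "real (4 + r) powr (- \<alpha> / 2) * real N powr (- \<alpha> / 2) \<le> real (Suc k) powr (- \<alpha> / 2)"
        by (simp only: powr_mult)
      then have "c1 * (real (4 + r) powr (- \<alpha> / 2) * real N powr (- \<alpha> / 2)) \<le> c1 * real (Suc k) powr (- \<alpha> / 2)"
        using c1(1) by (intro mult_left_mono) auto
      also note c1(2)[of k]
      finally show ?thesis .
    qed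
    have s2: "c2 / 2 * real N powr (\<alpha> + real r) \<le> Laguerre (\<alpha> + real r) (k - r) t"
    proof -
      have "real N powr (\<alpha> + real r) \<le> real (Suc (k - r)) powr (\<alpha> + real r)"
        using k \<alpha>r by (intro powr_mono2) auto
      then have "c2 * real N powr (\<alpha> + real r) \<le> c2 * real (Suc (k - r)) powr (\<alpha> + real r)"
        using c2(1) by (intro mult_left_mono) auto
      also note c2(2)[of "k - r"]
      finally have "c2 * real N powr (\<alpha> + real r) \<le> rbinom (\<alpha> + real r) (k - r)" .
      moreover have "rbinom (\<alpha> + real r) (k - r) / 2 \<le> Laguerre (\<alpha> + real r) (k - r) t"
      proof (rule Laguerre_lower[OF \<alpha>r])
        have "real (k - r) \<le> 3 * real N" using k by linarith
        then show "real (k - r) * t \<le> 1 / 4" using N by (simp add: t_def field_simps)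
      qed (use t in simp)
      ultimately show ?thesis by simp
    qed
    have s3: "12 powr (- \<alpha> / 2) * real N powr (- \<alpha> / 2) * exp (- 1) \<le> sqrt (w \<alpha> t)"
    proof -
      have "t powr (\<alpha> / 2) = 12 powr (- \<alpha> / 2) * real N powr (- \<alpha> / 2)"
        by (simp add: t_def powr_divide powr_mult powr_minus_divide)
      moreover have "exp (- 1) \<le> exp (- t / 2)" using t by simp
      ultimately show ?thesis unfolding sqrt_w[OF t(1)] by (simp add: mult_left_mono)
    qed
    have "c * real N powr real r = (c1 * (real (4 + r) powr (- \<alpha> / 2) * real N powr (- \<alpha> / 2))) *
        (c2 / 2 * real N powr (\<alpha> + real r)) * (12 powr (- \<alpha> / 2) * real N powr (- \<alpha> / 2) * exp (- 1))"
    proof -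
      have "real N powr real r = real N powr (- \<alpha> / 2) * real N powr (\<alpha> + real r) * real N powr (- \<alpha> / 2)"
        by (simp flip: powr_add)
      then show ?thesis unfolding c_def by (simp only: mult_ac)
    qed
    also have "\<dots> \<le> sqrt (fact k / Gamma (real k + \<alpha> + 1)) * Laguerre (\<alpha> + real r) (k - r) t * sqrt (w \<alpha> t)"
    proof -
      have "0 \<le> Laguerre (\<alpha> + real r) (k - r) t"
        by (rule order_trans[OF _ s2]) (use c2(1) in simp)
      moreover have "0 \<le> sqrt (fact k / Gamma (real k + \<alpha> + 1))"
        by (rule order_trans[OF _ s1]) (use c1(1) in simp)
      ultimately show ?thesis
        using c1(1) c2(1) by (intro mult_mono s1 s2 s3 mult_nonneg_nonneg) auto
    qed
    also have "\<dots> = (- 1) ^ r * laguerre_deriv \<alpha> r k t * sqrt (w \<alpha> t)"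
      using k by (simp add: laguerre_deriv_def)
    finally show "c * real N powr real r
      \<le> (- 1) ^ r * laguerre_deriv \<alpha> r k (1 / (12 * real N)) * sqrt (w \<alpha> (1 / (12 * real N)))"
      by (simp only: t_def)
  qed
qed

text \<open>The information operator maps the test function and its negative to 0, so the algorithm
  answers both with the same function and must miss one of them by at least the size of the
  derivative.\<close>

lemma err_lower:
  assumes \<alpha>: "0 \<le> \<alpha>" and s: "1 \<le> s" and \<mu>: "\<mu> > real r + 1 - recip s"
  shows "\<exists>c>0. \<forall>N \<psi> \<Omega> \<delta> p. 1 \<le> N \<longrightarrow> finite \<Omega> \<longrightarrow> card \<Omega> \<le> N \<longrightarrow>
      ennreal (c * real N powr (- (\<mu> + recip s - 1 - real r))) \<le> err \<alpha> r s \<mu> p \<delta> (\<psi>, \<Omega>)"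
proof -
  obtain c0 where c0: "0 < c0" "\<And>N k. 1 \<le> N \<Longrightarrow> N + r \<le> k \<Longrightarrow> k \<le> 3 * N + r \<Longrightarrow>
    c0 * real N powr real r \<le> (- 1) ^ r * laguerre_deriv \<alpha> r k (1 / (12 * real N)) * sqrt (w \<alpha> (1 / (12 * real N)))"
    using laguerre_deriv_lower[OF \<alpha>, of r] by metis
  \<comment> \<open>Normalizes the test function in the class: the indices are at most (3 + r) N,
    and there are at most 3 N of them.\<close>
  define m where "m = 1 / (real (3 + r) powr \<mu> * 3 powr recip s)"
  have m: "0 < m" by (simp add: m_def)
  have \<mu>0: "0 < \<mu>" using \<mu> recip_le_1[OF s] by simp
  show ?thesis
  proof (intro exI[of _ "m * c0"] conjI allI impI)
    show "0 < m * c0" using m c0 by simp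
    fix N :: nat and \<psi> :: "(nat \<Rightarrow> real) \<Rightarrow> real \<Rightarrow> real" and \<Omega> :: "nat set" and \<delta> and p :: ennreal
    assume N: "1 \<le> N" and \<Omega>: "finite \<Omega>" "card \<Omega> \<le> N"
    define t where "t = 1 / (12 * real N)"
    have t: "0 < t" using N by (simp add: t_def)
    define M where "M = m * real N powr (- \<mu> - recip s)"
    have M: "0 < M" using m N by (simp add: M_def)
    \<comment> \<open>The window has 2 N + 1 indices, so at least N survive the removal of \<Omega>,
      and all of them are of order N.\<close>
    define A where "A = {N + r..3 * N + r} - \<Omega>"
    have A: "finite A" by (simp add: A_def)
    have card_le: "card A \<le> 3 * N"
      using card_mono[of "{N + r..3 * N + r}" A] N by (simp add: A_def)
    have card_ge: "N \<le> card A"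
      using diff_card_le_card_Diff[OF \<Omega>(1), of "{N + r..3 * N + r}"] \<Omega>(2) by (simp add: A_def)
    have A0: "A \<noteq> {}" using card_ge N by auto
    \<comment> \<open>\<sigma> = 1 and \<sigma> = - 1 give the two competing functions; the factor
      (-1)^r cancels the sign of the r-th derivatives near 0.\<close>
    define f where "f = (\<lambda>\<sigma> t. \<Sum>k\<in>A. \<sigma> * (- 1) ^ r * M * laguerre_on \<alpha> k t)"
    have W: "f \<sigma> \<in> W_ball \<alpha> s \<mu>" and Gf: "G \<alpha> (f \<sigma>) = (\<lambda>k. if k \<in> A then \<sigma> * (- 1) ^ r * M else 0)"
      if \<sigma>: "\<bar>\<sigma>\<bar> = 1" for \<sigma>
    proof -
      have f_eq: "f \<sigma> = (\<lambda>t. \<Sum>k\<in>A. \<sigma> * (- 1) ^ r * M * laguerre_on \<alpha> k t)"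
        by (simp add: f_def)
      note L = laguerre_polynomial_L2w[OF \<alpha> A, of "\<lambda>_. \<sigma> * (- 1) ^ r * M", folded f_eq]
      show Gf: "G \<alpha> (f \<sigma>) = (\<lambda>k. if k \<in> A then \<sigma> * (- 1) ^ r * M else 0)" using L(2) .
      have "smooth_norm \<alpha> s \<mu> (f \<sigma>) \<le> ennreal ((real (3 + r) * real N) powr \<mu> * M * real (card A) powr recip s)"
        unfolding smooth_norm_def
      proof (rule ell_norm_finite_support_le[OF s A A0])
        fix k assume k: "k \<in> A"
        then have "max 1 k \<le> (3 + r) * N"
        proof -
          have "r \<le> r * N" using N by simp
          moreover have "k \<le> 3 * N + r" using k by (simp add: A_def)
          ultimately show ?thesis using N unfolding add_mult_distrib by linarith
        qed
        then have "real (max 1 k) \<le> real ((3 + r) * N)" by (rule of_nat_mono)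
        then have "real (max 1 k) powr \<mu> \<le> (real (3 + r) * real N) powr \<mu>"
          using \<mu>0 by (intro powr_mono2) (auto simp del: of_nat_max)
        then show "\<bar>real (max 1 k) powr \<mu> * \<bar>G \<alpha> (f \<sigma>) k\<bar>\<bar> \<le> (real (3 + r) * real N) powr \<mu> * M"
          using k \<sigma> M by (simp add: Gf abs_mult mult_right_mono)
      qed (use M in \<open>auto simp: Gf\<close>)
      also have "\<dots> \<le> ennreal 1"
      proof (rule ennreal_leI)
        have "real (card A) powr recip s \<le> (3 * real N) powr recip s"
          using card_le by (intro powr_mono2 recip_nonneg) auto
        then have "(real (3 + r) * real N) powr \<mu> * M * real (card A) powr recip s
          \<le> (real (3 + r) * real N) powr \<mu> * M * (3 * real N) powr recip s"
          using M by (intro mult_left_mono) auto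
        also have "\<dots> = m * (real (3 + r) powr \<mu> * 3 powr recip s) *
            (real N powr \<mu> * real N powr (- \<mu> - recip s) * real N powr recip s)"
          unfolding M_def powr_mult by (simp only: mult_ac)
        also have "real N powr \<mu> * real N powr (- \<mu> - recip s) * real N powr recip s = 1"
          using N by (simp flip: powr_add)
        also have "m * (real (3 + r) powr \<mu> * 3 powr recip s) * 1 = 1"
          unfolding m_def by simp
        finally show "(real (3 + r) * real N) powr \<mu> * M * real (card A) powr recip s \<le> 1" .
      qed
      finally show "f \<sigma> \<in> W_ball \<alpha> s \<mu>" using L(1) by (simp add: W_ball_def)
    qed
    define F where "F = (\<Sum>k\<in>A. (- 1) ^ r * M * laguerre_deriv \<alpha> r k t)"
    define y where "y = \<psi> (\<lambda>_. 0) t"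
    have err: "ennreal (\<bar>\<sigma> * F - y\<bar> * sqrt (w \<alpha> t)) \<le> err \<alpha> r s \<mu> p \<delta> (\<psi>, \<Omega>)" if \<sigma>: "\<bar>\<sigma>\<bar> = 1" for \<sigma>
    proof -
      have "proj \<Omega> (G \<alpha> (f \<sigma>)) k + 0 = 0" for k
        by (simp add: proj_def Gf[OF \<sigma>] A_def)
      moreover have "rth_deriv r (f \<sigma>) t = \<sigma> * F"
        unfolding f_def rth_deriv_laguerre_polynomial[OF t] F_def sum_distrib_left by (simp add: mult.assoc)
      ultimately have eq: "ennreal (\<bar>\<sigma> * F - y\<bar> * sqrt (w \<alpha> t))
        = ennreal \<bar>(rth_deriv r (f \<sigma>) t - \<psi> (\<lambda>k. proj \<Omega> (G \<alpha> (f \<sigma>)) k + (\<lambda>_. 0) k) t) * sqrt (w \<alpha> t)\<bar>"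
        by (simp add: y_def abs_mult w_nonneg)
      show ?thesis
        unfolding err_def prod.case C_norm_def eq
        using W[OF \<sigma>] t
        by (intro SUP_upper2[of "f \<sigma>"] SUP_upper2[of "\<lambda>_. 0"] SUP_upper2[of t]) (auto simp: ell_norm_zero)
    qed
    have "m * c0 * real N powr (- (\<mu> + recip s - 1 - real r)) = real N * (M * (c0 * real N powr real r))"
    proof -
      have "real N powr (- (\<mu> + recip s - 1 - real r)) = real N powr 1 * (real N powr (- \<mu> - recip s) * real N powr real r)"
        by (simp only: powr_add[symmetric]) (simp add: algebra_simps)
      then show ?thesis using N by (simp add: M_def)
    qed
    also have "\<dots> \<le> real (card A) * (M * (c0 * real N powr real r))"
      using card_ge M c0(1) by (intro mult_right_mono) auto
    also have "\<dots> = (\<Sum>k\<in>A. M * (c0 * real N powr real r))" by simp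
    also have "\<dots> \<le> (\<Sum>k\<in>A. M * ((- 1) ^ r * laguerre_deriv \<alpha> r k t * sqrt (w \<alpha> t)))"
      using M N unfolding t_def by (intro sum_mono mult_left_mono c0(2)) (auto simp: A_def)
    also have "\<dots> = F * sqrt (w \<alpha> t)"
      unfolding F_def sum_distrib_right by (intro sum.cong) auto
    also have "\<dots> \<le> max (\<bar>1 * F - y\<bar> * sqrt (w \<alpha> t)) (\<bar>- 1 * F - y\<bar> * sqrt (w \<alpha> t))"
    proof -
      \<comment> \<open>The points F and - F are 2 F apart, so no value \<open>y\<close> is closer
        than F to both.\<close>
      have "F \<le> \<bar>1 * F - y\<bar> \<or> F \<le> \<bar>- 1 * F - y\<bar>" by linarith
      then show ?thesis by (auto intro!: mult_right_mono simp: le_max_iff_disj w_nonneg)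
    qed
    finally have "ennreal (m * c0 * real N powr (- (\<mu> + recip s - 1 - real r)))
        \<le> max (ennreal (\<bar>1 * F - y\<bar> * sqrt (w \<alpha> t))) (ennreal (\<bar>- 1 * F - y\<bar> * sqrt (w \<alpha> t)))"
      by (metis ennreal_leI le_max_iff_disj)
    also have "\<dots> \<le> err \<alpha> r s \<mu> p \<delta> (\<psi>, \<Omega>)"
      using err[of 1] err[of "- 1"] by simp
    finally show "ennreal (m * c0 * real N powr (- (\<mu> + recip s - 1 - real r))) \<le> err \<alpha> r s \<mu> p \<delta> (\<psi>, \<Omega>)" .
  qed
qed

section \<open>Coupling of the noise level with N, and assembly of the estimates\<close>

text \<open>With \<open>x = \<delta> powr (- 1 / \<kappa>)\<close> the coupling reads a1 x \<le> N
  \<le> a2 x, while \<delta>^(e/\<kappa>) = x^(-e). The choice e = \<kappa> bounds \<delta> itself;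
  e = E compares the two forms of the rate.\<close>

lemma coupled_powr:
  assumes "coupled a\<^sub>1 a\<^sub>2 \<kappa> \<delta> N" and "0 < a\<^sub>1" "a\<^sub>1 \<le> a\<^sub>2" and \<kappa>: "0 < \<kappa>" and E: "0 < E"
  shows "\<delta> \<le> a\<^sub>2 powr \<kappa> * real N powr (- \<kappa>)"
    and "a\<^sub>1 powr E * real N powr (- E) \<le> \<delta> powr (E / \<kappa>)"
    and "\<delta> powr (E / \<kappa>) \<le> a\<^sub>2 powr E * real N powr (- E)"
proof -
  define x where "x = \<delta> powr (- 1 / \<kappa>)"
  have \<delta>: "0 < \<delta>" and N: "1 \<le> N" and x1: "a\<^sub>1 * x \<le> real N" and x2: "real N \<le> a\<^sub>2 * x"
    using assms(1) by (auto simp: coupled_def x_def)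
  have x: "0 < x" using \<delta> by (simp add: x_def)
  have a2: "0 < a\<^sub>2" using assms by simp
  have \<delta>x: "\<delta> powr (e / \<kappa>) = x powr (- e)" for e
    using \<kappa> by (simp add: x_def powr_powr)
  have up: "\<delta> powr (e / \<kappa>) \<le> a\<^sub>2 powr e * real N powr (- e)" if "0 < e" for e
  proof -
    have "real N powr e \<le> (a\<^sub>2 * x) powr e" using x2 that by (intro powr_mono2) auto
    also have "\<dots> = a\<^sub>2 powr e * x powr e" by (rule powr_mult)
    finally have "real N powr e \<le> a\<^sub>2 powr e * x powr e" .
    moreover have "1 / X \<le> b * (1 / Y)" if "0 < X" "0 < Y" "Y \<le> b * X" for X Y b :: real
      using that by (simp add: field_simps)
    ultimately show ?thesis
      unfolding \<delta>x powr_minus_divide using x N by simp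
  qed
  show "\<delta> powr (E / \<kappa>) \<le> a\<^sub>2 powr E * real N powr (- E)" by (rule up[OF E])
  show "\<delta> \<le> a\<^sub>2 powr \<kappa> * real N powr (- \<kappa>)" using up[OF \<kappa>] \<kappa> \<delta> by simp
  have "a\<^sub>1 powr E * x powr E = (a\<^sub>1 * x) powr E" by (rule powr_mult[symmetric])
  also have "\<dots> \<le> real N powr E" using x1 x assms(2) E by (intro powr_mono2) auto
  finally have "a\<^sub>1 powr E * x powr E \<le> real N powr E" .
  moreover have "b * (1 / Y) \<le> 1 / X" if "0 < X" "0 < Y" "b * X \<le> Y" for X Y b :: real
    using that by (simp add: field_simps)
  ultimately show "a\<^sub>1 powr E * real N powr (- E) \<le> \<delta> powr (E / \<kappa>)"
    unfolding \<delta>x powr_minus_divide using x N by simp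
qed

theorem theorem4p5:
  fixes \<alpha> \<mu> a\<^sub>1 a\<^sub>2 :: real and r :: nat and s p :: ennreal
  assumes "0 \<le> \<alpha>" and "1 \<le> r" and "1 \<le> s" and "1 \<le> p"
    and "\<mu> > real r + 1 - recip s"
    and "0 < a\<^sub>1" and "a\<^sub>1 \<le> a\<^sub>2"
  shows "(\<exists>c' c''. 0 < c' \<and> c' \<le> c'' \<and>
      (\<forall>\<delta> N. coupled a\<^sub>1 a\<^sub>2 (\<mu> + recip s - recip p) \<delta> N \<longrightarrow>
         ennreal (c' * \<delta> powr ((\<mu> + recip s - 1 - real r) / (\<mu> + recip s - recip p)))
           \<le> radius \<alpha> r s \<mu> p \<delta> N \<and>
         radius \<alpha> r s \<mu> p \<delta> N
           \<le> ennreal (c'' * \<delta> powr ((\<mu> + recip s - 1 - real r) / (\<mu> + recip s - recip p))) \<and>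
         c' * real N powr (- (\<mu> + recip s - 1 - real r))
           \<le> \<delta> powr ((\<mu> + recip s - 1 - real r) / (\<mu> + recip s - recip p)) \<and>
         \<delta> powr ((\<mu> + recip s - 1 - real r) / (\<mu> + recip s - recip p))
           \<le> c'' * real N powr (- (\<mu> + recip s - 1 - real r)))) \<and>
    (\<forall>\<theta>>0. \<theta> > \<mu> + recip s - 1 - real r \<longrightarrow>
      (\<forall>\<nu>\<in>S_class \<theta>. \<exists>c>0.
        \<forall>\<delta> N. coupled a\<^sub>1 a\<^sub>2 (\<mu> + recip s - recip p) \<delta> N \<longrightarrow>
          (psi_S \<alpha> r \<nu> N, {r..N}) \<in> Psi p N \<and>
          err \<alpha> r s \<mu> p \<delta> (psi_S \<alpha> r \<nu> N, {r..N})
            \<le> ennreal (c * \<delta> powr ((\<mu> + recip s - 1 - real r) / (\<mu> + recip s - recip p)))))"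
proof -
  define E where "E = \<mu> + recip s - 1 - real r"
  define \<kappa> where "\<kappa> = \<mu> + recip s - recip p"
  have E: "0 < E" using assms(5) by (simp add: E_def)
  \<comment> \<open>By the assumption on \<mu>, \<kappa> exceeds r + 1 - 1/p \<ge> r.\<close>
  have \<kappa>: "0 < \<kappa>" using assms(5) recip_le_1[OF assms(4)] assms(2) by (simp add: \<kappa>_def)
  have a2: "0 < a\<^sub>2" using assms by simp
  note cp = coupled_powr[OF _ assms(6,7) \<kappa> E]
  have cpN: "1 \<le> N" "0 \<le> \<delta>" if "coupled a\<^sub>1 a\<^sub>2 \<kappa> \<delta> N" for \<delta> N
    using that by (auto simp: coupled_def)
  have methods: "\<exists>c>0. \<forall>\<delta> N. coupled a\<^sub>1 a\<^sub>2 \<kappa> \<delta> N \<longrightarrow>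
      err \<alpha> r s \<mu> p \<delta> (psi_S \<alpha> r \<nu> N, {r..N}) \<le> ennreal (c * \<delta> powr (E / \<kappa>))"
    if \<theta>: "\<theta> > E" and \<nu>: "\<nu> \<in> S_class \<theta>" for \<theta> \<nu>
  proof -
    \<comment> \<open>The upper end of the coupling supplies the constant in the noise bound; the
      lower end then converts N^(-E) into a power of \<delta>.\<close>
    obtain c where c: "0 < c" "\<And>N \<delta>. 1 \<le> N \<Longrightarrow> 0 \<le> \<delta> \<Longrightarrow> \<delta> \<le> a\<^sub>2 powr \<kappa> * real N powr (- \<kappa>) \<Longrightarrow>
      err \<alpha> r s \<mu> p \<delta> (psi_S \<alpha> r \<nu> N, {r..N}) \<le> ennreal (c * real N powr (- E))"
      using psi_S_err[OF assms(1-5) _ \<theta>[unfolded E_def] \<nu>, of "a\<^sub>2 powr \<kappa>", folded E_def \<kappa>_def] a2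
      by auto
    show ?thesis
    proof (intro exI[of _ "c / a\<^sub>1 powr E"] conjI allI impI)
      show "0 < c / a\<^sub>1 powr E" using c(1) assms(6) by simp
      fix \<delta> N assume co: "coupled a\<^sub>1 a\<^sub>2 \<kappa> \<delta> N"
      have "c * real N powr (- E) \<le> c / a\<^sub>1 powr E * \<delta> powr (E / \<kappa>)"
        using mult_left_mono[OF cp(2)[OF co], of "c / a\<^sub>1 powr E"] c(1) assms(6) by simp
      then show "err \<alpha> r s \<mu> p \<delta> (psi_S \<alpha> r \<nu> N, {r..N}) \<le> ennreal (c / a\<^sub>1 powr E * \<delta> powr (E / \<kappa>))"
        by (rule order_trans[OF c(2)[OF cpN[OF co] cp(1)[OF co]] ennreal_leI])
    qed
  qed
  \<comment> \<open>Plain partial sums have no multiplier defect; they serve as the witness for the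
    upper bound on the radius.\<close>
  have one: "(\<lambda>_ _. 1) \<in> S_class (E + 1)" by (auto simp: S_class_def intro: exI[of _ 1])
  obtain cu where cu: "0 < cu" "\<And>\<delta> N. coupled a\<^sub>1 a\<^sub>2 \<kappa> \<delta> N \<Longrightarrow>
      err \<alpha> r s \<mu> p \<delta> (psi_S \<alpha> r (\<lambda>_ _. 1) N, {r..N}) \<le> ennreal (cu * \<delta> powr (E / \<kappa>))"
    using methods[OF _ one] by auto
  obtain cl where cl: "0 < cl" "\<And>N \<psi> \<Omega> \<delta>. 1 \<le> N \<Longrightarrow> finite \<Omega> \<Longrightarrow> card \<Omega> \<le> N \<Longrightarrow>
      ennreal (cl * real N powr (- E)) \<le> err \<alpha> r s \<mu> p \<delta> (\<psi>, \<Omega>)"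
    using err_lower[OF assms(1,3,5), folded E_def] by blast
  \<comment> \<open>Each constant serves two inequalities: the bound on the radius, and the
    comparison of \<delta>^(E/\<kappa>) with N^(-E).\<close>
  define c' where "c' = min (cl / a\<^sub>2 powr E) (a\<^sub>1 powr E)"
  define c'' where "c'' = max c' (max cu (a\<^sub>2 powr E))"
  have c': "0 < c'" using cl(1) assms(6) a2 by (simp add: c'_def)
  have main: "ennreal (c' * \<delta> powr (E / \<kappa>)) \<le> radius \<alpha> r s \<mu> p \<delta> N \<and>
      radius \<alpha> r s \<mu> p \<delta> N \<le> ennreal (c'' * \<delta> powr (E / \<kappa>)) \<and>
      c' * real N powr (- E) \<le> \<delta> powr (E / \<kappa>) \<and> \<delta> powr (E / \<kappa>) \<le> c'' * real N powr (- E)"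
    if co: "coupled a\<^sub>1 a\<^sub>2 \<kappa> \<delta> N" for \<delta> N
  proof (intro conjI)
    have "c' * \<delta> powr (E / \<kappa>) \<le> cl / a\<^sub>2 powr E * (a\<^sub>2 powr E * real N powr (- E))"
      using cl(1) a2 by (intro mult_mono cp(3)[OF co]) (auto simp: c'_def)
    also have "\<dots> = cl * real N powr (- E)" using a2 by simp
    finally have "ennreal (c' * \<delta> powr (E / \<kappa>)) \<le> ennreal (cl * real N powr (- E))" by (rule ennreal_leI)
    also have "\<dots> \<le> radius \<alpha> r s \<mu> p \<delta> N"
      unfolding radius_def by (intro INF_greatest) (auto simp: Psi_def intro: cl(2) cpN[OF co])
    finally show "ennreal (c' * \<delta> powr (E / \<kappa>)) \<le> radius \<alpha> r s \<mu> p \<delta> N" .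
    have "radius \<alpha> r s \<mu> p \<delta> N \<le> err \<alpha> r s \<mu> p \<delta> (psi_S \<alpha> r (\<lambda>_ _. 1) N, {r..N})"
      unfolding radius_def by (rule INF_lower[OF psi_S_Psi[OF assms(2)]])
    also have "\<dots> \<le> ennreal (cu * \<delta> powr (E / \<kappa>))" by (rule cu(2)[OF co])
    also have "\<dots> \<le> ennreal (c'' * \<delta> powr (E / \<kappa>))"
      by (intro ennreal_leI mult_right_mono) (auto simp: c''_def)
    finally show "radius \<alpha> r s \<mu> p \<delta> N \<le> ennreal (c'' * \<delta> powr (E / \<kappa>))" .
    have "c' * real N powr (- E) \<le> a\<^sub>1 powr E * real N powr (- E)"
      by (intro mult_right_mono) (auto simp: c'_def)
    then show "c' * real N powr (- E) \<le> \<delta> powr (E / \<kappa>)" using cp(2)[OF co] by linarith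
    have "a\<^sub>2 powr E * real N powr (- E) \<le> c'' * real N powr (- E)"
      by (intro mult_right_mono) (auto simp: c''_def)
    then show "\<delta> powr (E / \<kappa>) \<le> c'' * real N powr (- E)" using cp(3)[OF co] by linarith
  qed
  have c'c'': "c' \<le> c''" by (simp add: c''_def)
  show ?thesis
    unfolding E_def[symmetric] \<kappa>_def[symmetric]
  proof (rule conjI)
    show "\<exists>c' c''. 0 < c' \<and> c' \<le> c'' \<and> (\<forall>\<delta> N. coupled a\<^sub>1 a\<^sub>2 \<kappa> \<delta> N \<longrightarrow>
        ennreal (c' * \<delta> powr (E / \<kappa>)) \<le> radius \<alpha> r s \<mu> p \<delta> N \<and>
        radius \<alpha> r s \<mu> p \<delta> N \<le> ennreal (c'' * \<delta> powr (E / \<kappa>)) \<and>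
        c' * real N powr (- E) \<le> \<delta> powr (E / \<kappa>) \<and> \<delta> powr (E / \<kappa>) \<le> c'' * real N powr (- E))"
      by (intro exI[of _ c'] exI[of _ c''] conjI[OF c'] conjI[OF c'c''] allI impI main)
    show "\<forall>\<theta>>0. E < \<theta> \<longrightarrow> (\<forall>\<nu>\<in>S_class \<theta>. \<exists>c>0. \<forall>\<delta> N. coupled a\<^sub>1 a\<^sub>2 \<kappa> \<delta> N \<longrightarrow>
        (psi_S \<alpha> r \<nu> N, {r..N}) \<in> Psi p N \<and>
        err \<alpha> r s \<mu> p \<delta> (psi_S \<alpha> r \<nu> N, {r..N}) \<le> ennreal (c * \<delta> powr (E / \<kappa>)))"
    proof (intro allI impI ballI)
      fix \<theta> \<nu> assume "E < \<theta>" "\<nu> \<in> S_class \<theta>"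
      from methods[OF this] obtain c where "0 < c"
        "\<forall>\<delta> N. coupled a\<^sub>1 a\<^sub>2 \<kappa> \<delta> N \<longrightarrow>
          err \<alpha> r s \<mu> p \<delta> (psi_S \<alpha> r \<nu> N, {r..N}) \<le> ennreal (c * \<delta> powr (E / \<kappa>))"
        by blast
      then show "\<exists>c>0. \<forall>\<delta> N. coupled a\<^sub>1 a\<^sub>2 \<kappa> \<delta> N \<longrightarrow>
          (psi_S \<alpha> r \<nu> N, {r..N}) \<in> Psi p N \<and>
          err \<alpha> r s \<mu> p \<delta> (psi_S \<alpha> r \<nu> N, {r..N}) \<le> ennreal (c * \<delta> powr (E / \<kappa>))"
        by (intro exI[of _ c]) (auto intro: psi_S_Psi[OF assms(2)])
    qed
  qed
qed

end
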